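(* Let $R$ be a ring in $\mathscr V$. Then the theory $\mathrm{Mat}_R^{\mathrm{aff}}$ of left $R$-affine spaces and the theory $\mathrm{Mat}_{R^{\mathrm{op}}}^*$ of pointed right $R$-modules are commutants of one another over $\underline{\mathscr V}_R$.
   Context: $\mathscr V$ is a locally small cartesian closed category with equalizers, countable colimits, and intersections of countable families of strong subobjects; $\underline{\mathscr V}$ is $\mathscr V$ as a $\mathscr V$-category, with internal homs $\underline{\mathscr V}(V,W)$. Algebraic formulas below are to be read for generalized elements. \emph{Theories.} A theory (discretely finitary, enriched in $\mathscr V$) is a $\mathscr V$-category $\mathscr T$ whose objects are the natural numbers, equipped for each $n$ with morphisms $\pi_i:n\to1$ ($1\le i\le n$) exhibiting $n$ as a conical ($\mathscr V$-enriched) $n$-th power of $1$, with $\pi_1=\mathrm{id}$ if $n=1$. Morphisms of theories are identity-on-objects $\mathscr V$-functors preserving the designated $\pi_i$; $\mathrm{Th}$ is the resulting category. A $\mathscr T$-algebra is a $\mathscr V$-functor $A:\mathscr T\to\underline{\mathscr V}$ preserving conical finite powers, with carrier $|A|=A(1)$; it is normal if it sends the designated power $n$ of $1$ to the designated power $|A|^n$. $\mathscr T\text{-Alg}$ is the $\mathscr V$-category of $\mathscr T$-algebras, with hom-objects the objects of $\mathscr V$-natural transformations; limits in it are pointwise. \emph{Commutants.} For $X\in\mathscr V$, the full theory $\underline{\mathscr V}_X$ has $\underline{\mathscr V}_X(n,m)=\underline{\mathscr V}(X^n,X^m)$, composition as in $\underline{\mathscr V}$, and the product projections as designated $\pi_i$.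 A theory over $\underline{\mathscr V}_X$ is a theory $\mathscr T$ with a morphism $A:\mathscr T\to\underline{\mathscr V}_X$; it amounts to a $\mathscr T$-algebra $n\mapsto X^n$ with carrier $X$, also called $A$. Its commutant $\mathscr T^\perp$ is the theory with $\mathscr T^\perp(n,m)=\mathscr T\text{-Alg}(A^n,A^m)$, with composition as in $\mathscr T\text{-Alg}$; the forgetful morphisms $\mathscr T\text{-Alg}(A^n,A^m)\hookrightarrow\underline{\mathscr V}(X^n,X^m)$ make $\mathscr T^\perp$ a theory over $\underline{\mathscr V}_X$. Theories $\mathscr T,\mathscr U$ over $\underline{\mathscr V}_X$ are commutants of one another if $\mathscr T\cong\mathscr U^\perp$ and $\mathscr U\cong\mathscr T^\perp$ in $\mathrm{Th}/\underline{\mathscr V}_X$. \emph{Rings.} A rig in $\mathscr V$ is an object $R$ with a commutative monoid structure $(+,0)$ and a monoid structure $(\bullet,1)$ in $\mathscr V$ such that $\bullet$ preserves $+$ and $0$ in each variable separately; it is a ring in $\mathscr V$ if $(R,+,0)$ is an abelian group in $\mathscr V$. $R^{\mathrm{op}}$ has reversed multiplication, and right $R$-modules are left $R^{\mathrm{op}}$-modules. \emph{Affine spaces.} $\mathrm{Mat}_R$ is the theory with $\mathrm{Mat}_R(n,m)=R^{m\times n}$, composition given by matrix multiplication, identities the identity matrices, and designated projections the standard basis row vectors. $\mathrm{Mat}_R^{\mathrm{aff}}$ is its subtheory in which $\mathrm{Mat}_R^{\mathrm{aff}}(n,m)\hookrightarrow R^{m\times n}$ is the equalizer expressing that each row of the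 matrix sums to $1$. Normal $\mathrm{Mat}_R^{\mathrm{aff}}$-algebras are called left $R$-affine spaces. It is a theory over $\underline{\mathscr V}_R$ via the left $R$-affine space $R$, i.e. via $a\mapsto\big(x\mapsto(\sum_ia_{ji}x_i)_j\big)$. \emph{Pointed modules.} A pointed right $R$-module is a right $R$-module $M$ in $\mathscr V$ with a morphism $*:1\to M$ in $\mathscr V$. Pointed right $R$-modules are the normal algebras of the theory $\mathrm{Mat}_{R^{\mathrm{op}}}^*$ with $\mathrm{Mat}_{R^{\mathrm{op}}}^*(n,m)=(R^{1+n})^m$, where $u=(u_0,u_1,\dots,u_n)\in R^{1+n}=\mathrm{Mat}_{R^{\mathrm{op}}}^*(n,1)$ acts on a pointed right $R$-module $M$ as $x\mapsto *\,u_0+\sum_{i=1}^nx_iu_i:M^n\to M$; composition of $u\in(R^{1+n})^m$ and $v\in(R^{1+m})^\ell$ is by substitution: $(v\circ u)_{k0}=v_{k0}+\sum_ju_{j0}v_{kj}$, $(v\circ u)_{ki}=\sum_ju_{ji}v_{kj}$. It is a theory over $\underline{\mathscr V}_R$ via the pointed right $R$-module $(R,1)$, i.e. via the morphism $\Phi^R:\mathrm{Mat}_{R^{\mathrm{op}}}^*\to\underline{\mathscr V}_R$ sending $u\in R^{1+n}$ to $x\mapsto u_0+\sum_{i=1}^nx_iu_i$. *)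

theory Defs
  imports Main
begin

section \<open>The base category\<close>

text \<open>
  Objects and arrows form subsets of arbitrary types, so hom-collections are sets and every such
  category is locally small.
\<close>

record ('o, 'a) cat =
  Ob :: "'o set"
  Arr :: "'a set"
  Dom :: "'a \<Rightarrow> 'o"
  Cod :: "'a \<Rightarrow> 'o"
  Ide :: "'o \<Rightarrow> 'a"
  Comp :: "'a \<Rightarrow> 'a \<Rightarrow> 'a" (infixr "\<cdot>\<index>" 75)

definition hom :: "('o, 'a, 'z) cat_scheme \<Rightarrow> 'o \<Rightarrow> 'o \<Rightarrow> 'a set" where
  "hom V A B = {f \<in> Arr V. Dom V f = A \<and> Cod V f = B}"

locale category =
  fixes V :: "('o, 'a, 'z) cat_scheme" (structure)
  assumes Dom_Ob: "f \<in> Arr V \<Longrightarrow> Dom V f \<in> Ob V"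
    and Cod_Ob: "f \<in> Arr V \<Longrightarrow> Cod V f \<in> Ob V"
    and Ide_hom: "A \<in> Ob V \<Longrightarrow> Ide V A \<in> hom V A A"
    and Comp_hom: "f \<in> hom V A B \<Longrightarrow> g \<in> hom V B C \<Longrightarrow> g \<cdot> f \<in> hom V A C"
    and Comp_Ide_left: "f \<in> hom V A B \<Longrightarrow> Ide V B \<cdot> f = f"
    and Comp_Ide_right: "f \<in> hom V A B \<Longrightarrow> f \<cdot> Ide V A = f"
    and Comp_assoc:
      "f \<in> hom V A B \<Longrightarrow> g \<in> hom V B C \<Longrightarrow> h \<in> hom V C D \<Longrightarrow> (h \<cdot> g) \<cdot> f = h \<cdot> (g \<cdot> f)"

definition is_equalizer :: "('o, 'a, 'z) cat_scheme \<Rightarrow> 'a \<Rightarrow> 'a \<Rightarrow> 'a \<Rightarrow> bool" where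
  "is_equalizer V f g e \<longleftrightarrow>
     e \<in> Arr V \<and> Cod V e = Dom V f \<and> f \<cdot>\<^bsub>V\<^esub> e = g \<cdot>\<^bsub>V\<^esub> e \<and>
     (\<forall>h\<in>Arr V. Cod V h = Dom V f \<and> f \<cdot>\<^bsub>V\<^esub> h = g \<cdot>\<^bsub>V\<^esub> h \<longrightarrow>
        (\<exists>!k. k \<in> hom V (Dom V h) (Dom V e) \<and> e \<cdot>\<^bsub>V\<^esub> k = h))"

definition has_equalizers :: "('o, 'a, 'z) cat_scheme \<Rightarrow> bool" where
  "has_equalizers V \<longleftrightarrow> (\<forall>A B. \<forall>f\<in>hom V A B. \<forall>g\<in>hom V A B. \<exists>e. is_equalizer V f g e)"

definition is_functor ::
  "('i, 'j, 'y) cat_scheme \<Rightarrow> ('o, 'a, 'z) cat_scheme \<Rightarrow> ('i \<Rightarrow> 'o) \<Rightarrow> ('j \<Rightarrow> 'a) \<Rightarrow> bool" where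
  "is_functor J V Fo Fa \<longleftrightarrow>
     (\<forall>i\<in>Ob J. Fo i \<in> Ob V) \<and>
     (\<forall>i j. \<forall>f\<in>hom J i j. Fa f \<in> hom V (Fo i) (Fo j)) \<and>
     (\<forall>i\<in>Ob J. Fa (Ide J i) = Ide V (Fo i)) \<and>
     (\<forall>i j k. \<forall>f\<in>hom J i j. \<forall>g\<in>hom J j k. Fa (g \<cdot>\<^bsub>J\<^esub> f) = Fa g \<cdot>\<^bsub>V\<^esub> Fa f)"

definition is_cocone ::
  "('i, 'j, 'y) cat_scheme \<Rightarrow> ('o, 'a, 'z) cat_scheme \<Rightarrow> ('i \<Rightarrow> 'o) \<Rightarrow> ('j \<Rightarrow> 'a) \<Rightarrow>
     'o \<Rightarrow> ('i \<Rightarrow> 'a) \<Rightarrow> bool" where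
  "is_cocone J V Fo Fa L c \<longleftrightarrow>
     L \<in> Ob V \<and> (\<forall>i\<in>Ob J. c i \<in> hom V (Fo i) L) \<and>
     (\<forall>f\<in>Arr J. c (Cod J f) \<cdot>\<^bsub>V\<^esub> Fa f = c (Dom J f))"

definition is_colimit ::
  "('i, 'j, 'y) cat_scheme \<Rightarrow> ('o, 'a, 'z) cat_scheme \<Rightarrow> ('i \<Rightarrow> 'o) \<Rightarrow> ('j \<Rightarrow> 'a) \<Rightarrow>
     'o \<Rightarrow> ('i \<Rightarrow> 'a) \<Rightarrow> bool" where
  "is_colimit J V Fo Fa L c \<longleftrightarrow>
     is_cocone J V Fo Fa L c \<and>
     (\<forall>M d. is_cocone J V Fo Fa M d \<longrightarrow>
        (\<exists>!h. h \<in> hom V L M \<and> (\<forall>i\<in>Ob J. h \<cdot>\<^bsub>V\<^esub> c i = d i)))"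

text \<open>
  Up to isomorphism, the countable categories are those whose objects and arrows are sets of
  natural numbers.
\<close>

definition has_countable_colimits :: "('o, 'a, 'z) cat_scheme \<Rightarrow> bool" where
  "has_countable_colimits V \<longleftrightarrow>
     (\<forall>(J :: (nat, nat) cat) Fo Fa. category J \<and> is_functor J V Fo Fa \<longrightarrow>
        (\<exists>L c. is_colimit J V Fo Fa L c))"

definition is_mono :: "('o, 'a, 'z) cat_scheme \<Rightarrow> 'a \<Rightarrow> bool" where
  "is_mono V m \<longleftrightarrow> m \<in> Arr V \<and>
     (\<forall>W. \<forall>f\<in>hom V W (Dom V m). \<forall>g\<in>hom V W (Dom V m). m \<cdot>\<^bsub>V\<^esub> f = m \<cdot>\<^bsub>V\<^esub> g \<longrightarrow> f = g)"

definition is_epi :: "('o, 'a, 'z) cat_scheme \<Rightarrow> 'a \<Rightarrow> bool" where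
  "is_epi V e \<longleftrightarrow> e \<in> Arr V \<and>
     (\<forall>W. \<forall>f\<in>hom V (Cod V e) W. \<forall>g\<in>hom V (Cod V e) W. f \<cdot>\<^bsub>V\<^esub> e = g \<cdot>\<^bsub>V\<^esub> e \<longrightarrow> f = g)"

definition is_strong_mono :: "('o, 'a, 'z) cat_scheme \<Rightarrow> 'a \<Rightarrow> bool" where
  "is_strong_mono V m \<longleftrightarrow> is_mono V m \<and>
     (\<forall>e u v. is_epi V e \<and> u \<in> hom V (Dom V e) (Dom V m) \<and> v \<in> hom V (Cod V e) (Cod V m) \<and>
        m \<cdot>\<^bsub>V\<^esub> u = v \<cdot>\<^bsub>V\<^esub> e \<longrightarrow>
        (\<exists>d\<in>hom V (Cod V e) (Dom V m). d \<cdot>\<^bsub>V\<^esub> e = u \<and> m \<cdot>\<^bsub>V\<^esub> d = v))"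

definition factors_through :: "('o, 'a, 'z) cat_scheme \<Rightarrow> 'a \<Rightarrow> 'a \<Rightarrow> bool" where
  "factors_through V t m \<longleftrightarrow> (\<exists>h\<in>hom V (Dom V t) (Dom V m). m \<cdot>\<^bsub>V\<^esub> h = t)"

text \<open>An intersection of subobjects is their wide pullback.\<close>

definition is_intersection ::
  "('o, 'a, 'z) cat_scheme \<Rightarrow> 'o \<Rightarrow> 'i set \<Rightarrow> ('i \<Rightarrow> 'a) \<Rightarrow> 'a \<Rightarrow> bool" where
  "is_intersection V X I m s \<longleftrightarrow>
     is_mono V s \<and> Cod V s = X \<and> (\<forall>i\<in>I. factors_through V s (m i)) \<and>
     (\<forall>t\<in>Arr V. Cod V t = X \<and> (\<forall>i\<in>I. factors_through V t (m i)) \<longrightarrow> factors_through V t s)"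

definition has_countable_strong_intersections :: "('o, 'a, 'z) cat_scheme \<Rightarrow> bool" where
  "has_countable_strong_intersections V \<longleftrightarrow>
     (\<forall>X\<in>Ob V. \<forall>(I :: nat set) m. (\<forall>i\<in>I. is_strong_mono V (m i) \<and> Cod V (m i) = X) \<longrightarrow>
        (\<exists>s. is_intersection V X I m s))"

text \<open>Indices of finite powers run over \<open>0, \<dots>, n - 1\<close>.\<close>

definition is_power ::
  "('o, 'a, 'z) cat_scheme \<Rightarrow> nat \<Rightarrow> 'o \<Rightarrow> 'o \<Rightarrow> (nat \<Rightarrow> 'a) \<Rightarrow> bool" where
  "is_power V n X P p \<longleftrightarrow>
     P \<in> Ob V \<and> (\<forall>i<n. p i \<in> hom V P X) \<and>
     (\<forall>W\<in>Ob V. \<forall>f. (\<forall>i<n. f i \<in> hom V W X) \<longrightarrow>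
        (\<exists>!h. h \<in> hom V W P \<and> (\<forall>i<n. p i \<cdot>\<^bsub>V\<^esub> h = f i)))"

text \<open>
  \<open>Exp V A B\<close> is the internal hom from \<open>A\<close> to \<open>B\<close>; \<open>Pow V X n\<close> with the projections
  \<open>Proj V X n i\<close> is the designated \<open>n\<close>-th power of \<open>X\<close>.
\<close>

record ('o, 'a) ccc = "('o, 'a) cat" +
  One :: 'o
  Prd :: "'o \<Rightarrow> 'o \<Rightarrow> 'o"
  Fst :: "'o \<Rightarrow> 'o \<Rightarrow> 'a"
  Snd :: "'o \<Rightarrow> 'o \<Rightarrow> 'a"
  Exp :: "'o \<Rightarrow> 'o \<Rightarrow> 'o"
  Ev :: "'o \<Rightarrow> 'o \<Rightarrow> 'a"
  Pow :: "'o \<Rightarrow> nat \<Rightarrow> 'o"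
  Proj :: "'o \<Rightarrow> nat \<Rightarrow> nat \<Rightarrow> 'a"

definition bang :: "('o, 'a) ccc \<Rightarrow> 'o \<Rightarrow> 'a" where
  "bang V A = (THE f. f \<in> hom V A (One V))"

definition pair :: "('o, 'a) ccc \<Rightarrow> 'a \<Rightarrow> 'a \<Rightarrow> 'a" where
  "pair V f g =
     (THE h. h \<in> hom V (Dom V f) (Prd V (Cod V f) (Cod V g)) \<and>
        Fst V (Cod V f) (Cod V g) \<cdot>\<^bsub>V\<^esub> h = f \<and> Snd V (Cod V f) (Cod V g) \<cdot>\<^bsub>V\<^esub> h = g)"

definition tuple :: "('o, 'a) ccc \<Rightarrow> 'o \<Rightarrow> 'o \<Rightarrow> nat \<Rightarrow> (nat \<Rightarrow> 'a) \<Rightarrow> 'a" where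
  "tuple V W X n f =
     (THE h. h \<in> hom V W (Pow V X n) \<and> (\<forall>i<n. Proj V X n i \<cdot>\<^bsub>V\<^esub> h = f i))"

definition app :: "('o, 'a) ccc \<Rightarrow> 'o \<Rightarrow> 'o \<Rightarrow> 'a \<Rightarrow> 'a \<Rightarrow> 'a" where
  "app V A B g x = Ev V A B \<cdot>\<^bsub>V\<^esub> pair V g x"

definition transpose :: "('o, 'a) ccc \<Rightarrow> 'o \<Rightarrow> 'o \<Rightarrow> 'o \<Rightarrow> 'a \<Rightarrow> 'a" where
  "transpose V W A B f =
     (THE g. g \<in> hom V W (Exp V A B) \<and> app V A B (g \<cdot>\<^bsub>V\<^esub> Fst V W A) (Snd V W A) = f)"

locale cartesian_closed = category V
  for V :: "('o, 'a) ccc" (structure) +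
  assumes One_Ob: "One V \<in> Ob V"
    and terminal: "A \<in> Ob V \<Longrightarrow> \<exists>!f. f \<in> hom V A (One V)"
    and Prd_Ob: "A \<in> Ob V \<Longrightarrow> B \<in> Ob V \<Longrightarrow> Prd V A B \<in> Ob V"
    and Fst_hom: "A \<in> Ob V \<Longrightarrow> B \<in> Ob V \<Longrightarrow> Fst V A B \<in> hom V (Prd V A B) A"
    and Snd_hom: "A \<in> Ob V \<Longrightarrow> B \<in> Ob V \<Longrightarrow> Snd V A B \<in> hom V (Prd V A B) B"
    and product: "f \<in> hom V W A \<Longrightarrow> g \<in> hom V W B \<Longrightarrow>
      \<exists>!h. h \<in> hom V W (Prd V A B) \<and> Fst V A B \<cdot> h = f \<and> Snd V A B \<cdot> h = g"
    and Exp_Ob: "A \<in> Ob V \<Longrightarrow> B \<in> Ob V \<Longrightarrow> Exp V A B \<in> Ob V"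
    and Ev_hom: "A \<in> Ob V \<Longrightarrow> B \<in> Ob V \<Longrightarrow> Ev V A B \<in> hom V (Prd V (Exp V A B) A) B"
    and exponential: "W \<in> Ob V \<Longrightarrow> A \<in> Ob V \<Longrightarrow> f \<in> hom V (Prd V W A) B \<Longrightarrow>
      \<exists>!g. g \<in> hom V W (Exp V A B) \<and> app V A B (g \<cdot> Fst V W A) (Snd V W A) = f"
    and power: "X \<in> Ob V \<Longrightarrow> is_power V n X (Pow V X n) (Proj V X n)"
    and Pow_1: "X \<in> Ob V \<Longrightarrow> Pow V X 1 = X"
    and Proj_1: "X \<in> Ob V \<Longrightarrow> Proj V X 1 0 = Ide V X"

definition name :: "('o, 'a) ccc \<Rightarrow> 'o \<Rightarrow> 'o \<Rightarrow> 'a \<Rightarrow> 'a" where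
  "name V A B f = transpose V (One V) A B (f \<cdot>\<^bsub>V\<^esub> Snd V (One V) A)"


section \<open>Enriched categories\<close>

text \<open>
  \<open>vComp C a b c\<close> is the composition arrow from \<open>C(b,c) \<times> C(a,b)\<close> to \<open>C(a,c)\<close>. Enriched axioms
  are stated for generalized elements of the hom-objects; by the Yoneda lemma this amounts to the
  usual diagrams.
\<close>

record ('c, 'o, 'a) vcat =
  vOb :: "'c set"
  vHom :: "'c \<Rightarrow> 'c \<Rightarrow> 'o"
  vComp :: "'c \<Rightarrow> 'c \<Rightarrow> 'c \<Rightarrow> 'a"
  vId :: "'c \<Rightarrow> 'a"

definition vcomp ::
  "('o, 'a) ccc \<Rightarrow> ('c, 'o, 'a, 'z) vcat_scheme \<Rightarrow> 'c \<Rightarrow> 'c \<Rightarrow> 'c \<Rightarrow> 'a \<Rightarrow> 'a \<Rightarrow> 'a" where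
  "vcomp V C a b c g f = vComp C a b c \<cdot>\<^bsub>V\<^esub> pair V g f"

definition is_vcat :: "('o, 'a) ccc \<Rightarrow> ('c, 'o, 'a, 'z) vcat_scheme \<Rightarrow> bool" where
  "is_vcat V C \<longleftrightarrow>
     (\<forall>a\<in>vOb C. \<forall>b\<in>vOb C. vHom C a b \<in> Ob V) \<and>
     (\<forall>a\<in>vOb C. vId C a \<in> hom V (One V) (vHom C a a)) \<and>
     (\<forall>a\<in>vOb C. \<forall>b\<in>vOb C. \<forall>c\<in>vOb C.
        vComp C a b c \<in> hom V (Prd V (vHom C b c) (vHom C a b)) (vHom C a c)) \<and>
     (\<forall>a\<in>vOb C. \<forall>b\<in>vOb C. \<forall>W\<in>Ob V. \<forall>f\<in>hom V W (vHom C a b).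
        vcomp V C a a b f (vId C a \<cdot>\<^bsub>V\<^esub> bang V W) = f \<and>
        vcomp V C a b b (vId C b \<cdot>\<^bsub>V\<^esub> bang V W) f = f) \<and>
     (\<forall>a\<in>vOb C. \<forall>b\<in>vOb C. \<forall>c\<in>vOb C. \<forall>d\<in>vOb C. \<forall>W\<in>Ob V.
        \<forall>f\<in>hom V W (vHom C a b). \<forall>g\<in>hom V W (vHom C b c). \<forall>h\<in>hom V W (vHom C c d).
        vcomp V C a b d (vcomp V C b c d h g) f = vcomp V C a c d h (vcomp V C a b c g f))"

definition self :: "('o, 'a) ccc \<Rightarrow> ('o, 'o, 'a) vcat" where
  "self V =
     \<lparr>vOb = Ob V,
      vHom = Exp V,
      vComp = (\<lambda>A B C.
        let G = Exp V B C; F = Exp V A B; W = Prd V (Prd V G F) A;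
            g = Fst V G F \<cdot>\<^bsub>V\<^esub> Fst V (Prd V G F) A;
            f = Snd V G F \<cdot>\<^bsub>V\<^esub> Fst V (Prd V G F) A;
            x = Snd V (Prd V G F) A
        in transpose V (Prd V G F) A C (app V B C g (app V A B f x))),
      vId = (\<lambda>A. name V A A (Ide V A))\<rparr>"

record ('c, 'd, 'a) vfun =
  fOb :: "'c \<Rightarrow> 'd"
  fHom :: "'c \<Rightarrow> 'c \<Rightarrow> 'a"

definition is_vfun ::
  "('o, 'a) ccc \<Rightarrow> ('c, 'o, 'a, 'y) vcat_scheme \<Rightarrow> ('d, 'o, 'a, 'z) vcat_scheme \<Rightarrow>
     ('c, 'd, 'a) vfun \<Rightarrow> bool" where
  "is_vfun V C D F \<longleftrightarrow>
     (\<forall>a\<in>vOb C. fOb F a \<in> vOb D) \<and>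
     (\<forall>a\<in>vOb C. \<forall>b\<in>vOb C. fHom F a b \<in> hom V (vHom C a b) (vHom D (fOb F a) (fOb F b))) \<and>
     (\<forall>a\<in>vOb C. fHom F a a \<cdot>\<^bsub>V\<^esub> vId C a = vId D (fOb F a)) \<and>
     (\<forall>a\<in>vOb C. \<forall>b\<in>vOb C. \<forall>c\<in>vOb C. \<forall>W\<in>Ob V.
        \<forall>f\<in>hom V W (vHom C a b). \<forall>g\<in>hom V W (vHom C b c).
        fHom F a c \<cdot>\<^bsub>V\<^esub> vcomp V C a b c g f =
        vcomp V D (fOb F a) (fOb F b) (fOb F c) (fHom F b c \<cdot>\<^bsub>V\<^esub> g) (fHom F a b \<cdot>\<^bsub>V\<^esub> f))"

text \<open>
  A family \<open>p i : 1 \<rightarrow> C(P,X)\<close> for \<open>i < n\<close> exhibits \<open>P\<close> as a conical \<open>n\<close>-th power of \<open>X\<close> if every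
  \<open>C(Y,P)\<close>, with the arrows \<open>C(Y,p i)\<close>, is an \<open>n\<close>-th power of \<open>C(Y,X)\<close>.
\<close>

definition is_conical_power ::
  "('o, 'a) ccc \<Rightarrow> ('c, 'o, 'a, 'z) vcat_scheme \<Rightarrow> nat \<Rightarrow> 'c \<Rightarrow> 'c \<Rightarrow> (nat \<Rightarrow> 'a) \<Rightarrow> bool" where
  "is_conical_power V C n X P p \<longleftrightarrow>
     X \<in> vOb C \<and> P \<in> vOb C \<and> (\<forall>i<n. p i \<in> hom V (One V) (vHom C P X)) \<and>
     (\<forall>Y\<in>vOb C. is_power V n (vHom C Y X) (vHom C Y P)
        (\<lambda>i. vcomp V C Y P X (p i \<cdot>\<^bsub>V\<^esub> bang V (vHom C Y P)) (Ide V (vHom C Y P))))"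

definition preserves_conical_powers ::
  "('o, 'a) ccc \<Rightarrow> ('c, 'o, 'a, 'y) vcat_scheme \<Rightarrow> ('d, 'o, 'a, 'z) vcat_scheme \<Rightarrow>
     ('c, 'd, 'a) vfun \<Rightarrow> bool" where
  "preserves_conical_powers V C D F \<longleftrightarrow>
     (\<forall>n X P p. is_conical_power V C n X P p \<longrightarrow>
        is_conical_power V D n (fOb F X) (fOb F P) (\<lambda>i. fHom F P X \<cdot>\<^bsub>V\<^esub> p i))"

text \<open>
  \<open>is_vnat V C D A B W p\<close>: the arrows \<open>p c : W \<rightarrow> D(A c, B c)\<close> form a family, parametrized by \<open>W\<close>,
  of V-natural transformations; an object of V-natural transformations represents such families,
  i.e. it is the end of \<open>D(A c, B c)\<close>.
\<close>

definition is_vnat ::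
  "('o, 'a) ccc \<Rightarrow> ('c, 'o, 'a, 'y) vcat_scheme \<Rightarrow> ('d, 'o, 'a, 'z) vcat_scheme \<Rightarrow>
     ('c, 'd, 'a) vfun \<Rightarrow> ('c, 'd, 'a) vfun \<Rightarrow> 'o \<Rightarrow> ('c \<Rightarrow> 'a) \<Rightarrow> bool" where
  "is_vnat V C D A B W p \<longleftrightarrow>
     W \<in> Ob V \<and> (\<forall>c\<in>vOb C. p c \<in> hom V W (vHom D (fOb A c) (fOb B c))) \<and>
     (\<forall>b\<in>vOb C. \<forall>c\<in>vOb C.
        let H = vHom C b c; h = Fst V H W; w = Snd V H W in
        vcomp V D (fOb A b) (fOb B b) (fOb B c) (fHom B b c \<cdot>\<^bsub>V\<^esub> h) (p b \<cdot>\<^bsub>V\<^esub> w) =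
        vcomp V D (fOb A b) (fOb A c) (fOb B c) (p c \<cdot>\<^bsub>V\<^esub> w) (fHom A b c \<cdot>\<^bsub>V\<^esub> h))"

definition is_nat_object ::
  "('o, 'a) ccc \<Rightarrow> ('c, 'o, 'a, 'y) vcat_scheme \<Rightarrow> ('d, 'o, 'a, 'z) vcat_scheme \<Rightarrow>
     ('c, 'd, 'a) vfun \<Rightarrow> ('c, 'd, 'a) vfun \<Rightarrow> 'o \<Rightarrow> ('c \<Rightarrow> 'a) \<Rightarrow> bool" where
  "is_nat_object V C D A B E p \<longleftrightarrow>
     is_vnat V C D A B E p \<and>
     (\<forall>W q. is_vnat V C D A B W q \<longrightarrow>
        (\<exists>!h. h \<in> hom V W E \<and> (\<forall>c\<in>vOb C. p c \<cdot>\<^bsub>V\<^esub> h = q c)))"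


section \<open>Theories and their algebras\<close>

text \<open>
  \<open>tProj T n i\<close>, for \<open>i < n\<close>, is the designated projection from \<open>n\<close> to \<open>1\<close>, as an arrow from the
  terminal object to \<open>T(n,1)\<close>.
\<close>

record ('o, 'a) thy = "(nat, 'o, 'a) vcat" +
  tProj :: "nat \<Rightarrow> nat \<Rightarrow> 'a"

definition is_theory :: "('o, 'a) ccc \<Rightarrow> ('o, 'a) thy \<Rightarrow> bool" where
  "is_theory V T \<longleftrightarrow>
     is_vcat V T \<and> vOb T = UNIV \<and> (\<forall>n. is_conical_power V T n 1 n (tProj T n)) \<and>
     tProj T 1 0 = vId T 1"

text \<open>A morphism of theories is given by its actions on hom-objects.\<close>

definition is_theory_morphism ::
  "('o, 'a) ccc \<Rightarrow> ('o, 'a) thy \<Rightarrow> ('o, 'a) thy \<Rightarrow> (nat \<Rightarrow> nat \<Rightarrow> 'a) \<Rightarrow> bool" where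
  "is_theory_morphism V T U F \<longleftrightarrow>
     is_vfun V T U \<lparr>fOb = (\<lambda>n. n), fHom = F\<rparr> \<and>
     (\<forall>n. \<forall>i<n. F n 1 \<cdot>\<^bsub>V\<^esub> tProj T n i = tProj U n i)"

definition is_algebra ::
  "('o, 'a) ccc \<Rightarrow> ('o, 'a) thy \<Rightarrow> (nat, 'o, 'a) vfun \<Rightarrow> bool" where
  "is_algebra V T A \<longleftrightarrow> is_vfun V T (self V) A \<and> preserves_conical_powers V T (self V) A"

text \<open>
  The object of V-natural transformations between two algebras, with its components, is
  determined up to isomorphism; one is chosen. Generalized elements \<open>W \<rightarrow> T-Alg(A,B)\<close> are
  specified through their components by \<open>alg_hom_elem\<close>.
\<close>

definition alg_end ::
  "('o, 'a) ccc \<Rightarrow> ('o, 'a) thy \<Rightarrow> (nat, 'o, 'a) vfun \<Rightarrow> (nat, 'o, 'a) vfun \<Rightarrow>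
     'o \<times> (nat \<Rightarrow> 'a)" where
  "alg_end V T A B = (SOME (E, p). is_nat_object V T (self V) A B E p)"

definition alg_hom ::
  "('o, 'a) ccc \<Rightarrow> ('o, 'a) thy \<Rightarrow> (nat, 'o, 'a) vfun \<Rightarrow> (nat, 'o, 'a) vfun \<Rightarrow> 'o" where
  "alg_hom V T A B = fst (alg_end V T A B)"

definition alg_component ::
  "('o, 'a) ccc \<Rightarrow> ('o, 'a) thy \<Rightarrow> (nat, 'o, 'a) vfun \<Rightarrow> (nat, 'o, 'a) vfun \<Rightarrow> nat \<Rightarrow> 'a" where
  "alg_component V T A B = snd (alg_end V T A B)"

definition alg_hom_elem ::
  "('o, 'a) ccc \<Rightarrow> ('o, 'a) thy \<Rightarrow> (nat, 'o, 'a) vfun \<Rightarrow> (nat, 'o, 'a) vfun \<Rightarrow>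
     'o \<Rightarrow> (nat \<Rightarrow> 'a) \<Rightarrow> 'a" where
  "alg_hom_elem V T A B W q =
     (THE h. h \<in> hom V W (alg_hom V T A B) \<and> (\<forall>k. alg_component V T A B k \<cdot>\<^bsub>V\<^esub> h = q k))"

definition alg_cat ::
  "('o, 'a) ccc \<Rightarrow> ('o, 'a) thy \<Rightarrow> ((nat, 'o, 'a) vfun, 'o, 'a) vcat" where
  "alg_cat V T =
     \<lparr>vOb = {A. is_algebra V T A},
      vHom = alg_hom V T,
      vComp = (\<lambda>A B C.
        let G = alg_hom V T B C; F = alg_hom V T A B in
        alg_hom_elem V T A C (Prd V G F)
          (\<lambda>k. vcomp V (self V) (fOb A k) (fOb B k) (fOb C k)
             (alg_component V T B C k \<cdot>\<^bsub>V\<^esub> Fst V G F) (alg_component V T A B k \<cdot>\<^bsub>V\<^esub> Snd V G F))),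
      vId = (\<lambda>A. alg_hom_elem V T A A (One V) (\<lambda>k. vId (self V) (fOb A k)))\<rparr>"

text \<open>The pointwise power \<open>A\<^sup>n\<close> in \<open>T-Alg\<close>, and its projections to \<open>A = A\<^sup>1\<close>.\<close>

definition alg_pow ::
  "('o, 'a) ccc \<Rightarrow> ('o, 'a) thy \<Rightarrow> (nat, 'o, 'a) vfun \<Rightarrow> nat \<Rightarrow> (nat, 'o, 'a) vfun" where
  "alg_pow V T A n =
     \<lparr>fOb = (\<lambda>k. Pow V (fOb A k) n),
      fHom = (\<lambda>j k.
        let H = vHom T j k; P = Pow V (fOb A j) n; Q = Pow V (fOb A k) n in
        transpose V H P Q (tuple V (Prd V H P) (fOb A k) n
          (\<lambda>i. app V (fOb A j) (fOb A k)
             (fHom A j k \<cdot>\<^bsub>V\<^esub> Fst V H P) (Proj V (fOb A j) n i \<cdot>\<^bsub>V\<^esub> Snd V H P))))\<rparr>"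

definition alg_proj ::
  "('o, 'a) ccc \<Rightarrow> ('o, 'a) thy \<Rightarrow> (nat, 'o, 'a) vfun \<Rightarrow> nat \<Rightarrow> nat \<Rightarrow> 'a" where
  "alg_proj V T A n i =
     alg_hom_elem V T (alg_pow V T A n) (alg_pow V T A 1) (One V)
       (\<lambda>k. name V (Pow V (fOb A k) n) (fOb A k) (Proj V (fOb A k) n i))"


section \<open>Commutants\<close>

definition full_theory :: "('o, 'a) ccc \<Rightarrow> 'o \<Rightarrow> ('o, 'a) thy" where
  "full_theory V X =
     \<lparr>vOb = UNIV,
      vHom = (\<lambda>n m. vHom (self V) (Pow V X n) (Pow V X m)),
      vComp = (\<lambda>n m l. vComp (self V) (Pow V X n) (Pow V X m) (Pow V X l)),
      vId = (\<lambda>n. vId (self V) (Pow V X n)),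
      tProj = (\<lambda>n i. name V (Pow V X n) X (Proj V X n i))\<rparr>"

text \<open>A theory over \<open>full_theory V X\<close> is a theory \<open>T\<close> with a morphism \<open>\<alpha>\<close>.\<close>

type_synonym ('o, 'a) over_thy = "('o, 'a) thy \<times> (nat \<Rightarrow> nat \<Rightarrow> 'a)"

definition is_theory_over :: "('o, 'a) ccc \<Rightarrow> 'o \<Rightarrow> ('o, 'a) over_thy \<Rightarrow> bool" where
  "is_theory_over V X = (\<lambda>(T, \<alpha>). is_theory V T \<and> is_theory_morphism V T (full_theory V X) \<alpha>)"

definition is_morphism_over ::
  "('o, 'a) ccc \<Rightarrow> ('o, 'a) over_thy \<Rightarrow> ('o, 'a) over_thy \<Rightarrow> (nat \<Rightarrow> nat \<Rightarrow> 'a) \<Rightarrow> bool" where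
  "is_morphism_over V = (\<lambda>(T, \<alpha>) (U, \<beta>) F.
     is_theory_morphism V T U F \<and> (\<forall>n m. \<beta> n m \<cdot>\<^bsub>V\<^esub> F n m = \<alpha> n m))"

definition isomorphic_over ::
  "('o, 'a) ccc \<Rightarrow> 'o \<Rightarrow> ('o, 'a) over_thy \<Rightarrow> ('o, 'a) over_thy \<Rightarrow> bool" where
  "isomorphic_over V X T U \<longleftrightarrow>
     is_theory_over V X T \<and> is_theory_over V X U \<and>
     (\<exists>F G. is_morphism_over V T U F \<and> is_morphism_over V U T G \<and>
        (\<forall>n m. G n m \<cdot>\<^bsub>V\<^esub> F n m = Ide V (vHom (fst T) n m) \<and>
               F n m \<cdot>\<^bsub>V\<^esub> G n m = Ide V (vHom (fst U) n m)))"

definition over_algebra ::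
  "('o, 'a) ccc \<Rightarrow> 'o \<Rightarrow> (nat \<Rightarrow> nat \<Rightarrow> 'a) \<Rightarrow> (nat, 'o, 'a) vfun" where
  "over_algebra V X \<alpha> = \<lparr>fOb = Pow V X, fHom = \<alpha>\<rparr>"

text \<open>
  The morphism to \<open>full_theory V X\<close> takes components at \<open>1\<close>; it has the right codomain because
  \<open>A\<^sup>n(1) = Pow V (Pow V X 1) n = Pow V X n\<close>.
\<close>

definition commutant :: "('o, 'a) ccc \<Rightarrow> 'o \<Rightarrow> ('o, 'a) over_thy \<Rightarrow> ('o, 'a) over_thy" where
  "commutant V X = (\<lambda>(T, \<alpha>).
     let A = over_algebra V X \<alpha>; P = alg_pow V T A; C = alg_cat V T in
     (\<lparr>vOb = UNIV,
       vHom = (\<lambda>n m. vHom C (P n) (P m)),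
       vComp = (\<lambda>n m l. vComp C (P n) (P m) (P l)),
       vId = (\<lambda>n. vId C (P n)),
       tProj = alg_proj V T A\<rparr>,
      \<lambda>n m. alg_component V T (P n) (P m) 1))"

definition mutual_commutants ::
  "('o, 'a) ccc \<Rightarrow> 'o \<Rightarrow> ('o, 'a) over_thy \<Rightarrow> ('o, 'a) over_thy \<Rightarrow> bool" where
  "mutual_commutants V X T U \<longleftrightarrow>
     isomorphic_over V X T (commutant V X U) \<and> isomorphic_over V X U (commutant V X T)"


section \<open>Rings\<close>

record ('o, 'a) rig =
  Car :: 'o
  Add :: 'a
  Zero :: 'a
  Mul :: 'a
  Unit :: 'a

text \<open>
  Operations on generalized elements \<open>W \<rightarrow> R\<close>; the stage \<open>W\<close> is an argument only for constants
  and for sums, which may be empty.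
\<close>

definition radd :: "('o, 'a) ccc \<Rightarrow> ('o, 'a) rig \<Rightarrow> 'a \<Rightarrow> 'a \<Rightarrow> 'a" where
  "radd V R a b = Add R \<cdot>\<^bsub>V\<^esub> pair V a b"

definition rmul :: "('o, 'a) ccc \<Rightarrow> ('o, 'a) rig \<Rightarrow> 'a \<Rightarrow> 'a \<Rightarrow> 'a" where
  "rmul V R a b = Mul R \<cdot>\<^bsub>V\<^esub> pair V a b"

definition rzero :: "('o, 'a) ccc \<Rightarrow> ('o, 'a) rig \<Rightarrow> 'o \<Rightarrow> 'a" where
  "rzero V R W = Zero R \<cdot>\<^bsub>V\<^esub> bang V W"

definition rone :: "('o, 'a) ccc \<Rightarrow> ('o, 'a) rig \<Rightarrow> 'o \<Rightarrow> 'a" where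
  "rone V R W = Unit R \<cdot>\<^bsub>V\<^esub> bang V W"

primrec radd_upto :: "('o, 'a) ccc \<Rightarrow> ('o, 'a) rig \<Rightarrow> 'o \<Rightarrow> nat \<Rightarrow> (nat \<Rightarrow> 'a) \<Rightarrow> 'a" where
  "radd_upto V R W 0 f = rzero V R W"
| "radd_upto V R W (Suc n) f = radd V R (radd_upto V R W n f) (f n)"

locale rig_in = cartesian_closed V
  for V :: "('o, 'a) ccc" (structure) and R :: "('o, 'a) rig" +
  assumes Car_Ob: "Car R \<in> Ob V"
    and Add_hom: "Add R \<in> hom V (Prd V (Car R) (Car R)) (Car R)"
    and Zero_hom: "Zero R \<in> hom V (One V) (Car R)"
    and Mul_hom: "Mul R \<in> hom V (Prd V (Car R) (Car R)) (Car R)"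
    and Unit_hom: "Unit R \<in> hom V (One V) (Car R)"
    and add_assoc: "a \<in> hom V W (Car R) \<Longrightarrow> b \<in> hom V W (Car R) \<Longrightarrow> c \<in> hom V W (Car R) \<Longrightarrow>
      radd V R (radd V R a b) c = radd V R a (radd V R b c)"
    and add_commute: "a \<in> hom V W (Car R) \<Longrightarrow> b \<in> hom V W (Car R) \<Longrightarrow> radd V R a b = radd V R b a"
    and add_zero: "a \<in> hom V W (Car R) \<Longrightarrow> radd V R a (rzero V R W) = a"
    and mul_assoc: "a \<in> hom V W (Car R) \<Longrightarrow> b \<in> hom V W (Car R) \<Longrightarrow> c \<in> hom V W (Car R) \<Longrightarrow>
      rmul V R (rmul V R a b) c = rmul V R a (rmul V R b c)"
    and mul_one: "a \<in> hom V W (Car R) \<Longrightarrow> rmul V R a (rone V R W) = a"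
    and one_mul: "a \<in> hom V W (Car R) \<Longrightarrow> rmul V R (rone V R W) a = a"
    and mul_add: "a \<in> hom V W (Car R) \<Longrightarrow> b \<in> hom V W (Car R) \<Longrightarrow> c \<in> hom V W (Car R) \<Longrightarrow>
      rmul V R a (radd V R b c) = radd V R (rmul V R a b) (rmul V R a c)"
    and add_mul: "a \<in> hom V W (Car R) \<Longrightarrow> b \<in> hom V W (Car R) \<Longrightarrow> c \<in> hom V W (Car R) \<Longrightarrow>
      rmul V R (radd V R a b) c = radd V R (rmul V R a c) (rmul V R b c)"
    and mul_zero: "a \<in> hom V W (Car R) \<Longrightarrow> rmul V R a (rzero V R W) = rzero V R W"
    and zero_mul: "a \<in> hom V W (Car R) \<Longrightarrow> rmul V R (rzero V R W) a = rzero V R W"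

locale ring_in = rig_in +
  assumes neg: "\<exists>neg\<in>hom V (Car R) (Car R). \<forall>W. \<forall>a\<in>hom V W (Car R).
    radd V R a (neg \<cdot> a) = rzero V R W"


section \<open>Matrices and affine spaces\<close>

text \<open>The object \<open>R\<^sup>m\<^sup>\<times>\<^sup>n\<close> of matrices with \<open>m\<close> rows and \<open>n\<close> columns is taken as \<open>(R\<^sup>n)\<^sup>m\<close>.\<close>

definition mat_obj :: "('o, 'a) ccc \<Rightarrow> ('o, 'a) rig \<Rightarrow> nat \<Rightarrow> nat \<Rightarrow> 'o" where
  "mat_obj V R n m = Pow V (Pow V (Car R) n) m"

definition mat_of ::
  "('o, 'a) ccc \<Rightarrow> ('o, 'a) rig \<Rightarrow> 'o \<Rightarrow> nat \<Rightarrow> nat \<Rightarrow> (nat \<Rightarrow> nat \<Rightarrow> 'a) \<Rightarrow> 'a" where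
  "mat_of V R W n m a = tuple V W (Pow V (Car R) n) m (\<lambda>j. tuple V W (Car R) n (\<lambda>i. a j i))"

definition entry ::
  "('o, 'a) ccc \<Rightarrow> ('o, 'a) rig \<Rightarrow> nat \<Rightarrow> nat \<Rightarrow> 'a \<Rightarrow> nat \<Rightarrow> nat \<Rightarrow> 'a" where
  "entry V R n m u j i = Proj V (Car R) n i \<cdot>\<^bsub>V\<^esub> Proj V (Pow V (Car R) n) m j \<cdot>\<^bsub>V\<^esub> u"

definition Mat :: "('o, 'a) ccc \<Rightarrow> ('o, 'a) rig \<Rightarrow> ('o, 'a) thy" where
  "Mat V R =
     \<lparr>vOb = UNIV,
      vHom = mat_obj V R,
      vComp = (\<lambda>n m l.
        let B = mat_obj V R m l; A = mat_obj V R n m; W = Prd V B A;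
            b = entry V R m l (Fst V B A); a = entry V R n m (Snd V B A)
        in mat_of V R W n l (\<lambda>k i. radd_upto V R W m (\<lambda>j. rmul V R (b k j) (a j i)))),
      vId = (\<lambda>n. mat_of V R (One V) n n
        (\<lambda>j i. if j = i then rone V R (One V) else rzero V R (One V))),
      tProj = (\<lambda>n i. mat_of V R (One V) n 1
        (\<lambda>_ i'. if i' = i then rone V R (One V) else rzero V R (One V)))\<rparr>"

definition Mat_act :: "('o, 'a) ccc \<Rightarrow> ('o, 'a) rig \<Rightarrow> nat \<Rightarrow> nat \<Rightarrow> 'a" where
  "Mat_act V R n m =
     (let A = mat_obj V R n m; X = Pow V (Car R) n; W = Prd V A X;
          a = entry V R n m (Fst V A X); x = (\<lambda>i. Proj V (Car R) n i \<cdot>\<^bsub>V\<^esub> Snd V A X)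
      in transpose V A X (Pow V (Car R) m)
           (tuple V W (Car R) m (\<lambda>j. radd_upto V R W n (\<lambda>i. rmul V R (a j i) (x i)))))"

definition row_sums :: "('o, 'a) ccc \<Rightarrow> ('o, 'a) rig \<Rightarrow> nat \<Rightarrow> nat \<Rightarrow> 'a" where
  "row_sums V R n m =
     (let A = mat_obj V R n m; a = entry V R n m (Ide V A)
      in tuple V A (Car R) m (\<lambda>j. radd_upto V R A n (\<lambda>i. a j i)))"

definition all_ones :: "('o, 'a) ccc \<Rightarrow> ('o, 'a) rig \<Rightarrow> nat \<Rightarrow> nat \<Rightarrow> 'a" where
  "all_ones V R n m =
     (let A = mat_obj V R n m in tuple V A (Car R) m (\<lambda>j. rone V R A))"

definition aff_incl :: "('o, 'a) ccc \<Rightarrow> ('o, 'a) rig \<Rightarrow> nat \<Rightarrow> nat \<Rightarrow> 'a" where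
  "aff_incl V R n m = (SOME e. is_equalizer V (row_sums V R n m) (all_ones V R n m) e)"

definition factor :: "('o, 'a) ccc \<Rightarrow> 'a \<Rightarrow> 'a \<Rightarrow> 'a" where
  "factor V e f = (THE h. h \<in> hom V (Dom V f) (Dom V e) \<and> e \<cdot>\<^bsub>V\<^esub> h = f)"

definition Mat_aff :: "('o, 'a) ccc \<Rightarrow> ('o, 'a) rig \<Rightarrow> ('o, 'a) thy" where
  "Mat_aff V R =
     (let e = aff_incl V R; H = (\<lambda>n m. Dom V (e n m)) in
     \<lparr>vOb = UNIV,
      vHom = H,
      vComp = (\<lambda>n m l. factor V (e n l)
        (vcomp V (Mat V R) n m l
           (e m l \<cdot>\<^bsub>V\<^esub> Fst V (H m l) (H n m)) (e n m \<cdot>\<^bsub>V\<^esub> Snd V (H m l) (H n m)))),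
      vId = (\<lambda>n. factor V (e n n) (vId (Mat V R) n)),
      tProj = (\<lambda>n i. factor V (e n 1) (tProj (Mat V R) n i))\<rparr>)"

definition Mat_aff_act :: "('o, 'a) ccc \<Rightarrow> ('o, 'a) rig \<Rightarrow> nat \<Rightarrow> nat \<Rightarrow> 'a" where
  "Mat_aff_act V R n m = Mat_act V R n m \<cdot>\<^bsub>V\<^esub> aff_incl V R n m"


section \<open>Pointed right modules\<close>

text \<open>
  The theory \<open>Mat\<^sup>*\<close> for the opposite rig of \<open>R\<close>, with all products taken in \<open>R\<close>. A morphism from
  \<open>n\<close> to \<open>m\<close> is an \<open>m \<times> (1 + n)\<close> matrix: column \<open>0\<close> holds the coefficients of the base point, and
  column \<open>Suc i\<close> those of the variable with (zero-based) index \<open>i\<close>.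
\<close>

definition Mat_op_star :: "('o, 'a) ccc \<Rightarrow> ('o, 'a) rig \<Rightarrow> ('o, 'a) thy" where
  "Mat_op_star V R =
     \<lparr>vOb = UNIV,
      vHom = (\<lambda>n m. mat_obj V R (Suc n) m),
      vComp = (\<lambda>n m l.
        let B = mat_obj V R (Suc m) l; A = mat_obj V R (Suc n) m; W = Prd V B A;
            v = entry V R (Suc m) l (Fst V B A); u = entry V R (Suc n) m (Snd V B A);
            s = (\<lambda>k i. radd_upto V R W m (\<lambda>j. rmul V R (u j i) (v k (Suc j))))
        in mat_of V R W (Suc n) l (\<lambda>k i. if i = 0 then radd V R (v k 0) (s k 0) else s k i)),
      vId = (\<lambda>n. mat_of V R (One V) (Suc n) n
        (\<lambda>j i. if i = Suc j then rone V R (One V) else rzero V R (One V))),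
      tProj = (\<lambda>n i. mat_of V R (One V) (Suc n) 1
        (\<lambda>_ i'. if i' = Suc i then rone V R (One V) else rzero V R (One V)))\<rparr>"

definition Mat_op_star_act :: "('o, 'a) ccc \<Rightarrow> ('o, 'a) rig \<Rightarrow> nat \<Rightarrow> nat \<Rightarrow> 'a" where
  "Mat_op_star_act V R n m =
     (let A = mat_obj V R (Suc n) m; X = Pow V (Car R) n; W = Prd V A X;
          u = entry V R (Suc n) m (Fst V A X); x = (\<lambda>i. Proj V (Car R) n i \<cdot>\<^bsub>V\<^esub> Snd V A X)
      in transpose V A X (Pow V (Car R) m)
           (tuple V W (Car R) m
              (\<lambda>j. radd V R (u j 0) (radd_upto V R W n (\<lambda>i. rmul V R (x i) (u j (Suc i)))))))"

end

theory Submission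
  imports Defs
begin

text \<open>
  Both theories act faithfully on \<open>R\<close>: a matrix is recovered from its values at the basis vectors,
  and an arrow \<open>u = (u\<^sub>0, \<dots>, u\<^sub>n)\<close> of the theory of pointed right modules from its value
  \<open>u\<^sub>0\<close> at the origin and its values \<open>u\<^sub>0 + u\<^sub>a\<close> at the basis vectors, since \<open>R\<close> has subtraction.
  Each of them is therefore a family of subobjects of the internal homs \<open>[R\<^sup>n, R\<^sup>m]\<close>.

  The commutants are families of subobjects of \<open>[R\<^sup>n, R\<^sup>m]\<close> as well. A natural transformation
  \<open>A\<^sup>n \<rightarrow> A\<^sup>m\<close> is determined by its component at \<open>1\<close>, because the designated projections force it
  to act column by column on \<open>(X\<^sup>k)\<^sup>n\<close>; and \<open>f : W \<rightarrow> [X\<^sup>n, X\<^sup>m]\<close> is such a component exactly if \<open>f\<close>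
  commutes with all operations of the theory: applying \<open>f\<close> to the columns of a matrix and then an
  operation to the results, or the operation to the rows and then \<open>f\<close>, gives the same
  (\<open>alg_vnat_commutes\<close>, \<open>extension_vnat\<close>). So a theory embedded in the full theory is isomorphic to
  the commutant as soon as its subobjects consist of the arrows that commute with all operations
  (\<open>isomorphic_commutant\<close>); in particular the ends that define the commutant then exist.

  What remains is a computation with generalized elements of \<open>R\<close>.
  Affine combinations commute with the operations \<open>x \<mapsto> u\<^sub>0 + \<Sum>\<^sub>a x\<^sub>a u\<^sub>a\<close>, as
  \<open>\<Sum>\<^sub>i h\<^sub>i (u\<^sub>0 + \<Sum>\<^sub>a x\<^sub>i\<^sub>a u\<^sub>a) = u\<^sub>0 + \<Sum>\<^sub>a (\<Sum>\<^sub>i h\<^sub>i x\<^sub>i\<^sub>a) u\<^sub>a\<close> if \<open>\<Sum>\<^sub>i h\<^sub>i = 1\<close>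
  (\<open>affine_pointed_interchange\<close>).
  If \<open>f\<close> commutes with the pointed-module operations, then \<open>f(x) = \<Sum>\<^sub>i f(e\<^sub>i) x\<^sub>i\<close>, and the
  coefficients sum to \<open>f(1, \<dots>, 1) = 1\<close> because \<open>f\<close> preserves the base point
  (\<open>star_commutes_factors\<close>). If \<open>f\<close> commutes with affine combinations, then writing \<open>x\<close> as
  \<open>\<Sum>\<^sub>i x\<^sub>i e\<^sub>i + (1 - \<Sum>\<^sub>i x\<^sub>i) 0\<close> gives \<open>f(x) = f(0) + \<Sum>\<^sub>i x\<^sub>i (f(e\<^sub>i) - f(0))\<close>, which is a
  pointed-module operation (\<open>aff_commutes_factors\<close>).
\<close>

section \<open>Categories with products and exponentials\<close>

text \<open>The hom-objects \<open>T(n,1)\<close> of a theory are kept in this form, with the numeral \<open>1\<close>.\<close>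

declare One_nat_def [simp del]

context category
begin

lemma comp_Arr [simp]: "f \<in> Arr V \<Longrightarrow> g \<in> Arr V \<Longrightarrow> Cod V f = Dom V g \<Longrightarrow> g \<cdot> f \<in> Arr V"
  and Dom_comp [simp]: "f \<in> Arr V \<Longrightarrow> g \<in> Arr V \<Longrightarrow> Cod V f = Dom V g \<Longrightarrow> Dom V (g \<cdot> f) = Dom V f"
  and Cod_comp [simp]: "f \<in> Arr V \<Longrightarrow> g \<in> Arr V \<Longrightarrow> Cod V f = Dom V g \<Longrightarrow> Cod V (g \<cdot> f) = Cod V g"
  using Comp_hom[of f "Dom V f" "Dom V g" g "Cod V g"] by (auto simp: hom_def)

lemma Ide_Arr [simp]: "A \<in> Ob V \<Longrightarrow> Ide V A \<in> Arr V"
  and Dom_Ide [simp]: "A \<in> Ob V \<Longrightarrow> Dom V (Ide V A) = A"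
  and Cod_Ide [simp]: "A \<in> Ob V \<Longrightarrow> Cod V (Ide V A) = A"
  using Ide_hom[of A] by (auto simp: hom_def)

lemma Ide_comp [simp]: "f \<in> Arr V \<Longrightarrow> Cod V f = A \<Longrightarrow> Ide V A \<cdot> f = f"
  and comp_Ide [simp]: "f \<in> Arr V \<Longrightarrow> Dom V f = A \<Longrightarrow> f \<cdot> Ide V A = f"
  using Comp_Ide_left[of f "Dom V f" A] Comp_Ide_right[of f A "Cod V f"] by (auto simp: hom_def)

lemma comp_assoc [simp]:
  "f \<in> Arr V \<Longrightarrow> g \<in> Arr V \<Longrightarrow> h \<in> Arr V \<Longrightarrow> Cod V f = Dom V g \<Longrightarrow> Cod V g = Dom V h \<Longrightarrow>
    (h \<cdot> g) \<cdot> f = h \<cdot> (g \<cdot> f)"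
  using Comp_assoc[of f "Dom V f" "Dom V g" g "Dom V h" h "Cod V h"] by (auto simp: hom_def)

lemma homI: "f \<in> Arr V \<Longrightarrow> Dom V f = A \<Longrightarrow> Cod V f = B \<Longrightarrow> f \<in> hom V A B"
  by (simp add: hom_def)

lemma hom_Arr: "f \<in> hom V A B \<Longrightarrow> f \<in> Arr V"
  and hom_Dom: "f \<in> hom V A B \<Longrightarrow> Dom V f = A"
  and hom_Cod: "f \<in> hom V A B \<Longrightarrow> Cod V f = B"
  by (auto simp: hom_def)

lemma Dom_Ob' [simp]: "f \<in> Arr V \<Longrightarrow> Dom V f \<in> Ob V"
  and Cod_Ob' [simp]: "f \<in> Arr V \<Longrightarrow> Cod V f \<in> Ob V"
  by (simp_all add: Dom_Ob Cod_Ob)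

lemma mono_cancel:
  "is_mono V m \<Longrightarrow> f \<in> Arr V \<Longrightarrow> g \<in> Arr V \<Longrightarrow> Dom V f = Dom V g \<Longrightarrow>
    Cod V f = Dom V m \<Longrightarrow> Cod V g = Dom V m \<Longrightarrow> m \<cdot> f = m \<cdot> g \<Longrightarrow> f = g"
  unfolding is_mono_def hom_def by blast

lemma equalizer_mono:
  assumes "f \<in> hom V A B" "g \<in> hom V A B" "is_equalizer V f g e"
  shows "is_mono V e"
proof -
  have e: "e \<in> Arr V" "Cod V e = A" "f \<cdot> e = g \<cdot> e"
    and uniq: "\<And>h. h \<in> Arr V \<Longrightarrow> Cod V h = A \<Longrightarrow> f \<cdot> h = g \<cdot> h \<Longrightarrow>
      \<exists>!k. k \<in> hom V (Dom V h) (Dom V e) \<and> e \<cdot> k = h"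
    using assms by (auto simp: is_equalizer_def hom_def)
  show ?thesis
    unfolding is_mono_def
  proof (intro conjI allI ballI impI)
    show "e \<in> Arr V" by (rule e)
    fix W s t
    assume s: "s \<in> hom V W (Dom V e)" and t: "t \<in> hom V W (Dom V e)" and eq: "e \<cdot> s = e \<cdot> t"
    have "f \<cdot> (e \<cdot> s) = (f \<cdot> e) \<cdot> s" using assms s e(1,2) by (simp add: hom_def)
    also have "\<dots> = g \<cdot> (e \<cdot> s)" unfolding e(3) using assms s e(1,2) by (simp add: hom_def)
    finally have "\<exists>!k. k \<in> hom V (Dom V (e \<cdot> s)) (Dom V e) \<and> e \<cdot> k = e \<cdot> s"
      using s e by (intro uniq) (auto simp: hom_def)
    moreover have "Dom V (e \<cdot> s) = W" using s e by (simp add: hom_def)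
    ultimately show "s = t" using s t eq by auto
  qed
qed

lemma mono_comp:
  assumes m: "is_mono V m" and e: "is_mono V e" and "Cod V e = Dom V m"
  shows "is_mono V (m \<cdot> e)"
  unfolding is_mono_def
proof (intro conjI allI ballI impI)
  have [simp]: "m \<in> Arr V" "e \<in> Arr V" "Cod V e = Dom V m"
    using assms by (simp_all add: is_mono_def)
  show "m \<cdot> e \<in> Arr V" by simp
  fix W f g
  assume f: "f \<in> hom V W (Dom V (m \<cdot> e))" and g: "g \<in> hom V W (Dom V (m \<cdot> e))"
    and eq: "(m \<cdot> e) \<cdot> f = (m \<cdot> e) \<cdot> g"
  have 1: "m \<cdot> (e \<cdot> f) = m \<cdot> (e \<cdot> g)"
    using f g eq by (simp add: hom_def)
  have 2: "e \<cdot> f = e \<cdot> g"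
    by (rule mono_cancel[OF m]) (use f g 1 in \<open>simp_all add: hom_def\<close>)
  show "f = g"
    by (rule mono_cancel[OF e]) (use f g 2 in \<open>simp_all add: hom_def\<close>)
qed

end

context cartesian_closed
begin

lemma One_in_Ob [simp]: "One V \<in> Ob V"
  by (rule One_Ob)

lemma Prd_in_Ob [simp]: "A \<in> Ob V \<Longrightarrow> B \<in> Ob V \<Longrightarrow> Prd V A B \<in> Ob V"
  by (rule Prd_Ob)

lemma Exp_in_Ob [simp]: "A \<in> Ob V \<Longrightarrow> B \<in> Ob V \<Longrightarrow> Exp V A B \<in> Ob V"
  by (rule Exp_Ob)

lemma Pow_in_Ob [simp]: "X \<in> Ob V \<Longrightarrow> Pow V X n \<in> Ob V"
  using power by (simp add: is_power_def)

declare Pow_1 [simp] Proj_1 [simp]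

lemma Fst_Arr [simp]: "A \<in> Ob V \<Longrightarrow> B \<in> Ob V \<Longrightarrow> Fst V A B \<in> Arr V"
  and Dom_Fst [simp]: "A \<in> Ob V \<Longrightarrow> B \<in> Ob V \<Longrightarrow> Dom V (Fst V A B) = Prd V A B"
  and Cod_Fst [simp]: "A \<in> Ob V \<Longrightarrow> B \<in> Ob V \<Longrightarrow> Cod V (Fst V A B) = A"
  and Snd_Arr [simp]: "A \<in> Ob V \<Longrightarrow> B \<in> Ob V \<Longrightarrow> Snd V A B \<in> Arr V"
  and Dom_Snd [simp]: "A \<in> Ob V \<Longrightarrow> B \<in> Ob V \<Longrightarrow> Dom V (Snd V A B) = Prd V A B"
  and Cod_Snd [simp]: "A \<in> Ob V \<Longrightarrow> B \<in> Ob V \<Longrightarrow> Cod V (Snd V A B) = B"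
  using Fst_hom[of A B] Snd_hom[of A B] by (auto simp: hom_def)

lemma Ev_Arr [simp]: "A \<in> Ob V \<Longrightarrow> B \<in> Ob V \<Longrightarrow> Ev V A B \<in> Arr V"
  and Dom_Ev [simp]: "A \<in> Ob V \<Longrightarrow> B \<in> Ob V \<Longrightarrow> Dom V (Ev V A B) = Prd V (Exp V A B) A"
  and Cod_Ev [simp]: "A \<in> Ob V \<Longrightarrow> B \<in> Ob V \<Longrightarrow> Cod V (Ev V A B) = B"
  using Ev_hom[of A B] by (auto simp: hom_def)

lemma Proj_Arr [simp]: "X \<in> Ob V \<Longrightarrow> i < n \<Longrightarrow> Proj V X n i \<in> Arr V"
  and Dom_Proj [simp]: "X \<in> Ob V \<Longrightarrow> i < n \<Longrightarrow> Dom V (Proj V X n i) = Pow V X n"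
  and Cod_Proj [simp]: "X \<in> Ob V \<Longrightarrow> i < n \<Longrightarrow> Cod V (Proj V X n i) = X"
  using power[of X n] by (auto simp: hom_def is_power_def)

lemma bang_hom: "A \<in> Ob V \<Longrightarrow> bang V A \<in> hom V A (One V)"
  unfolding bang_def using terminal[of A] by (rule theI')

lemma bang_Arr [simp]: "A \<in> Ob V \<Longrightarrow> bang V A \<in> Arr V"
  and Dom_bang [simp]: "A \<in> Ob V \<Longrightarrow> Dom V (bang V A) = A"
  and Cod_bang [simp]: "A \<in> Ob V \<Longrightarrow> Cod V (bang V A) = One V"
  using bang_hom[of A] by (auto simp: hom_def)

lemma bang_unique: "f \<in> Arr V \<Longrightarrow> Cod V f = One V \<Longrightarrow> f = bang V (Dom V f)"
  using terminal[of "Dom V f"] bang_hom[of "Dom V f"] by (auto simp: hom_def)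

lemma bang_comp [simp]: "f \<in> Arr V \<Longrightarrow> Cod V f = A \<Longrightarrow> bang V A \<cdot> f = bang V (Dom V f)"
  using bang_unique[of "bang V A \<cdot> f"] by auto

lemma pair_props:
  assumes "f \<in> Arr V" "g \<in> Arr V" "Dom V f = Dom V g"
  shows "pair V f g \<in> hom V (Dom V f) (Prd V (Cod V f) (Cod V g)) \<and>
    Fst V (Cod V f) (Cod V g) \<cdot> pair V f g = f \<and> Snd V (Cod V f) (Cod V g) \<cdot> pair V f g = g"
  unfolding pair_def by (rule theI', rule product) (use assms in \<open>auto simp: hom_def\<close>)

lemma pair_Arr [simp]: "f \<in> Arr V \<Longrightarrow> g \<in> Arr V \<Longrightarrow> Dom V f = Dom V g \<Longrightarrow> pair V f g \<in> Arr V"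
  and Dom_pair [simp]:
    "f \<in> Arr V \<Longrightarrow> g \<in> Arr V \<Longrightarrow> Dom V f = Dom V g \<Longrightarrow> Dom V (pair V f g) = Dom V f"
  and Cod_pair [simp]: "f \<in> Arr V \<Longrightarrow> g \<in> Arr V \<Longrightarrow> Dom V f = Dom V g \<Longrightarrow>
      Cod V (pair V f g) = Prd V (Cod V f) (Cod V g)"
  and Fst_pair [simp]: "f \<in> Arr V \<Longrightarrow> g \<in> Arr V \<Longrightarrow> Dom V f = Dom V g \<Longrightarrow>
      Cod V f = A \<Longrightarrow> Cod V g = B \<Longrightarrow> Fst V A B \<cdot> pair V f g = f"
  and Snd_pair [simp]: "f \<in> Arr V \<Longrightarrow> g \<in> Arr V \<Longrightarrow> Dom V f = Dom V g \<Longrightarrow>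
      Cod V f = A \<Longrightarrow> Cod V g = B \<Longrightarrow> Snd V A B \<cdot> pair V f g = g"
  using pair_props[of f g] by (auto simp: hom_def)

lemma Prd_eqI:
  assumes "f \<in> hom V W (Prd V A B)" "g \<in> hom V W (Prd V A B)" "A \<in> Ob V" "B \<in> Ob V"
    "Fst V A B \<cdot> f = Fst V A B \<cdot> g" "Snd V A B \<cdot> f = Snd V A B \<cdot> g"
  shows "f = g"
  using product[of "Fst V A B \<cdot> g" W A "Snd V A B \<cdot> g" B] assms
  by (auto simp: hom_def)

lemma pair_comp [simp]:
  assumes "f \<in> Arr V" "g \<in> Arr V" "Dom V f = Dom V g" "t \<in> Arr V" "Cod V t = Dom V g"
  shows "pair V f g \<cdot> t = pair V (f \<cdot> t) (g \<cdot> t)"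
proof (rule Prd_eqI)
  let ?A = "Cod V f" and ?B = "Cod V g"
  have "Fst V ?A ?B \<cdot> (pair V f g \<cdot> t) = (Fst V ?A ?B \<cdot> pair V f g) \<cdot> t"
    using assms by (simp del: Fst_pair)
  then show "Fst V ?A ?B \<cdot> (pair V f g \<cdot> t) = Fst V ?A ?B \<cdot> pair V (f \<cdot> t) (g \<cdot> t)"
    using assms by simp
  have "Snd V ?A ?B \<cdot> (pair V f g \<cdot> t) = (Snd V ?A ?B \<cdot> pair V f g) \<cdot> t"
    using assms by (simp del: Snd_pair)
  then show "Snd V ?A ?B \<cdot> (pair V f g \<cdot> t) = Snd V ?A ?B \<cdot> pair V (f \<cdot> t) (g \<cdot> t)"
    using assms by simp
qed (use assms in \<open>auto simp: hom_def\<close>)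

lemma tuple_props:
  assumes "W \<in> Ob V" "X \<in> Ob V" "\<And>i. i < n \<Longrightarrow> f i \<in> hom V W X"
  shows "tuple V W X n f \<in> hom V W (Pow V X n) \<and> (\<forall>i<n. Proj V X n i \<cdot> tuple V W X n f = f i)"
  unfolding tuple_def 
  by (rule theI') (use power[of X n] assms in \<open>auto simp: is_power_def\<close>)

lemma tuple_Arr [simp]: "W \<in> Ob V \<Longrightarrow> X \<in> Ob V \<Longrightarrow> \<forall>i<n. f i \<in> hom V W X \<Longrightarrow>
      tuple V W X n f \<in> Arr V"
  and Dom_tuple [simp]: "W \<in> Ob V \<Longrightarrow> X \<in> Ob V \<Longrightarrow> \<forall>i<n. f i \<in> hom V W X \<Longrightarrow>
      Dom V (tuple V W X n f) = W"
  and Cod_tuple [simp]: "W \<in> Ob V \<Longrightarrow> X \<in> Ob V \<Longrightarrow> \<forall>i<n. f i \<in> hom V W X \<Longrightarrow>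
      Cod V (tuple V W X n f) = Pow V X n"
  and Proj_tuple [simp]: "W \<in> Ob V \<Longrightarrow> X \<in> Ob V \<Longrightarrow> \<forall>i<n. f i \<in> hom V W X \<Longrightarrow>
      i < n \<Longrightarrow> Proj V X n i \<cdot> tuple V W X n f = f i"
  using tuple_props[of W X n f] by (auto simp: hom_def)

lemma Pow_eqI:
  assumes "f \<in> hom V W (Pow V X n)" "g \<in> hom V W (Pow V X n)" "X \<in> Ob V"
    "\<And>i. i < n \<Longrightarrow> Proj V X n i \<cdot> f = Proj V X n i \<cdot> g"
  shows "f = g"
proof -
  have "W \<in> Ob V" using assms(1) by (auto simp: hom_def)
  then have "\<exists>!h. h \<in> hom V W (Pow V X n) \<and> (\<forall>i<n. Proj V X n i \<cdot> h = Proj V X n i \<cdot> g)"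
    using power[of X n] assms(2,3) unfolding is_power_def by (auto simp: hom_def)
  then show ?thesis using assms by blast
qed

lemma tuple_comp [simp]:
  assumes "X \<in> Ob V" "\<forall>i<n. f i \<in> hom V W X" "t \<in> Arr V" "Cod V t = W"
  shows "tuple V W X n f \<cdot> t = tuple V (Dom V t) X n (\<lambda>i. f i \<cdot> t)"
proof (rule Pow_eqI)
  fix i assume i: "i < n"
  have W: "W \<in> Ob V" using assms by auto
  have "Proj V X n i \<cdot> (tuple V W X n f \<cdot> t) = (Proj V X n i \<cdot> tuple V W X n f) \<cdot> t"
    using assms i W by (simp del: Proj_tuple)
  also have "\<dots> = f i \<cdot> t" using assms i W by simp
  also have "\<dots> = Proj V X n i \<cdot> tuple V (Dom V t) X n (\<lambda>i. f i \<cdot> t)"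
    using assms i W by (simp add: hom_def)
  finally show "Proj V X n i \<cdot> (tuple V W X n f \<cdot> t) =
    Proj V X n i \<cdot> tuple V (Dom V t) X n (\<lambda>i. f i \<cdot> t)" .
qed (use assms in \<open>auto simp: hom_def\<close>)

lemma tuple_cong: "(\<And>i. i < n \<Longrightarrow> f i = g i) \<Longrightarrow> tuple V W X n f = tuple V W X n g"
proof -
  assume "\<And>i. i < n \<Longrightarrow> f i = g i"
  then have "(\<forall>i<n. Proj V X n i \<cdot> h = f i) \<longleftrightarrow> (\<forall>i<n. Proj V X n i \<cdot> h = g i)" for h by auto
  then show ?thesis by (simp add: tuple_def)
qed

lemma tuple_Proj [simp]:
  "X \<in> Ob V \<Longrightarrow> y \<in> hom V W (Pow V X n) \<Longrightarrow> tuple V W X n (\<lambda>i. Proj V X n i \<cdot> y) = y"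
  by (rule Pow_eqI[of _ W X n]) (auto simp: hom_def)

lemma tuple_1 [simp]:
  assumes "X \<in> Ob V" "f 0 \<in> hom V W X"
  shows "tuple V W X 1 f = f 0"
proof (rule Pow_eqI[of _ W X 1])
  show "Proj V X 1 i \<cdot> tuple V W X 1 f = Proj V X 1 i \<cdot> f 0"
    if "i < 1" for i
    using assms that Proj_tuple[of W X 1 f 0] by (auto simp: hom_def simp del: Proj_tuple)
qed (use assms in \<open>auto simp: hom_def\<close>)

lemma app_Arr [simp]: "g \<in> Arr V \<Longrightarrow> x \<in> Arr V \<Longrightarrow> Dom V g = Dom V x \<Longrightarrow> Cod V g = Exp V A B \<Longrightarrow>
      Cod V x = A \<Longrightarrow> B \<in> Ob V \<Longrightarrow> app V A B g x \<in> Arr V"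
  and Dom_app [simp]: "g \<in> Arr V \<Longrightarrow> x \<in> Arr V \<Longrightarrow> Dom V g = Dom V x \<Longrightarrow> Cod V g = Exp V A B \<Longrightarrow>
      Cod V x = A \<Longrightarrow> B \<in> Ob V \<Longrightarrow> Dom V (app V A B g x) = Dom V x"
  and Cod_app [simp]: "g \<in> Arr V \<Longrightarrow> x \<in> Arr V \<Longrightarrow> Dom V g = Dom V x \<Longrightarrow> Cod V g = Exp V A B \<Longrightarrow>
      Cod V x = A \<Longrightarrow> B \<in> Ob V \<Longrightarrow> Cod V (app V A B g x) = B"
  and app_comp [simp]: "g \<in> Arr V \<Longrightarrow> x \<in> Arr V \<Longrightarrow> Dom V g = Dom V x \<Longrightarrow> Cod V g = Exp V A B \<Longrightarrow>
      Cod V x = A \<Longrightarrow> B \<in> Ob V \<Longrightarrow> t \<in> Arr V \<Longrightarrow> Cod V t = Dom V x \<Longrightarrow>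
      app V A B g x \<cdot> t = app V A B (g \<cdot> t) (x \<cdot> t)"
  unfolding app_def by auto

lemma transpose_props:
  assumes "W \<in> Ob V" "A \<in> Ob V" "f \<in> hom V (Prd V W A) B"
  shows "transpose V W A B f \<in> hom V W (Exp V A B) \<and>
    app V A B (transpose V W A B f \<cdot> Fst V W A) (Snd V W A) = f"
  unfolding transpose_def by (rule theI', intro exponential assms)

lemma transpose_Arr [simp]:
    "W \<in> Ob V \<Longrightarrow> A \<in> Ob V \<Longrightarrow> f \<in> Arr V \<Longrightarrow> Dom V f = Prd V W A \<Longrightarrow> Cod V f = B \<Longrightarrow>
      transpose V W A B f \<in> Arr V"
  and Dom_transpose [simp]:
    "W \<in> Ob V \<Longrightarrow> A \<in> Ob V \<Longrightarrow> f \<in> Arr V \<Longrightarrow> Dom V f = Prd V W A \<Longrightarrow> Cod V f = B \<Longrightarrow>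
      Dom V (transpose V W A B f) = W"
  and Cod_transpose [simp]:
    "W \<in> Ob V \<Longrightarrow> A \<in> Ob V \<Longrightarrow> f \<in> Arr V \<Longrightarrow> Dom V f = Prd V W A \<Longrightarrow> Cod V f = B \<Longrightarrow>
      Cod V (transpose V W A B f) = Exp V A B"
  using transpose_props[of W A f B] by (auto simp: hom_def)

lemma app_transpose [simp]:
  assumes "W \<in> Ob V" "A \<in> Ob V" "f \<in> Arr V" "Dom V f = Prd V W A" "Cod V f = B"
    "t \<in> Arr V" "x \<in> Arr V" "Dom V t = Dom V x" "Cod V t = W" "Cod V x = A"
  shows "app V A B (transpose V W A B f \<cdot> t) x = f \<cdot> pair V t x"
proof -
  have B: "B \<in> Ob V" using assms by auto
  have "f \<cdot> pair V t x =
      app V A B (transpose V W A B f \<cdot> Fst V W A) (Snd V W A) \<cdot> pair V t x"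
    using transpose_props[of W A f B] assms by (simp add: hom_def)
  also have "\<dots> = app V A B (transpose V W A B f \<cdot> t) x"
    using assms B by simp
  finally show ?thesis by simp
qed

text \<open>
  Arrows into an exponential are compared by their values on generalized elements; the universal
  element \<open>(Fst, Snd)\<close> suffices, by uniqueness of transposes.
\<close>

lemma Exp_eqI:
  assumes "f \<in> hom V W (Exp V A B)" "g \<in> hom V W (Exp V A B)" "A \<in> Ob V" "B \<in> Ob V"
    and "\<And>U t x. t \<in> hom V U W \<Longrightarrow> x \<in> hom V U A \<Longrightarrow> app V A B (f \<cdot> t) x = app V A B (g \<cdot> t) x"
  shows "f = g"
proof -
  have W: "W \<in> Ob V" using assms(1) by (auto simp: hom_def)
  have eq: "app V A B (f \<cdot> Fst V W A) (Snd V W A) = app V A B (g \<cdot> Fst V W A) (Snd V W A)"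
    using W assms(3) by (intro assms(5)[of _ "Prd V W A"]) (auto simp: hom_def)
  have "app V A B (f \<cdot> Fst V W A) (Snd V W A) \<in> hom V (Prd V W A) B"
    using assms W by (auto simp: hom_def)
  from exponential[OF W assms(3) this] eq assms(1,2) show ?thesis by metis
qed

lemma name_Arr [simp]: "f \<in> Arr V \<Longrightarrow> Dom V f = A \<Longrightarrow> Cod V f = B \<Longrightarrow> name V A B f \<in> Arr V"
  and Dom_name [simp]: "f \<in> Arr V \<Longrightarrow> Dom V f = A \<Longrightarrow> Cod V f = B \<Longrightarrow> Dom V (name V A B f) = One V"
  and Cod_name [simp]:
    "f \<in> Arr V \<Longrightarrow> Dom V f = A \<Longrightarrow> Cod V f = B \<Longrightarrow> Cod V (name V A B f) = Exp V A B"
  and app_name [simp]: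
    "f \<in> Arr V \<Longrightarrow> Dom V f = A \<Longrightarrow> Cod V f = B \<Longrightarrow> x \<in> Arr V \<Longrightarrow> Cod V x = A \<Longrightarrow> t \<in> Arr V \<Longrightarrow>
      Cod V t = One V \<Longrightarrow> Dom V t = Dom V x \<Longrightarrow> app V A B (name V A B f \<cdot> t) x = f \<cdot> x"
  unfolding name_def by auto

section \<open>Composition in the self-enriched category\<close>

lemma self_simps [simp]: "vOb (self V) = Ob V" "vHom (self V) = Exp V"
  "vId (self V) A = name V A A (Ide V A)"
  by (simp_all add: self_def)

lemma self_vComp:
  assumes "A \<in> Ob V" "B \<in> Ob V" "C \<in> Ob V"
  shows "vComp (self V) A B C \<in> hom V (Prd V (Exp V B C) (Exp V A B)) (Exp V A C)"
proof -
  let ?G = "Exp V B C" and ?F = "Exp V A B"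
  let ?P = "Prd V ?G ?F"
  define y where "y = app V A B (Snd V ?G ?F \<cdot> Fst V ?P A) (Snd V ?P A)"
  have y: "y \<in> Arr V" "Dom V y = Prd V ?P A" "Cod V y = B"
    using assms by (simp_all add: y_def)
  define z where "z = app V B C (Fst V ?G ?F \<cdot> Fst V ?P A) y"
  have z: "z \<in> Arr V" "Dom V z = Prd V ?P A" "Cod V z = C"
    using assms y by (simp_all add: z_def)
  have "vComp (self V) A B C = transpose V ?P A C z"
    by (simp only: self_def vcat.simps z_def y_def Let_def)
  then show ?thesis using assms z by (simp add: hom_def)
qed

lemma self_vComp_Arr [simp]:
    "A \<in> Ob V \<Longrightarrow> B \<in> Ob V \<Longrightarrow> C \<in> Ob V \<Longrightarrow> vComp (self V) A B C \<in> Arr V"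
  and self_vComp_Dom [simp]: "A \<in> Ob V \<Longrightarrow> B \<in> Ob V \<Longrightarrow> C \<in> Ob V \<Longrightarrow>
    Dom V (vComp (self V) A B C) = Prd V (Exp V B C) (Exp V A B)"
  and self_vComp_Cod [simp]: "A \<in> Ob V \<Longrightarrow> B \<in> Ob V \<Longrightarrow> C \<in> Ob V \<Longrightarrow>
    Cod V (vComp (self V) A B C) = Exp V A C"
  using self_vComp[of A B C] by (auto simp: hom_def)

lemma self_vcomp_Arr [simp]:
    "A \<in> Ob V \<Longrightarrow> B \<in> Ob V \<Longrightarrow> C \<in> Ob V \<Longrightarrow> f \<in> Arr V \<Longrightarrow> g \<in> Arr V \<Longrightarrow> Dom V f = Dom V g \<Longrightarrow>
      Cod V f = Exp V A B \<Longrightarrow> Cod V g = Exp V B C \<Longrightarrow> vcomp V (self V) A B C g f \<in> Arr V"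
  and self_vcomp_Dom [simp]:
    "A \<in> Ob V \<Longrightarrow> B \<in> Ob V \<Longrightarrow> C \<in> Ob V \<Longrightarrow> f \<in> Arr V \<Longrightarrow> g \<in> Arr V \<Longrightarrow> Dom V f = Dom V g \<Longrightarrow>
      Cod V f = Exp V A B \<Longrightarrow> Cod V g = Exp V B C \<Longrightarrow>
      Dom V (vcomp V (self V) A B C g f) = Dom V g"
  and self_vcomp_Cod [simp]:
    "A \<in> Ob V \<Longrightarrow> B \<in> Ob V \<Longrightarrow> C \<in> Ob V \<Longrightarrow> f \<in> Arr V \<Longrightarrow> g \<in> Arr V \<Longrightarrow> Dom V f = Dom V g \<Longrightarrow>
      Cod V f = Exp V A B \<Longrightarrow> Cod V g = Exp V B C \<Longrightarrow>
      Cod V (vcomp V (self V) A B C g f) = Exp V A C"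
  and self_vcomp_comp [simp]:
    "A \<in> Ob V \<Longrightarrow> B \<in> Ob V \<Longrightarrow> C \<in> Ob V \<Longrightarrow> f \<in> Arr V \<Longrightarrow> g \<in> Arr V \<Longrightarrow> Dom V f = Dom V g \<Longrightarrow>
      Cod V f = Exp V A B \<Longrightarrow> Cod V g = Exp V B C \<Longrightarrow> t \<in> Arr V \<Longrightarrow> Cod V t = Dom V g \<Longrightarrow>
      vcomp V (self V) A B C g f \<cdot> t = vcomp V (self V) A B C (g \<cdot> t) (f \<cdot> t)"
  unfolding vcomp_def by auto

lemma app_self_vcomp [simp]:
  assumes "A \<in> Ob V" "B \<in> Ob V" "C \<in> Ob V" "f \<in> Arr V" "g \<in> Arr V" "Dom V f = Dom V g"
    "Cod V f = Exp V A B" "Cod V g = Exp V B C" "x \<in> Arr V" "Dom V x = Dom V g" "Cod V x = A"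
  shows "app V A C (vcomp V (self V) A B C g f) x = app V B C g (app V A B f x)"
proof -
  let ?G = "Exp V B C" and ?F = "Exp V A B"
  let ?P = "Prd V ?G ?F"
  define g' where "g' = Fst V ?G ?F \<cdot> Fst V ?P A"
  define f' where "f' = Snd V ?G ?F \<cdot> Fst V ?P A"
  define x' where "x' = Snd V ?P A"
  define y' where "y' = app V A B f' x'"
  define z' where "z' = app V B C g' y'"
  define p where "p = pair V (pair V g f) x"
  have p: "p \<in> Arr V" "Cod V p = Prd V ?P A" "Dom V p = Dom V g"
    "Fst V ?P A \<cdot> p = pair V g f" "Snd V ?P A \<cdot> p = x"
    using assms by (simp_all add: p_def)
  have g': "g' \<in> Arr V" "Dom V g' = Prd V ?P A" "Cod V g' = ?G" "g' \<cdot> p = g"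
    using assms p by (simp_all add: g'_def)
  have f': "f' \<in> Arr V" "Dom V f' = Prd V ?P A" "Cod V f' = ?F" "f' \<cdot> p = f"
    using assms p by (simp_all add: f'_def)
  have x': "x' \<in> Arr V" "Dom V x' = Prd V ?P A" "Cod V x' = A" "x' \<cdot> p = x"
    using assms p by (simp_all add: x'_def)
  have y': "y' \<in> Arr V" "Dom V y' = Prd V ?P A" "Cod V y' = B" "y' \<cdot> p = app V A B f x"
    using assms p f' x' by (simp_all add: y'_def)
  have z': "z' \<in> Arr V" "Dom V z' = Prd V ?P A" "Cod V z' = C"
    "z' \<cdot> p = app V B C g (app V A B f x)"
    using assms p g' y' by (simp_all add: z'_def)
  have "vComp (self V) A B C = transpose V ?P A C z'"
    by (simp only: self_def vcat.simps z'_def y'_def x'_def f'_def g'_def Let_def)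
  then have "app V A C (vcomp V (self V) A B C g f) x = z' \<cdot> p"
    unfolding vcomp_def p_def using assms z'(1-3) by simp
  also have "\<dots> = app V B C g (app V A B f x)"
    by (rule z')
  finally show ?thesis .
qed

end

section \<open>Theories embedded in the full theory\<close>

context cartesian_closed
begin

lemma full_theory_simps [simp]:
  "vOb (full_theory V X) = UNIV"
  "vHom (full_theory V X) n m = Exp V (Pow V X n) (Pow V X m)"
  "vId (full_theory V X) n = name V (Pow V X n) (Pow V X n) (Ide V (Pow V X n))"
  "tProj (full_theory V X) n i = name V (Pow V X n) X (Proj V X n i)"
  "vcomp V (full_theory V X) n m l g f =
     vcomp V (self V) (Pow V X n) (Pow V X m) (Pow V X l) g f"
  by (simp_all add: full_theory_def vcomp_def)

lemma transpose_tuple_hom: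
  assumes "W \<in> Ob V" "A \<in> Ob V" "Y \<in> Ob V" "\<And>i. i < n \<Longrightarrow> b i \<in> hom V (Prd V W A) Y"
  shows "transpose V W A (Pow V Y n) (tuple V (Prd V W A) Y n b) \<in> hom V W (Exp V A (Pow V Y n))"
  using assms by (simp add: hom_def)

lemma Proj_app_transpose_tuple:
  assumes "W \<in> Ob V" "A \<in> Ob V" "Y \<in> Ob V" "\<And>i. i < n \<Longrightarrow> b i \<in> hom V (Prd V W A) Y"
    and "t \<in> hom V U W" "x \<in> hom V U A" and i: "i < n"
  shows "Proj V Y n i \<cdot>
      app V A (Pow V Y n) (transpose V W A (Pow V Y n) (tuple V (Prd V W A) Y n b) \<cdot> t) x =
    b i \<cdot> pair V t x"
proof -
  let ?b = "tuple V (Prd V W A) Y n b"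
  have b: "?b \<in> Arr V" "Dom V ?b = Prd V W A" "Cod V ?b = Pow V Y n"
    "Proj V Y n i \<cdot> ?b = b i"
    using assms by simp_all
  have "Proj V Y n i \<cdot> app V A (Pow V Y n) (transpose V W A (Pow V Y n) ?b \<cdot> t) x =
      Proj V Y n i \<cdot> (?b \<cdot> pair V t x)"
    using assms b(1-3) by (simp add: hom_def del: tuple_comp)
  also have "\<dots> = (Proj V Y n i \<cdot> ?b) \<cdot> pair V t x"
    using assms b(1-3) by (subst comp_assoc) (simp_all add: hom_def del: tuple_comp Proj_tuple)
  finally show ?thesis by (simp only: b(4))
qed

text \<open>
  The \<open>j\<close>-th component of \<open>f : W \<rightarrow> [X\<^sup>n, X\<^sup>m]\<close>; if \<open>f\<close> acts by a matrix, it acts by the \<open>j\<close>-th row.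
\<close>

definition row :: "'o \<Rightarrow> nat \<Rightarrow> nat \<Rightarrow> nat \<Rightarrow> 'a \<Rightarrow> 'a" where
  "row X n m j f = vcomp V (self V) (Pow V X n) (Pow V X m) X
     (name V (Pow V X m) X (Proj V X m j) \<cdot> bang V (Dom V f)) f"

lemma row_hom:
  "X \<in> Ob V \<Longrightarrow> f \<in> hom V W (Exp V (Pow V X n) (Pow V X m)) \<Longrightarrow> j < m \<Longrightarrow>
    row X n m j f \<in> hom V W (Exp V (Pow V X n) X)"
  by (auto simp: row_def hom_def)

lemma app_row:
  assumes "X \<in> Ob V" "f \<in> hom V W (Exp V (Pow V X n) (Pow V X m))" "j < m"
    "t \<in> hom V U W" "x \<in> hom V U (Pow V X n)"
  shows "app V (Pow V X n) X (row X n m j f \<cdot> t) x =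
    Proj V X m j \<cdot> app V (Pow V X n) (Pow V X m) (f \<cdot> t) x"
  using assms by (auto simp: row_def hom_def)

end

text \<open>
  Enough of a theory over the full theory on \<open>X\<close> to say that an arrow commutes with all its
  operations. This precedes the remaining axioms, because for each of the two theories of the final
  theorem closure under powers is derived from commutation with the other one.
\<close>

locale operations_on = cartesian_closed V
  for V :: "('o, 'a) ccc" (structure) and X :: 'o and T :: "('o, 'a) thy"
    and \<alpha> :: "nat \<Rightarrow> nat \<Rightarrow> 'a" +
  assumes X_Ob [simp]: "X \<in> Ob V"
    and incl_hom: "\<alpha> n m \<in> hom V (vHom T n m) (Exp V (Pow V X n) (Pow V X m))"
begin

lemma incl_simps [simp]: "\<alpha> n m \<in> Arr V" "Dom V (\<alpha> n m) = vHom T n m"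
  "Cod V (\<alpha> n m) = Exp V (Pow V X n) (Pow V X m)"
  using incl_hom by (auto simp: hom_def)

lemma vHom_Ob [simp]: "vHom T n m \<in> Ob V"
  using Dom_Ob'[of "\<alpha> n m"] by simp

abbreviation val :: "nat \<Rightarrow> nat \<Rightarrow> 'a \<Rightarrow> 'a \<Rightarrow> 'a" where
  "val n m \<equiv> app V (Pow V X n) (Pow V X m)"

abbreviation op_val :: "nat \<Rightarrow> 'a \<Rightarrow> 'a \<Rightarrow> 'a" where
  "op_val n \<equiv> app V (Pow V X n) X"

text \<open>
  The entries \<open>x a i\<close> form an \<open>n \<times> b\<close> matrix over \<open>X\<close> at stage \<open>U\<close>: \<open>f\<close> acts on its columns and
  \<open>h\<close> on its rows. The condition is symmetric in \<open>f\<close> and \<open>h\<close>. Quantifying over stages \<open>t : U \<rightarrow> W\<close>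
  makes it stable under reindexing, so that it describes a subfunctor of the functor represented by
  \<open>[X\<^sup>n, X\<^sup>m]\<close>.
\<close>

definition commutes :: "nat \<Rightarrow> nat \<Rightarrow> 'a \<Rightarrow> bool" where
  "commutes n m f \<longleftrightarrow>
     (\<forall>U t b l h x j q. t \<in> hom V U (Dom V f) \<longrightarrow> h \<in> hom V U (vHom T b l) \<longrightarrow>
        (\<forall>a<n. \<forall>i<b. x a i \<in> hom V U X) \<longrightarrow> j < m \<longrightarrow> q < l \<longrightarrow>
        Proj V X l q \<cdot> val b l (\<alpha> b l \<cdot> h)
          (tuple V U X b (\<lambda>i. Proj V X m j \<cdot> val n m (f \<cdot> t) (tuple V U X n (\<lambda>a. x a i)))) =
        Proj V X m j \<cdot> val n m (f \<cdot> t)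
          (tuple V U X n (\<lambda>a. Proj V X l q \<cdot> val b l (\<alpha> b l \<cdot> h) (tuple V U X b (x a)))))"

text \<open>
  Only one coordinate of the values of \<open>f\<close> enters the condition at a time. Hence arrows that commute
  with all operations satisfy the axiom \<open>closed\<close> of the next locale.
\<close>

lemma commutes_rows:
  assumes f: "f \<in> hom V W (Exp V (Pow V X n) (Pow V X m))"
    and rows: "\<And>j. j < m \<Longrightarrow> commutes n 1 (row X n m j f)"
  shows "commutes n m f"
  unfolding commutes_def
proof (intro allI impI)
  fix U t b l h x j q
  assume t: "t \<in> hom V U (Dom V f)" and h: "h \<in> hom V U (vHom T b l)"
    and x: "\<forall>a<n. \<forall>i<b. x a i \<in> hom V U X" and j: "j < m" and q: "q < l"
  have U: "U \<in> Ob V" and t': "t \<in> hom V U W" using t f by (auto simp: hom_def)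
  have r: "row X n m j f \<in> hom V W (Exp V (Pow V X n) X)" by (rule row_hom[OF X_Ob f j])
  have row: "Proj V X 1 0 \<cdot> val n 1 (row X n m j f \<cdot> t) y = Proj V X m j \<cdot> val n m (f \<cdot> t) y"
    if "y \<in> hom V U (Pow V X n)" for y
  proof -
    have "Proj V X 1 0 \<cdot> val n 1 (row X n m j f \<cdot> t) y = op_val n (row X n m j f \<cdot> t) y"
      using r t' that by (simp add: hom_def)
    then show ?thesis by (simp only: app_row[OF X_Ob f j t' that])
  qed
  let ?h = "\<lambda>y. Proj V X l q \<cdot> val b l (\<alpha> b l \<cdot> h) y"
  have "?h (tuple V U X b (x a)) \<in> hom V U X" if "a < n" for a
    using h x U q that by (simp add: hom_def)
  then have img: "tuple V U X n (\<lambda>a. ?h (tuple V U X b (x a))) \<in> hom V U (Pow V X n)"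
    using U by (simp add: hom_def)
  have col: "tuple V U X n (\<lambda>a. x a i) \<in> hom V U (Pow V X n)" if "i < b" for i
    using x U that by (simp add: hom_def)
  have "t \<in> hom V U (Dom V (row X n m j f))" using r t' by (simp add: hom_def)
  then have "?h (tuple V U X b (\<lambda>i. Proj V X 1 0 \<cdot>
        val n 1 (row X n m j f \<cdot> t) (tuple V U X n (\<lambda>a. x a i)))) =
      Proj V X 1 0 \<cdot> val n 1 (row X n m j f \<cdot> t) (tuple V U X n (\<lambda>a. ?h (tuple V U X b (x a))))"
    using rows[OF j] h x q unfolding commutes_def by blast
  moreover have "tuple V U X b (\<lambda>i. Proj V X 1 0 \<cdot>
        val n 1 (row X n m j f \<cdot> t) (tuple V U X n (\<lambda>a. x a i))) =
      tuple V U X b (\<lambda>i. Proj V X m j \<cdot> val n m (f \<cdot> t) (tuple V U X n (\<lambda>a. x a i)))"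
    using row[OF col] by (intro tuple_cong)
  ultimately show "?h (tuple V U X b
        (\<lambda>i. Proj V X m j \<cdot> val n m (f \<cdot> t) (tuple V U X n (\<lambda>a. x a i)))) =
      Proj V X m j \<cdot> val n m (f \<cdot> t) (tuple V U X n (\<lambda>a. ?h (tuple V U X b (x a))))"
    by (simp only: row[OF img])
qed

end

text \<open>
  A theory whose hom-objects are subobjects of those of the full theory. Its structure is then
  determined by the subobjects, and identities between arrows can be checked on values. The axiom
  \<open>closed\<close> makes \<open>T(n,m)\<close> the \<open>m\<close>-th power of \<open>T(n,1)\<close>: an arrow into \<open>[X\<^sup>n, X\<^sup>m]\<close> belongs to
  \<open>T(n,m)\<close> if all its components belong to \<open>T(n,1)\<close>.
\<close>

locale subtheory = operations_on V X T \<alpha>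
  for V :: "('o, 'a) ccc" (structure) and X T \<alpha> +
  assumes objects: "vOb T = UNIV"
    and mono: "is_mono V (\<alpha> n m)"
    and vComp_hom: "vComp T n m l \<in> hom V (Prd V (vHom T m l) (vHom T n m)) (vHom T n l)"
    and incl_comp: "f \<in> hom V W (vHom T n m) \<Longrightarrow> g \<in> hom V W (vHom T m l) \<Longrightarrow>
      \<alpha> n l \<cdot> vcomp V T n m l g f =
      vcomp V (self V) (Pow V X n) (Pow V X m) (Pow V X l) (\<alpha> m l \<cdot> g) (\<alpha> n m \<cdot> f)"
    and vId_hom: "vId T n \<in> hom V (One V) (vHom T n n)"
    and incl_Id: "\<alpha> n n \<cdot> vId T n = name V (Pow V X n) (Pow V X n) (Ide V (Pow V X n))"
    and tProj_hom: "i < n \<Longrightarrow> tProj T n i \<in> hom V (One V) (vHom T n 1)"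
    and incl_tProj: "i < n \<Longrightarrow> \<alpha> n 1 \<cdot> tProj T n i = name V (Pow V X n) X (Proj V X n i)"
    and closed: "f \<in> hom V W (Exp V (Pow V X n) (Pow V X m)) \<Longrightarrow>
      (\<And>j. j < m \<Longrightarrow> factors_through V (row X n m j f) (\<alpha> n 1)) \<Longrightarrow>
      factors_through V f (\<alpha> n m)"
begin

lemma struct_simps [simp]:
  "vComp T n m l \<in> Arr V" "Dom V (vComp T n m l) = Prd V (vHom T m l) (vHom T n m)"
  "Cod V (vComp T n m l) = vHom T n l"
  "vId T n \<in> Arr V" "Dom V (vId T n) = One V" "Cod V (vId T n) = vHom T n n"
  "i < n \<Longrightarrow> tProj T n i \<in> Arr V" "i < n \<Longrightarrow> Dom V (tProj T n i) = One V"
  "i < n \<Longrightarrow> Cod V (tProj T n i) = vHom T n 1"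
  using vComp_hom vId_hom tProj_hom by (auto simp: hom_def)

lemma vcomp_hom:
  "f \<in> hom V W (vHom T n m) \<Longrightarrow> g \<in> hom V W (vHom T m l) \<Longrightarrow>
    vcomp V T n m l g f \<in> hom V W (vHom T n l)"
  by (auto simp: vcomp_def hom_def)

lemma incl_cancel:
  "f \<in> hom V W (vHom T n m) \<Longrightarrow> g \<in> hom V W (vHom T n m) \<Longrightarrow> \<alpha> n m \<cdot> f = \<alpha> n m \<cdot> g \<Longrightarrow> f = g"
  using mono_cancel[OF mono, of f g n m] by (auto simp: hom_def)

lemma incl_eqI:
  assumes f: "f \<in> hom V W (vHom T n m)" and g: "g \<in> hom V W (vHom T n m)"
    and eq: "\<And>U t x. t \<in> hom V U W \<Longrightarrow> x \<in> hom V U (Pow V X n) \<Longrightarrow>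
      app V (Pow V X n) (Pow V X m) (\<alpha> n m \<cdot> f \<cdot> t) x =
      app V (Pow V X n) (Pow V X m) (\<alpha> n m \<cdot> g \<cdot> t) x"
  shows "f = g"
proof (rule incl_cancel[OF f g], rule Exp_eqI)
  fix U t x assume "t \<in> hom V U W" "x \<in> hom V U (Pow V X n)"
  from eq[OF this] show "app V (Pow V X n) (Pow V X m) ((\<alpha> n m \<cdot> f) \<cdot> t) x =
      app V (Pow V X n) (Pow V X m) ((\<alpha> n m \<cdot> g) \<cdot> t) x"
    using f g \<open>t \<in> hom V U W\<close> by (simp add: hom_def)
qed (use f g in \<open>auto simp: hom_def\<close>)

lemma app_vcomp:
  assumes f: "f \<in> hom V W (vHom T n m)" and g: "g \<in> hom V W (vHom T m l)"
    and t: "t \<in> hom V U W" and x: "x \<in> hom V U (Pow V X n)"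
  shows "app V (Pow V X n) (Pow V X l) (\<alpha> n l \<cdot> vcomp V T n m l g f \<cdot> t) x =
    app V (Pow V X m) (Pow V X l) (\<alpha> m l \<cdot> g \<cdot> t)
      (app V (Pow V X n) (Pow V X m) (\<alpha> n m \<cdot> f \<cdot> t) x)"
proof -
  have "\<alpha> n l \<cdot> vcomp V T n m l g f \<cdot> t = (\<alpha> n l \<cdot> vcomp V T n m l g f) \<cdot> t"
    using vcomp_hom[OF f g] t by (simp add: hom_def)
  also have "\<dots> = vcomp V (self V) (Pow V X n) (Pow V X m) (Pow V X l)
      (\<alpha> m l \<cdot> g) (\<alpha> n m \<cdot> f) \<cdot> t"
    by (simp add: incl_comp[OF f g])
  finally show ?thesis using f g t x by (simp add: hom_def)
qed

lemma app_vId: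
  assumes t: "t \<in> hom V U (One V)" and x: "x \<in> hom V U (Pow V X n)"
  shows "app V (Pow V X n) (Pow V X n) (\<alpha> n n \<cdot> vId T n \<cdot> t) x = x"
proof -
  have "\<alpha> n n \<cdot> vId T n \<cdot> t = (\<alpha> n n \<cdot> vId T n) \<cdot> t"
    using t by (simp add: hom_def)
  then show ?thesis using t x by (simp add: incl_Id hom_def)
qed

lemma app_tProj:
  assumes i: "i < n" and t: "t \<in> hom V U (One V)" and x: "x \<in> hom V U (Pow V X n)"
  shows "app V (Pow V X n) X (\<alpha> n 1 \<cdot> tProj T n i \<cdot> t) x = Proj V X n i \<cdot> x"
proof -
  have "\<alpha> n 1 \<cdot> tProj T n i \<cdot> t = (\<alpha> n 1 \<cdot> tProj T n i) \<cdot> t"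
    using t i by (simp add: hom_def)
  then show ?thesis using t x i by (simp add: incl_tProj hom_def)
qed

lemma is_vcat: "is_vcat V T"
proof -
  have unit: "vcomp V T a a b f (vId T a \<cdot> bang V W) = f"
      "vcomp V T a b b (vId T b \<cdot> bang V W) f = f"
    if f: "f \<in> hom V W (vHom T a b)" for a b W f
  proof -
    have W: "W \<in> Ob V" using f by (auto simp: hom_def)
    then have u: "vId T c \<cdot> bang V W \<in> hom V W (vHom T c c)" for c
      by (simp add: hom_def)
    have id: "app V (Pow V X c) (Pow V X c) (\<alpha> c c \<cdot> (vId T c \<cdot> bang V W) \<cdot> t) x = x"
      if "t \<in> hom V U W" "x \<in> hom V U (Pow V X c)" for t x U c
      using app_vId[of "bang V U" U x c] that W by (auto simp: hom_def)
    show "vcomp V T a a b f (vId T a \<cdot> bang V W) = f"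
    proof (rule incl_eqI[OF vcomp_hom[OF u f] f])
      fix U t x assume tx: "t \<in> hom V U W" "x \<in> hom V U (Pow V X a)"
      show "app V (Pow V X a) (Pow V X b) (\<alpha> a b \<cdot> vcomp V T a a b f (vId T a \<cdot> bang V W) \<cdot> t) x =
        app V (Pow V X a) (Pow V X b) (\<alpha> a b \<cdot> f \<cdot> t) x"
        by (simp only: app_vcomp[OF u f tx] id[OF tx])
    qed
    show "vcomp V T a b b (vId T b \<cdot> bang V W) f = f"
    proof (rule incl_eqI[OF vcomp_hom[OF f u] f])
      fix U t x assume tx: "t \<in> hom V U W" "x \<in> hom V U (Pow V X a)"
      have "app V (Pow V X a) (Pow V X b) (\<alpha> a b \<cdot> f \<cdot> t) x \<in> hom V U (Pow V X b)"
        using f tx by (simp add: hom_def)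
      then show "app V (Pow V X a) (Pow V X b) (\<alpha> a b \<cdot> vcomp V T a b b (vId T b \<cdot> bang V W) f \<cdot> t) x =
        app V (Pow V X a) (Pow V X b) (\<alpha> a b \<cdot> f \<cdot> t) x"
        by (simp only: app_vcomp[OF f u tx] id[OF tx(1)])
    qed
  qed
  have assoc: "vcomp V T a b d (vcomp V T b c d h g) f = vcomp V T a c d h (vcomp V T a b c g f)"
    if f: "f \<in> hom V W (vHom T a b)" and g: "g \<in> hom V W (vHom T b c)"
      and h: "h \<in> hom V W (vHom T c d)" for a b c d W f g h
  proof (rule incl_eqI[OF vcomp_hom[OF f vcomp_hom[OF g h]] vcomp_hom[OF vcomp_hom[OF f g] h]])
    fix U t x assume tx: "t \<in> hom V U W" "x \<in> hom V U (Pow V X a)"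
    have fx: "app V (Pow V X a) (Pow V X b) (\<alpha> a b \<cdot> f \<cdot> t) x \<in> hom V U (Pow V X b)"
      using f tx by (simp add: hom_def)
    show "app V (Pow V X a) (Pow V X d) (\<alpha> a d \<cdot> vcomp V T a b d (vcomp V T b c d h g) f \<cdot> t) x =
        app V (Pow V X a) (Pow V X d) (\<alpha> a d \<cdot> vcomp V T a c d h (vcomp V T a b c g f) \<cdot> t) x"
      by (simp only: app_vcomp[OF f vcomp_hom[OF g h] tx] app_vcomp[OF vcomp_hom[OF f g] h tx]
          app_vcomp[OF f g tx] app_vcomp[OF g h tx(1) fx])
  qed
  show ?thesis
    unfolding is_vcat_def objects
    using unit assoc vComp_hom vId_hom by auto
qed

text \<open>
  A family of arrows \<open>W \<rightarrow> T(Y,1)\<close> is tupled in the full theory, where the power is the one of \<open>X\<close>;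
  by \<open>closed\<close> the result lies in \<open>T(Y,n)\<close>.
\<close>

lemma conical_power: "is_conical_power V T n 1 n (tProj T n)"
proof -
  have pow: "is_power V n (vHom T Y 1) (vHom T Y n)
      (\<lambda>i. vcomp V T Y n 1 (tProj T n i \<cdot> bang V (vHom T Y n)) (Ide V (vHom T Y n)))" for Y
  proof -
    let ?p = "\<lambda>i. vcomp V T Y n 1 (tProj T n i \<cdot> bang V (vHom T Y n)) (Ide V (vHom T Y n))"
    have u: "tProj T n i \<cdot> bang V (vHom T Y n) \<in> hom V (vHom T Y n) (vHom T n 1)"
      if "i < n" for i using that by (simp add: hom_def)
    have id: "Ide V (vHom T Y n) \<in> hom V (vHom T Y n) (vHom T Y n)" by (simp add: hom_def)
    have p: "?p i \<in> hom V (vHom T Y n) (vHom T Y 1)" if "i < n" for i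
      by (rule vcomp_hom[OF id u[OF that]])
    have app_p: "app V (Pow V X Y) X (\<alpha> Y 1 \<cdot> (?p i \<cdot> h) \<cdot> t) x =
        Proj V X n i \<cdot> app V (Pow V X Y) (Pow V X n) (\<alpha> Y n \<cdot> h \<cdot> t) x"
      if "i < n" "h \<in> hom V W (vHom T Y n)" "t \<in> hom V U W" "x \<in> hom V U (Pow V X Y)"
      for i h W U t x
    proof -
      have ht: "h \<cdot> t \<in> hom V U (vHom T Y n)" using that by (simp add: hom_def)
      have fx: "app V (Pow V X Y) (Pow V X n) (\<alpha> Y n \<cdot> h \<cdot> t) x \<in> hom V U (Pow V X n)"
        using that by (simp add: hom_def)
      have U: "U \<in> Ob V" using that by (auto simp: hom_def)
      have eq1: "(?p i \<cdot> h) \<cdot> t = ?p i \<cdot> (h \<cdot> t)"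
        using p[OF that(1)] that by (simp add: hom_def)
      have eq2: "\<alpha> n 1 \<cdot> (tProj T n i \<cdot> bang V (vHom T Y n)) \<cdot> (h \<cdot> t) =
        \<alpha> n 1 \<cdot> tProj T n i \<cdot> bang V U"
        using that by (simp add: hom_def)
      have eq3: "Ide V (vHom T Y n) \<cdot> (h \<cdot> t) = h \<cdot> t"
        using that by (simp add: hom_def)
      show ?thesis
        using app_vcomp[OF id u[OF that(1)] ht that(4)] U
          app_tProj[OF that(1) bang_hom[OF U] fx]
        by (simp only: eq1 eq2 eq3 Pow_1 X_Ob)
    qed
    have ex1: "\<exists>!h. h \<in> hom V W (vHom T Y n) \<and> (\<forall>i<n. ?p i \<cdot> h = f i)"
      if W: "W \<in> Ob V" and f: "\<forall>i<n. f i \<in> hom V W (vHom T Y 1)" for W f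
    proof (rule ex_ex1I)
      let ?B = "\<lambda>i. app V (Pow V X Y) X (\<alpha> Y 1 \<cdot> f i \<cdot> Fst V W (Pow V X Y)) (Snd V W (Pow V X Y))"
      let ?g = "transpose V W (Pow V X Y) (Pow V X n) (tuple V (Prd V W (Pow V X Y)) X n ?B)"
      have B: "?B i \<in> hom V (Prd V W (Pow V X Y)) X" if "i < n" for i
        using W f that by (simp add: hom_def)
      have g: "?g \<in> hom V W (Exp V (Pow V X Y) (Pow V X n))"
        using W B by (intro transpose_tuple_hom) simp_all
      have app_g: "Proj V X n i \<cdot> app V (Pow V X Y) (Pow V X n) (?g \<cdot> t) x =
          app V (Pow V X Y) X (\<alpha> Y 1 \<cdot> f i \<cdot> t) x"
        if "i < n" "t \<in> hom V U W" "x \<in> hom V U (Pow V X Y)" for i U t x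
      proof -
        have "Proj V X n i \<cdot> app V (Pow V X Y) (Pow V X n) (?g \<cdot> t) x = ?B i \<cdot> pair V t x"
          using W B that by (intro Proj_app_transpose_tuple[of W _ X n _ t U]) simp_all
        then show ?thesis using W f that by (simp add: hom_def)
      qed
      have "factors_through V ?g (\<alpha> Y n)"
      proof (rule closed[OF g])
        fix j assume j: "j < n"
        have "\<alpha> Y 1 \<cdot> f j = row X Y n j ?g"
        proof (rule Exp_eqI)
          show "row X Y n j ?g \<in> hom V W (Exp V (Pow V X Y) X)" by (rule row_hom[OF X_Ob g j])
          fix U t x assume tx: "t \<in> hom V U W" "x \<in> hom V U (Pow V X Y)"
          have "app V (Pow V X Y) X (row X Y n j ?g \<cdot> t) x = app V (Pow V X Y) X (\<alpha> Y 1 \<cdot> f j \<cdot> t) x"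
            by (simp only: app_row[OF X_Ob g j tx] app_g[OF j tx])
          then show "app V (Pow V X Y) X ((\<alpha> Y 1 \<cdot> f j) \<cdot> t) x = app V (Pow V X Y) X (row X Y n j ?g \<cdot> t) x"
            using f j tx by (simp add: hom_def)
        qed (use f j in \<open>auto simp: hom_def\<close>)
        moreover have "Dom V (row X Y n j ?g) = W" using row_hom[OF X_Ob g j] by (simp add: hom_def)
        ultimately show "factors_through V (row X Y n j ?g) (\<alpha> Y 1)"
          using f j by (auto simp: factors_through_def)
      qed
      then obtain h where h: "h \<in> hom V W (vHom T Y n)" "\<alpha> Y n \<cdot> h = ?g"
        using g by (auto simp: factors_through_def hom_Dom)
      have "?p i \<cdot> h = f i" if i: "i < n" for i
      proof (rule incl_eqI[of _ W Y 1])
        show "?p i \<cdot> h \<in> hom V W (vHom T Y 1)" using p[OF i] h by (simp add: hom_def)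
        show "f i \<in> hom V W (vHom T Y 1)" using f i by simp
        fix U t x assume tx: "t \<in> hom V U W" "x \<in> hom V U (Pow V X Y)"
        have "\<alpha> Y n \<cdot> h \<cdot> t = (\<alpha> Y n \<cdot> h) \<cdot> t" using h(1) tx by (simp add: hom_def)
        then show "app V (Pow V X Y) (Pow V X 1) (\<alpha> Y 1 \<cdot> (?p i \<cdot> h) \<cdot> t) x =
          app V (Pow V X Y) (Pow V X 1) (\<alpha> Y 1 \<cdot> f i \<cdot> t) x"
          by (simp only: app_p[OF i h(1) tx] h(2) app_g[OF i tx] Pow_1 X_Ob)
      qed
      with h show "\<exists>h. h \<in> hom V W (vHom T Y n) \<and> (\<forall>i<n. ?p i \<cdot> h = f i)" by blast
    next
      fix h k assume h: "h \<in> hom V W (vHom T Y n) \<and> (\<forall>i<n. ?p i \<cdot> h = f i)"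
        and k: "k \<in> hom V W (vHom T Y n) \<and> (\<forall>i<n. ?p i \<cdot> k = f i)"
      show "h = k"
      proof (rule incl_eqI)
        show hh: "h \<in> hom V W (vHom T Y n)" and kk: "k \<in> hom V W (vHom T Y n)" using h k by auto
        fix U t x assume tx: "t \<in> hom V U W" "x \<in> hom V U (Pow V X Y)"
        show "app V (Pow V X Y) (Pow V X n) (\<alpha> Y n \<cdot> h \<cdot> t) x =
          app V (Pow V X Y) (Pow V X n) (\<alpha> Y n \<cdot> k \<cdot> t) x"
        proof (rule Pow_eqI)
          fix i assume i: "i < n"
          show "Proj V X n i \<cdot> app V (Pow V X Y) (Pow V X n) (\<alpha> Y n \<cdot> h \<cdot> t) x =
            Proj V X n i \<cdot> app V (Pow V X Y) (Pow V X n) (\<alpha> Y n \<cdot> k \<cdot> t) x"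
            using h k i by (simp only: app_p[OF i hh tx, symmetric] app_p[OF i kk tx, symmetric])
        qed (use hh kk tx in \<open>auto simp: hom_def\<close>)
      qed
    qed
    show ?thesis
      unfolding is_power_def using p ex1 by auto
  qed
  show ?thesis
    unfolding is_conical_power_def objects using tProj_hom pow by auto
qed

lemma is_theory_over: "is_theory_over V X (T, \<alpha>)"
proof -
  have "tProj T 1 0 = vId T 1"
  proof (rule incl_cancel)
    show "\<alpha> 1 1 \<cdot> tProj T 1 0 = \<alpha> 1 1 \<cdot> vId T 1"
      by (simp add: incl_tProj incl_Id)
  qed (use tProj_hom[of 0 1] vId_hom[of 1] in simp_all)
  then have "is_theory V T"
    unfolding is_theory_def using is_vcat objects conical_power by blast
  moreover have "is_theory_morphism V T (full_theory V X) \<alpha>"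
    unfolding is_theory_morphism_def is_vfun_def
    using incl_hom incl_Id incl_comp incl_tProj by (simp add: objects)
  ultimately show ?thesis by (simp add: is_theory_over_def)
qed

end

text \<open>
  Both structures are computed in the full theory, and \<open>\<beta>\<close> is monic, so a family of arrows over
  the full theory is automatically functorial.
\<close>

lemma (in cartesian_closed) subtheory_morphism:
  assumes T: "subtheory V X T \<alpha>" and U: "subtheory V X U \<beta>"
    and F: "\<And>n m. F n m \<in> hom V (vHom T n m) (vHom U n m)" "\<And>n m. \<beta> n m \<cdot> F n m = \<alpha> n m"
  shows "is_morphism_over V (T, \<alpha>) (U, \<beta>) F"
proof -
  interpret T: subtheory V X T \<alpha> by (rule T)
  interpret U: subtheory V X U \<beta> by (rule U)
  have F_simps [simp]: "F n m \<in> Arr V" "Dom V (F n m) = vHom T n m" "Cod V (F n m) = vHom U n m" for n m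
    using F(1) by (auto simp: hom_def)
  have F_comp: "\<beta> n m \<cdot> F n m \<cdot> f = \<alpha> n m \<cdot> f" if "f \<in> hom V W (vHom T n m)" for W n m f
  proof -
    have "\<beta> n m \<cdot> F n m \<cdot> f = (\<beta> n m \<cdot> F n m) \<cdot> f" using that by (simp add: hom_def)
    then show ?thesis by (simp only: F(2))
  qed
  have F_hom: "F n m \<cdot> f \<in> hom V W (vHom U n m)" if "f \<in> hom V W (vHom T n m)" for W n m f
    using that by (simp add: hom_def)
  have comp: "F n l \<cdot> vcomp V T n m l g f = vcomp V U n m l (F m l \<cdot> g) (F n m \<cdot> f)"
    if f: "f \<in> hom V W (vHom T n m)" and g: "g \<in> hom V W (vHom T m l)" for n m l W f g
  proof (rule U.incl_cancel[OF F_hom[OF T.vcomp_hom[OF f g]] U.vcomp_hom[OF F_hom[OF f] F_hom[OF g]]])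
    show "\<beta> n l \<cdot> F n l \<cdot> vcomp V T n m l g f = \<beta> n l \<cdot> vcomp V U n m l (F m l \<cdot> g) (F n m \<cdot> f)"
      by (simp only: F_comp[OF T.vcomp_hom[OF f g]] T.incl_comp[OF f g]
          U.incl_comp[OF F_hom[OF f] F_hom[OF g]] F_comp[OF f] F_comp[OF g])
  qed
  have Id: "F n n \<cdot> vId T n = vId U n" for n
    by (rule U.incl_cancel[OF F_hom[OF T.vId_hom] U.vId_hom])
      (simp only: F_comp[OF T.vId_hom] T.incl_Id U.incl_Id)
  have tProj: "F n 1 \<cdot> tProj T n i = tProj U n i" if "i < n" for n i
    by (rule U.incl_cancel[OF F_hom[OF T.tProj_hom[OF that]] U.tProj_hom[OF that]])
      (simp only: F_comp[OF T.tProj_hom[OF that]] T.incl_tProj[OF that] U.incl_tProj[OF that])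
  show ?thesis
    unfolding is_morphism_over_def is_theory_morphism_def is_vfun_def
    using F comp Id tProj by (simp add: T.objects U.objects)
qed

text \<open>
  Two subtheories with the same underlying subobjects are isomorphic: the comparison arrows are
  unique, hence inverse to one another.
\<close>

lemma (in cartesian_closed) isomorphic_overI:
  assumes T: "subtheory V X T \<alpha>" and U: "subtheory V X U \<beta>"
    and TU: "\<And>n m. factors_through V (\<alpha> n m) (\<beta> n m)"
    and UT: "\<And>n m. factors_through V (\<beta> n m) (\<alpha> n m)"
  shows "isomorphic_over V X (T, \<alpha>) (U, \<beta>)"
proof -
  interpret T: subtheory V X T \<alpha> by (rule T)
  interpret U: subtheory V X U \<beta> by (rule U)
  have "\<forall>n m. \<exists>h. h \<in> hom V (vHom T n m) (vHom U n m) \<and> \<beta> n m \<cdot> h = \<alpha> n m"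
    using TU by (auto simp: factors_through_def)
  then obtain F where F: "\<And>n m. F n m \<in> hom V (vHom T n m) (vHom U n m)"
      "\<And>n m. \<beta> n m \<cdot> F n m = \<alpha> n m" by metis
  have "\<forall>n m. \<exists>h. h \<in> hom V (vHom U n m) (vHom T n m) \<and> \<alpha> n m \<cdot> h = \<beta> n m"
    using UT by (auto simp: factors_through_def)
  then obtain G where G: "\<And>n m. G n m \<in> hom V (vHom U n m) (vHom T n m)"
      "\<And>n m. \<alpha> n m \<cdot> G n m = \<beta> n m" by metis
  have [simp]: "F n m \<in> Arr V" "Dom V (F n m) = vHom T n m" "Cod V (F n m) = vHom U n m"
    "G n m \<in> Arr V" "Dom V (G n m) = vHom U n m" "Cod V (G n m) = vHom T n m" for n m
    using F(1) G(1) by (auto simp: hom_def)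
  have "G n m \<cdot> F n m = Ide V (vHom T n m)" for n m
  proof (rule T.incl_cancel)
    have "\<alpha> n m \<cdot> G n m \<cdot> F n m = (\<alpha> n m \<cdot> G n m) \<cdot> F n m" by simp
    then show "\<alpha> n m \<cdot> G n m \<cdot> F n m = \<alpha> n m \<cdot> Ide V (vHom T n m)" by (simp only: F G) simp
  qed (simp_all add: hom_def)
  moreover have "F n m \<cdot> G n m = Ide V (vHom U n m)" for n m
  proof (rule U.incl_cancel)
    have "\<beta> n m \<cdot> F n m \<cdot> G n m = (\<beta> n m \<cdot> F n m) \<cdot> G n m" by simp
    then show "\<beta> n m \<cdot> F n m \<cdot> G n m = \<beta> n m \<cdot> Ide V (vHom U n m)" by (simp only: F G) simp
  qed (simp_all add: hom_def)
  ultimately show ?thesis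
    unfolding isomorphic_over_def
    using T.is_theory_over U.is_theory_over subtheory_morphism[OF T U F] subtheory_morphism[OF U T G]
    by (intro conjI exI[of _ F] exI[of _ G]) simp_all
qed

section \<open>Natural transformations between powers of an algebra\<close>

context cartesian_closed
begin

text \<open>
  Naturality is an equation between arrows from \<open>T(b,c) \<times> W\<close> to an exponential; it holds if and only
  if it holds for generalized elements \<open>h\<close> of \<open>T(b,c)\<close>, \<open>t\<close> of \<open>W\<close> and \<open>y\<close> of \<open>A(b)\<close>.
\<close>

lemma is_vnat_iff:
  assumes A: "\<And>k. fOb A k \<in> Ob V" "\<And>b c. fHom A b c \<in> hom V (vHom T b c) (Exp V (fOb A b) (fOb A c))"
    and B: "\<And>k. fOb B k \<in> Ob V" "\<And>b c. fHom B b c \<in> hom V (vHom T b c) (Exp V (fOb B b) (fOb B c))"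
    and T: "vOb T = UNIV"
  shows "is_vnat V T (self V) A B W p \<longleftrightarrow>
    W \<in> Ob V \<and> (\<forall>k. p k \<in> hom V W (Exp V (fOb A k) (fOb B k))) \<and>
    (\<forall>b c U h t y. h \<in> hom V U (vHom T b c) \<longrightarrow> t \<in> hom V U W \<longrightarrow> y \<in> hom V U (fOb A b) \<longrightarrow>
      app V (fOb B b) (fOb B c) (fHom B b c \<cdot> h) (app V (fOb A b) (fOb B b) (p b \<cdot> t) y) =
      app V (fOb A c) (fOb B c) (p c \<cdot> t) (app V (fOb A b) (fOb A c) (fHom A b c \<cdot> h) y))"
    (is "_ \<longleftrightarrow> ?W \<and> ?typed \<and> ?natural")
proof -
  have [simp]: "fOb A k \<in> Ob V" "fHom A b c \<in> Arr V" "Dom V (fHom A b c) = vHom T b c"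
    "Cod V (fHom A b c) = Exp V (fOb A b) (fOb A c)"
    "fOb B k \<in> Ob V" "fHom B b c \<in> Arr V" "Dom V (fHom B b c) = vHom T b c"
    "Cod V (fHom B b c) = Exp V (fOb B b) (fOb B c)" for k b c
    using A B by (auto simp: hom_def)
  have H [simp]: "vHom T b c \<in> Ob V" for b c
    using Dom_Ob'[of "fHom A b c"] by simp
  define L where "L b c = vcomp V (self V) (fOb A b) (fOb B b) (fOb B c)
    (fHom B b c \<cdot> Fst V (vHom T b c) W) (p b \<cdot> Snd V (vHom T b c) W)" for b c
  define R where "R b c = vcomp V (self V) (fOb A b) (fOb A c) (fOb B c)
    (p c \<cdot> Snd V (vHom T b c) W) (fHom A b c \<cdot> Fst V (vHom T b c) W)" for b c
  have "L b c = R b c \<longleftrightarrow>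
    (\<forall>U h t y. h \<in> hom V U (vHom T b c) \<longrightarrow> t \<in> hom V U W \<longrightarrow> y \<in> hom V U (fOb A b) \<longrightarrow>
      app V (fOb B b) (fOb B c) (fHom B b c \<cdot> h) (app V (fOb A b) (fOb B b) (p b \<cdot> t) y) =
      app V (fOb A c) (fOb B c) (p c \<cdot> t) (app V (fOb A b) (fOb A c) (fHom A b c \<cdot> h) y))"
    (is "_ \<longleftrightarrow> ?N") if W [simp]: "W \<in> Ob V" and p: "?typed" for b c
  proof -
    have [simp]: "p k \<in> Arr V" "Dom V (p k) = W" "Cod V (p k) = Exp V (fOb A k) (fOb B k)" for k
      using p by (auto simp: hom_def)
    have L: "L b c \<in> hom V (Prd V (vHom T b c) W) (Exp V (fOb A b) (fOb B c))"
      and R: "R b c \<in> hom V (Prd V (vHom T b c) W) (Exp V (fOb A b) (fOb B c))"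
      by (simp_all add: L_def R_def hom_def)
    have app_L: "app V (fOb A b) (fOb B c) (L b c \<cdot> s) y =
        app V (fOb B b) (fOb B c) (fHom B b c \<cdot> (Fst V (vHom T b c) W \<cdot> s))
          (app V (fOb A b) (fOb B b) (p b \<cdot> (Snd V (vHom T b c) W \<cdot> s)) y)"
      and app_R: "app V (fOb A b) (fOb B c) (R b c \<cdot> s) y =
        app V (fOb A c) (fOb B c) (p c \<cdot> (Snd V (vHom T b c) W \<cdot> s))
          (app V (fOb A b) (fOb A c) (fHom A b c \<cdot> (Fst V (vHom T b c) W \<cdot> s)) y)"
      if "s \<in> hom V U (Prd V (vHom T b c) W)" "y \<in> hom V U (fOb A b)" for U s y
      using that by (simp_all add: L_def R_def hom_def)
    show ?thesis
    proof (intro iffI allI impI)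
      fix U h t y
      assume eq: "L b c = R b c" and hty: "h \<in> hom V U (vHom T b c)" "t \<in> hom V U W"
        "y \<in> hom V U (fOb A b)"
      then have s: "pair V h t \<in> hom V U (Prd V (vHom T b c) W)" by (simp add: hom_def)
      have "Fst V (vHom T b c) W \<cdot> pair V h t = h" "Snd V (vHom T b c) W \<cdot> pair V h t = t"
        using hty by (simp_all add: hom_def)
      then show "app V (fOb B b) (fOb B c) (fHom B b c \<cdot> h) (app V (fOb A b) (fOb B b) (p b \<cdot> t) y) =
          app V (fOb A c) (fOb B c) (p c \<cdot> t) (app V (fOb A b) (fOb A c) (fHom A b c \<cdot> h) y)"
        using app_L[OF s hty(3)] app_R[OF s hty(3)] eq by simp
    next
      assume N: ?N
      show "L b c = R b c"
      proof (rule Exp_eqI[OF L R])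
        fix U s y
        assume s: "s \<in> hom V U (Prd V (vHom T b c) W)" and y: "y \<in> hom V U (fOb A b)"
        have "Fst V (vHom T b c) W \<cdot> s \<in> hom V U (vHom T b c)" "Snd V (vHom T b c) W \<cdot> s \<in> hom V U W"
          using s by (simp_all add: hom_def)
        with N y show "app V (fOb A b) (fOb B c) (L b c \<cdot> s) y = app V (fOb A b) (fOb B c) (R b c \<cdot> s) y"
          unfolding app_L[OF s y] app_R[OF s y] by blast
      qed simp_all
    qed
  qed
  then have "W \<in> Ob V \<Longrightarrow> ?typed \<Longrightarrow> (\<forall>b c. L b c = R b c) \<longleftrightarrow> ?natural" by simp
  then show ?thesis
    unfolding is_vnat_def T L_def R_def by (auto simp: Let_def)
qed

end

context subtheory
begin

abbreviation apow :: "nat \<Rightarrow> nat \<Rightarrow> 'o" where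
  "apow k n \<equiv> Pow V (Pow V X k) n"

text \<open>
  Evaluation of components at \<open>k\<close> of transformations \<open>A\<^sup>n \<rightarrow> A\<^sup>m\<close>.
\<close>

abbreviation aval :: "nat \<Rightarrow> nat \<Rightarrow> nat \<Rightarrow> 'a \<Rightarrow> 'a \<Rightarrow> 'a" where
  "aval k n m \<equiv> app V (apow k n) (apow k m)"

text \<open>
  Evaluation of the action of \<open>T(b,c)\<close> on \<open>A\<^sup>n\<close>, from \<open>(X\<^sup>b)\<^sup>n\<close> to \<open>(X\<^sup>c)\<^sup>n\<close>.
\<close>

abbreviation top_val :: "nat \<Rightarrow> nat \<Rightarrow> nat \<Rightarrow> 'a \<Rightarrow> 'a \<Rightarrow> 'a" where
  "top_val b c n \<equiv> app V (apow b n) (apow c n)"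

abbreviation alg :: "nat \<Rightarrow> (nat, 'o, 'a) vfun" where
  "alg \<equiv> alg_pow V T (over_algebra V X \<alpha>)"

abbreviation alg_vnat :: "nat \<Rightarrow> nat \<Rightarrow> 'o \<Rightarrow> (nat \<Rightarrow> 'a) \<Rightarrow> bool" where
  "alg_vnat n m \<equiv> is_vnat V T (self V) (alg n) (alg m)"

lemma fOb_alg [simp]: "fOb (alg n) k = apow k n"
  by (simp add: alg_pow_def over_algebra_def)

lemma fHom_alg_entry:
  assumes "i < n"
  shows "app V (Pow V X j) (Pow V X k) (\<alpha> j k \<cdot> Fst V (vHom T j k) (apow j n))
       (Proj V (Pow V X j) n i \<cdot> Snd V (vHom T j k) (apow j n))
     \<in> hom V (Prd V (vHom T j k) (apow j n)) (Pow V X k)"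
  using assms by (simp add: hom_def)

lemma fHom_alg: "fHom (alg n) j k =
  transpose V (vHom T j k) (apow j n) (apow k n)
    (tuple V (Prd V (vHom T j k) (apow j n)) (Pow V X k) n
      (\<lambda>i. app V (Pow V X j) (Pow V X k) (\<alpha> j k \<cdot> Fst V (vHom T j k) (apow j n))
       (Proj V (Pow V X j) n i \<cdot> Snd V (vHom T j k) (apow j n))))"
  by (simp add: alg_pow_def over_algebra_def Let_def)

lemma fHom_alg_hom:
  "fHom (alg n) j k \<in> hom V (vHom T j k) (Exp V (apow j n) (apow k n))"
  unfolding fHom_alg by (rule transpose_tuple_hom) (simp_all add: fHom_alg_entry)

lemma fHom_alg_simps [simp]: "fHom (alg n) j k \<in> Arr V" "Dom V (fHom (alg n) j k) = vHom T j k"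
  "Cod V (fHom (alg n) j k) = Exp V (apow j n) (apow k n)"
  using fHom_alg_hom by (auto simp: hom_def)

lemma Proj_app_alg:
  assumes "i < n" "h \<in> hom V U (vHom T j k)" "y \<in> hom V U (apow j n)"
  shows "Proj V (Pow V X k) n i \<cdot>
      top_val j k n (fHom (alg n) j k \<cdot> h) y =
    val j k (\<alpha> j k \<cdot> h) (Proj V (Pow V X j) n i \<cdot> y)"
proof -
  let ?H = "vHom T j k" and ?Y = "apow j n"
  have "Proj V (Pow V X k) n i \<cdot>
      app V ?Y (apow k n) (fHom (alg n) j k \<cdot> h) y =
      val j k (\<alpha> j k \<cdot> Fst V ?H ?Y) (Proj V (Pow V X j) n i \<cdot> Snd V ?H ?Y) \<cdot> pair V h y"
    unfolding fHom_alg using assms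
    by (intro Proj_app_transpose_tuple[where U = U]) (simp_all add: fHom_alg_entry)
  then show ?thesis using assms by (simp add: hom_def)
qed

lemma alg_vnat_iff:
  "alg_vnat n m W p \<longleftrightarrow>
    W \<in> Ob V \<and> (\<forall>k. p k \<in> hom V W (Exp V (apow k n) (apow k m))) \<and>
    (\<forall>b c U h t y. h \<in> hom V U (vHom T b c) \<longrightarrow> t \<in> hom V U W \<longrightarrow>
      y \<in> hom V U (apow b n) \<longrightarrow>
      top_val b c m (fHom (alg m) b c \<cdot> h)
        (aval b n m (p b \<cdot> t) y) =
      aval c n m (p c \<cdot> t)
        (top_val b c n (fHom (alg n) b c \<cdot> h) y))"
  by (subst is_vnat_iff) (simp_all add: objects hom_def)

lemma alg_vnat_hom:
  assumes "alg_vnat n m W p"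
  shows "p k \<in> hom V W (Exp V (apow k n) (apow k m))" "W \<in> Ob V"
    "p 1 \<in> hom V W (Exp V (Pow V X n) (Pow V X m))"
proof -
  show p: "p k \<in> hom V W (Exp V (apow k n) (apow k m))" for k
    using assms by (auto simp: alg_vnat_iff)
  show "W \<in> Ob V"
    using assms by (auto simp: alg_vnat_iff)
  show "p 1 \<in> hom V W (Exp V (Pow V X n) (Pow V X m))" using p[of 1] by simp
qed

lemma alg_vnat_natural:
  assumes "alg_vnat n m W p"
    "h \<in> hom V U (vHom T b c)" "t \<in> hom V U W" "y \<in> hom V U (apow b n)"
  shows "top_val b c m (fHom (alg m) b c \<cdot> h)
        (aval b n m (p b \<cdot> t) y) =
      aval c n m (p c \<cdot> t)
        (top_val b c n (fHom (alg n) b c \<cdot> h) y)"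
  using assms unfolding alg_vnat_iff by blast

lemma alg_to_1:
  assumes h: "h \<in> hom V U (vHom T k 1)" and y: "y \<in> hom V U (apow k n)"
  shows "app V (apow k n) (Pow V X n) (fHom (alg n) k 1 \<cdot> h) y =
    tuple V U X n (\<lambda>a. op_val k (\<alpha> k 1 \<cdot> h) (Proj V (Pow V X k) n a \<cdot> y))"
proof (rule Pow_eqI)
  have U: "U \<in> Ob V" using h by (auto simp: hom_def)
  have hy: "op_val k (\<alpha> k 1 \<cdot> h) (Proj V (Pow V X k) n a \<cdot> y) \<in> hom V U X" if "a < n" for a
    using h y that by (simp add: hom_def)
  show "app V (apow k n) (Pow V X n) (fHom (alg n) k 1 \<cdot> h) y \<in> hom V U (Pow V X n)"
    using h y by (simp add: hom_def)
  show "tuple V U X n (\<lambda>a. op_val k (\<alpha> k 1 \<cdot> h) (Proj V (Pow V X k) n a \<cdot> y)) \<in> hom V U (Pow V X n)"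
    using hy U by (simp add: hom_def)
  show "Proj V X n i \<cdot> app V (apow k n) (Pow V X n) (fHom (alg n) k 1 \<cdot> h) y =
    Proj V X n i \<cdot> tuple V U X n (\<lambda>a. op_val k (\<alpha> k 1 \<cdot> h) (Proj V (Pow V X k) n a \<cdot> y))"
    if i: "i < n" for i
    using Proj_app_alg[OF i h y] hy U i by simp
qed simp

text \<open>
  Naturality with respect to the projection \<open>\<pi>\<^sub>i : k \<rightarrow> 1\<close>: the component at \<open>k\<close> applies the component
  at \<open>1\<close> to each of the \<open>k\<close> columns of an element of \<open>(X\<^sup>k)\<^sup>n\<close>. So a transformation between powers of
  the algebra is determined by its component at \<open>1\<close>.
\<close>

lemma alg_vnat_entry:
  assumes p: "alg_vnat n m W p"
    and t: "t \<in> hom V U W" and y: "y \<in> hom V U (apow k n)" and j: "j < m" and i: "i < k"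
  shows "Proj V X k i \<cdot> Proj V (Pow V X k) m j \<cdot>
      aval k n m (p k \<cdot> t) y =
    Proj V X m j \<cdot> val n m (p 1 \<cdot> t)
      (tuple V U X n (\<lambda>a. Proj V X k i \<cdot> Proj V (Pow V X k) n a \<cdot> y))"
proof -
  have U: "U \<in> Ob V" using t by (auto simp: hom_def)
  define h where "h = tProj T k i \<cdot> bang V U"
  have h: "h \<in> hom V U (vHom T k 1)" using U i by (simp add: h_def hom_def)
  have app_h: "op_val k (\<alpha> k 1 \<cdot> h) z = Proj V X k i \<cdot> z" if "z \<in> hom V U (Pow V X k)" for z
    unfolding h_def by (rule app_tProj[OF i bang_hom[OF U] that])
  define py where "py = aval k n m (p k \<cdot> t) y"
  have py: "py \<in> hom V U (apow k m)"
    using alg_vnat_hom(1)[OF p, of k] t y by (simp add: py_def hom_def)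
  have pyj: "Proj V (Pow V X k) m j \<cdot> py \<in> hom V U (Pow V X k)"
    using py j by (simp add: hom_def)
  have ya: "Proj V (Pow V X k) n a \<cdot> y \<in> hom V U (Pow V X k)" if "a < n" for a
    using y that by (simp add: hom_def)
  have "Proj V X k i \<cdot> Proj V (Pow V X k) m j \<cdot> py = op_val k (\<alpha> k 1 \<cdot> h) (Proj V (Pow V X k) m j \<cdot> py)"
    by (simp only: app_h[OF pyj])
  also have "\<dots> = Proj V X m j \<cdot> app V (apow k m) (Pow V X m) (fHom (alg m) k 1 \<cdot> h) py"
    using Proj_app_alg[OF j h py] by simp
  also have "app V (apow k m) (Pow V X m) (fHom (alg m) k 1 \<cdot> h) py =
      val n m (p 1 \<cdot> t) (app V (apow k n) (Pow V X n) (fHom (alg n) k 1 \<cdot> h) y)"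
    using alg_vnat_natural[OF p h t y] by (simp add: py_def)
  also have "app V (apow k n) (Pow V X n) (fHom (alg n) k 1 \<cdot> h) y =
      tuple V U X n (\<lambda>a. Proj V X k i \<cdot> Proj V (Pow V X k) n a \<cdot> y)"
    unfolding alg_to_1[OF h y] using app_h[OF ya] by (rule tuple_cong)
  finally show ?thesis by (simp only: py_def)
qed

lemma Pow_Pow_eqI:
  assumes "f \<in> hom V U (apow k m)" "g \<in> hom V U (apow k m)"
    and "\<And>i j. i < k \<Longrightarrow> j < m \<Longrightarrow>
      Proj V X k i \<cdot> Proj V (Pow V X k) m j \<cdot> f = Proj V X k i \<cdot> Proj V (Pow V X k) m j \<cdot> g"
  shows "f = g"
proof (rule Pow_eqI[OF assms(1,2)])
  fix j assume "j < m"
  with assms show "Proj V (Pow V X k) m j \<cdot> f = Proj V (Pow V X k) m j \<cdot> g"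
    by (intro Pow_eqI[of "Proj V (Pow V X k) m j \<cdot> f" U X k "Proj V (Pow V X k) m j \<cdot> g"])
      (simp_all add: hom_def)
qed simp

lemma alg_vnat_eqI:
  assumes p: "alg_vnat n m W p"
    and q: "alg_vnat n m W q" and eq: "p 1 = q 1"
  shows "p k = q k"
proof (rule Exp_eqI[OF alg_vnat_hom(1)[OF p] alg_vnat_hom(1)[OF q]])
  fix U t y assume ty: "t \<in> hom V U W" "y \<in> hom V U (apow k n)"
  show "aval k n m (p k \<cdot> t) y =
    aval k n m (q k \<cdot> t) y"
  proof (rule Pow_Pow_eqI)
    show "aval k n m (p k \<cdot> t) y \<in> hom V U (apow k m)"
      using alg_vnat_hom(1)[OF p, of k] ty by (simp add: hom_def)
    show "aval k n m (q k \<cdot> t) y \<in> hom V U (apow k m)"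
      using alg_vnat_hom(1)[OF q, of k] ty by (simp add: hom_def)
  qed (simp only: alg_vnat_entry[OF p ty] alg_vnat_entry[OF q ty] eq)
qed simp_all

text \<open>
  Naturality with respect to \<open>h\<close>, evaluated at the element of \<open>(X\<^sup>b)\<^sup>n\<close> with rows \<open>x a\<close>: by
  \<open>alg_vnat_entry\<close>, the components at \<open>b\<close> and \<open>l\<close> act columnwise through \<open>p 1\<close>.
\<close>

lemma alg_vnat_commutes:
  assumes p: "alg_vnat n m W p"
  shows "commutes n m (p 1)"
  unfolding commutes_def
proof (intro allI impI)
  fix U t b l h x j q
  assume t: "t \<in> hom V U (Dom V (p 1))" and h: "h \<in> hom V U (vHom T b l)"
    and x: "\<forall>a<n. \<forall>i<b. x a i \<in> hom V U X" and j: "j < m" and q: "q < l"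
  have U: "U \<in> Ob V" and t': "t \<in> hom V U W"
    using t alg_vnat_hom(3)[OF p] by (auto simp: hom_def)
  define y where "y = tuple V U (Pow V X b) n (\<lambda>a. tuple V U X b (x a))"
  have xa: "tuple V U X b (x a) \<in> hom V U (Pow V X b)" if "a < n" for a
    using x U that by (simp add: hom_def)
  have y_row: "Proj V (Pow V X b) n a \<cdot> y = tuple V U X b (x a)" if "a < n" for a
    using xa U that by (simp_all add: y_def hom_def)
  have y: "y \<in> hom V U (apow b n)"
    using xa U by (simp_all add: y_def hom_def)
  have y_entry: "Proj V X b i \<cdot> Proj V (Pow V X b) n a \<cdot> y = x a i" if "a < n" "i < b" for a i
    using x U that by (simp add: y_row)
  define py where "py = aval b n m (p b \<cdot> t) y"
  have py: "py \<in> hom V U (apow b m)"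
    using alg_vnat_hom(1)[OF p, of b] t' y by (simp add: py_def hom_def)
  have pyj: "Proj V (Pow V X b) m j \<cdot> py \<in> hom V U (Pow V X b)"
    using py j by (simp add: hom_def)
  have "Proj V (Pow V X b) m j \<cdot> py = tuple V U X b (\<lambda>i. Proj V X b i \<cdot> Proj V (Pow V X b) m j \<cdot> py)"
    using pyj by simp
  also have "\<dots> = tuple V U X b (\<lambda>i. Proj V X m j \<cdot> val n m (p 1 \<cdot> t) (tuple V U X n (\<lambda>a. x a i)))"
  proof (rule tuple_cong)
    fix i assume i: "i < b"
    have "tuple V U X n (\<lambda>a. Proj V X b i \<cdot> Proj V (Pow V X b) n a \<cdot> y) = tuple V U X n (\<lambda>a. x a i)"
      using y_entry i by (intro tuple_cong)
    then show "Proj V X b i \<cdot> Proj V (Pow V X b) m j \<cdot> py =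
        Proj V X m j \<cdot> val n m (p 1 \<cdot> t) (tuple V U X n (\<lambda>a. x a i))"
      using alg_vnat_entry[OF p t' y j i] by (simp only: py_def)
  qed
  finally have lhs: "tuple V U X b (\<lambda>i. Proj V X m j \<cdot> val n m (p 1 \<cdot> t) (tuple V U X n (\<lambda>a. x a i))) =
      Proj V (Pow V X b) m j \<cdot> py" ..
  define hy where "hy = top_val b l n (fHom (alg n) b l \<cdot> h) y"
  have hy: "hy \<in> hom V U (apow l n)"
    using h y by (simp add: hy_def hom_def)
  have rhs: "tuple V U X n (\<lambda>a. Proj V X l q \<cdot> val b l (\<alpha> b l \<cdot> h) (tuple V U X b (x a))) =
      tuple V U X n (\<lambda>a. Proj V X l q \<cdot> Proj V (Pow V X l) n a \<cdot> hy)"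
    by (rule tuple_cong) (simp only: hy_def y_row Proj_app_alg[OF _ h y])
  have "Proj V X l q \<cdot> val b l (\<alpha> b l \<cdot> h) (Proj V (Pow V X b) m j \<cdot> py) =
      Proj V X l q \<cdot> Proj V (Pow V X l) m j \<cdot>
        top_val b l m (fHom (alg m) b l \<cdot> h) py"
    by (simp only: Proj_app_alg[OF j h py])
  also have "top_val b l m (fHom (alg m) b l \<cdot> h) py =
      aval l n m (p l \<cdot> t) hy"
    unfolding py_def hy_def by (rule alg_vnat_natural[OF p h t' y])
  also have "Proj V X l q \<cdot> Proj V (Pow V X l) m j \<cdot> \<dots> = Proj V X m j \<cdot> val n m (p 1 \<cdot> t)
      (tuple V U X n (\<lambda>a. Proj V X l q \<cdot> Proj V (Pow V X l) n a \<cdot> hy))"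
    by (rule alg_vnat_entry[OF p t' hy j q])
  finally show "Proj V X l q \<cdot> val b l (\<alpha> b l \<cdot> h)
          (tuple V U X b (\<lambda>i. Proj V X m j \<cdot> val n m (p 1 \<cdot> t) (tuple V U X n (\<lambda>a. x a i)))) =
        Proj V X m j \<cdot> val n m (p 1 \<cdot> t)
          (tuple V U X n (\<lambda>a. Proj V X l q \<cdot> val b l (\<alpha> b l \<cdot> h) (tuple V U X b (x a))))"
    by (simp only: lhs rhs)
qed

text \<open>
  The columnwise action of \<open>f\<close> on \<open>(X\<^sup>k)\<^sup>n\<close>; by \<open>alg_vnat_entry\<close> this is the only candidate for a
  transformation with component \<open>f\<close> at \<open>1\<close>.
\<close>

definition extension :: "nat \<Rightarrow> nat \<Rightarrow> 'a \<Rightarrow> nat \<Rightarrow> 'a" where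
  "extension n m f k =
     (let W = Dom V f; Y = apow k n in
      transpose V W Y (apow k m)
        (tuple V (Prd V W Y) (Pow V X k) m (\<lambda>j. tuple V (Prd V W Y) X k (\<lambda>i.
          Proj V X m j \<cdot> val n m (f \<cdot> Fst V W Y)
            (tuple V (Prd V W Y) X n (\<lambda>a. Proj V X k i \<cdot> Proj V (Pow V X k) n a \<cdot> Snd V W Y))))))"

lemma extension_hom:
    "f \<in> hom V W (Exp V (Pow V X n) (Pow V X m)) \<Longrightarrow>
      extension n m f k \<in> hom V W (Exp V (apow k n) (apow k m))"
  and extension_entry:
    "\<lbrakk>f \<in> hom V W (Exp V (Pow V X n) (Pow V X m)); t \<in> hom V U W;
      y \<in> hom V U (apow k n); j < m; i < k\<rbrakk> \<Longrightarrow>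
      Proj V X k i \<cdot> Proj V (Pow V X k) m j \<cdot>
        aval k n m (extension n m f k \<cdot> t) y =
      Proj V X m j \<cdot> val n m (f \<cdot> t)
        (tuple V U X n (\<lambda>a. Proj V X k i \<cdot> Proj V (Pow V X k) n a \<cdot> y))"
proof -
  assume f: "f \<in> hom V W (Exp V (Pow V X n) (Pow V X m))"
  let ?Y = "apow k n"
  let ?S = "Prd V W ?Y"
  define e where "e i = tuple V ?S X n (\<lambda>a. Proj V X k i \<cdot> Proj V (Pow V X k) n a \<cdot> Snd V W ?Y)" for i
  define c where "c j i = Proj V X m j \<cdot> val n m (f \<cdot> Fst V W ?Y) (e i)" for j i
  define r where "r j = tuple V ?S X k (\<lambda>i. c j i)" for j
  have W: "W \<in> Ob V" and DW: "Dom V f = W" using f by (auto simp: hom_def)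
  have e: "e i \<in> hom V ?S (Pow V X n)" if "i < k" for i
    using W that by (simp add: e_def hom_def)
  have c: "c j i \<in> hom V ?S X" if "j < m" "i < k" for i j
    using W f that e[OF that(2)] by (simp add: c_def hom_def)
  have r: "r j \<in> hom V ?S (Pow V X k)" if "j < m" for j
    using W c that by (simp add: r_def hom_def)
  have ext: "extension n m f k = transpose V W ?Y (apow k m)
      (tuple V ?S (Pow V X k) m r)"
    by (simp only: extension_def Let_def DW r_def[abs_def] c_def[abs_def] e_def)
  show "extension n m f k \<in> hom V W (Exp V ?Y (apow k m))"
    unfolding ext using W r by (intro transpose_tuple_hom) simp_all
  assume t: "t \<in> hom V U W" and y: "y \<in> hom V U ?Y" and j: "j < m" and i: "i < k"
  have p: "pair V t y \<in> hom V U ?S" "Snd V W ?Y \<cdot> pair V t y = y" "Fst V W ?Y \<cdot> pair V t y = t"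
    using t y by (simp_all add: hom_def)
  have "Proj V (Pow V X k) m j \<cdot>
        app V ?Y (apow k m) (extension n m f k \<cdot> t) y = r j \<cdot> pair V t y"
    unfolding ext using W r t y j by (intro Proj_app_transpose_tuple[where U = U]) simp_all
  then have "Proj V X k i \<cdot> Proj V (Pow V X k) m j \<cdot>
        app V ?Y (apow k m) (extension n m f k \<cdot> t) y = Proj V X k i \<cdot> (r j \<cdot> pair V t y)"
    by (rule arg_cong)
  also have "\<dots> = (Proj V X k i \<cdot> r j) \<cdot> pair V t y"
    using r[OF j] i p(1) by (simp add: hom_def)
  also have "Proj V X k i \<cdot> r j = c j i"
    using W c j i by (simp add: r_def)
  also have "c j i \<cdot> pair V t y = Proj V X m j \<cdot> val n m (f \<cdot> t) (e i \<cdot> pair V t y)"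
    using W f j e[OF i] p by (simp add: c_def hom_def)
  also have "e i \<cdot> pair V t y = tuple V U X n (\<lambda>a. Proj V X k i \<cdot> Proj V (Pow V X k) n a \<cdot> y)"
  proof -
    have "e i \<cdot> pair V t y = tuple V (Dom V (pair V t y)) X n
        (\<lambda>a. (Proj V X k i \<cdot> Proj V (Pow V X k) n a \<cdot> Snd V W ?Y) \<cdot> pair V t y)"
      unfolding e_def using W p(1) i by (intro tuple_comp) (simp_all add: hom_def)
    also have "\<dots> = tuple V U X n (\<lambda>a. Proj V X k i \<cdot> Proj V (Pow V X k) n a \<cdot> y)"
      using W p i by (auto simp: hom_def intro!: tuple_cong)
    finally show ?thesis .
  qed
  finally show "Proj V X k i \<cdot> Proj V (Pow V X k) m j \<cdot>
        app V ?Y (apow k m) (extension n m f k \<cdot> t) y =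
      Proj V X m j \<cdot> val n m (f \<cdot> t)
        (tuple V U X n (\<lambda>a. Proj V X k i \<cdot> Proj V (Pow V X k) n a \<cdot> y))" .
qed

lemma extension_1:
  assumes f: "f \<in> hom V W (Exp V (Pow V X n) (Pow V X m))"
  shows "extension n m f 1 = f"
proof (rule Exp_eqI[OF _ f])
  show e: "extension n m f 1 \<in> hom V W (Exp V (Pow V X n) (Pow V X m))"
    using extension_hom[OF f, of 1] by simp
  fix U t y assume t: "t \<in> hom V U W" and y: "y \<in> hom V U (Pow V X n)"
  have fy: "val n m (f \<cdot> t) y \<in> hom V U (Pow V X m)"
    and ey: "val n m (extension n m f 1 \<cdot> t) y \<in> hom V U (Pow V X m)"
    using f e t y by (simp_all add: hom_def)
  show "val n m (extension n m f 1 \<cdot> t) y = val n m (f \<cdot> t) y"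
  proof (rule Pow_eqI[OF ey fy])
    fix j assume j: "j < m"
    have "tuple V U X n (\<lambda>a. Proj V X 1 0 \<cdot> Proj V (Pow V X 1) n a \<cdot> y) =
        tuple V U X n (\<lambda>a. Proj V X n a \<cdot> y)"
      using y by (intro tuple_cong) (simp add: hom_def)
    also have "\<dots> = y" using y by simp
    moreover have "Proj V X 1 0 \<cdot> Proj V X m j \<cdot> val n m (extension n m f 1 \<cdot> t) y =
        Proj V X m j \<cdot> val n m (extension n m f 1 \<cdot> t) y"
      using ey j by (simp add: hom_def)
    ultimately show "Proj V X m j \<cdot> val n m (extension n m f 1 \<cdot> t) y = Proj V X m j \<cdot> val n m (f \<cdot> t) y"
      using extension_entry[OF f t _ j, of y 1 0] y by simp
  qed simp
qed simp_all

text \<open>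
  Commutation of \<open>f\<close> with \<open>h\<close> is naturality of the extension with respect to \<open>h\<close>, entry by entry.
\<close>

lemma extension_vnat:
  assumes f: "f \<in> hom V W (Exp V (Pow V X n) (Pow V X m))" and comm: "commutes n m f"
  shows "alg_vnat n m W (extension n m f)"
  unfolding alg_vnat_iff
proof (intro conjI allI impI)
  show "W \<in> Ob V" using f by (auto simp: hom_def)
  show "extension n m f k \<in> hom V W (Exp V (apow k n) (apow k m))" for k
    by (rule extension_hom[OF f])
  fix b c U h t y
  assume h: "h \<in> hom V U (vHom T b c)" and t: "t \<in> hom V U W"
    and y: "y \<in> hom V U (apow b n)"
  let ?e = "\<lambda>k. aval k n m (extension n m f k \<cdot> t)"
  let ?h = "\<lambda>n. top_val b c n (fHom (alg n) b c \<cdot> h)"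
  have e: "?e k z \<in> hom V U (apow k m)" if "z \<in> hom V U (apow k n)" for k z
    using extension_hom[OF f, of k] t that by (simp add: hom_def)
  have hh: "?h l z \<in> hom V U (apow c l)" if "z \<in> hom V U (apow b l)" for l z
    using h that by (simp add: hom_def)
  show "?h m (?e b y) = ?e c (?h n y)"
  proof (rule Pow_Pow_eqI[OF hh[OF e[OF y]] e[OF hh[OF y]]])
    fix i j assume i: "i < c" and j: "j < m"
    define x where "x a i' = Proj V X b i' \<cdot> Proj V (Pow V X b) n a \<cdot> y" for a i'
    have x: "x a i' \<in> hom V U X" if "a < n" "i' < b" for a i'
      using that y by (simp add: x_def hom_def)
    have ya: "Proj V (Pow V X b) n a \<cdot> y \<in> hom V U (Pow V X b)" if "a < n" for a
      using y that by (simp add: hom_def)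
    have x_row: "tuple V U X b (x a) = Proj V (Pow V X b) n a \<cdot> y" if "a < n" for a
      using tuple_Proj[OF X_Ob ya[OF that]] by (simp add: x_def[abs_def])
    have eyj: "Proj V (Pow V X b) m j \<cdot> ?e b y \<in> hom V U (Pow V X b)"
      using e[OF y] j by (simp add: hom_def)
    have t': "t \<in> hom V U (Dom V f)" using t f by (simp add: hom_def)
    have "Proj V X c i \<cdot> Proj V (Pow V X c) m j \<cdot> ?h m (?e b y) =
        Proj V X c i \<cdot> val b c (\<alpha> b c \<cdot> h) (Proj V (Pow V X b) m j \<cdot> ?e b y)"
      by (simp only: Proj_app_alg[OF j h e[OF y]])
    also have "Proj V (Pow V X b) m j \<cdot> ?e b y =
        tuple V U X b (\<lambda>i'. Proj V X b i' \<cdot> Proj V (Pow V X b) m j \<cdot> ?e b y)"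
      using tuple_Proj[OF X_Ob eyj] by simp
    also have "\<dots> = tuple V U X b (\<lambda>i'. Proj V X m j \<cdot> val n m (f \<cdot> t) (tuple V U X n (\<lambda>a. x a i')))"
      unfolding x_def by (intro tuple_cong extension_entry[OF f t y j])
    also have "Proj V X c i \<cdot> val b c (\<alpha> b c \<cdot> h) \<dots> =
        Proj V X m j \<cdot> val n m (f \<cdot> t)
          (tuple V U X n (\<lambda>a. Proj V X c i \<cdot> val b c (\<alpha> b c \<cdot> h) (tuple V U X b (x a))))"
      using comm t' h x j i unfolding commutes_def by blast
    also have "tuple V U X n (\<lambda>a. Proj V X c i \<cdot> val b c (\<alpha> b c \<cdot> h) (tuple V U X b (x a))) =
        tuple V U X n (\<lambda>a. Proj V X c i \<cdot> Proj V (Pow V X c) n a \<cdot> ?h n y)"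
    proof (rule tuple_cong)
      fix a assume a: "a < n"
      show "Proj V X c i \<cdot> val b c (\<alpha> b c \<cdot> h) (tuple V U X b (x a)) =
          Proj V X c i \<cdot> Proj V (Pow V X c) n a \<cdot> ?h n y"
        by (simp only: x_row[OF a] Proj_app_alg[OF a h y])
    qed
    also have "Proj V X m j \<cdot> val n m (f \<cdot> t) \<dots> = Proj V X c i \<cdot> Proj V (Pow V X c) m j \<cdot> ?e c (?h n y)"
      by (simp only: extension_entry[OF f t hh[OF y] j i])
    finally show "Proj V X c i \<cdot> Proj V (Pow V X c) m j \<cdot> ?h m (?e b y) =
        Proj V X c i \<cdot> Proj V (Pow V X c) m j \<cdot> ?e c (?h n y)" .
  qed
qed

lemma alg_vnat_comp:
  assumes p: "alg_vnat n m W p" and s: "s \<in> hom V W' W"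
  shows "alg_vnat n m W' (\<lambda>k. p k \<cdot> s)"
  unfolding alg_vnat_iff
proof (intro conjI allI impI)
  show "W' \<in> Ob V" using s by (auto simp: hom_def)
  show "p k \<cdot> s \<in> hom V W' (Exp V (apow k n) (apow k m))" for k
    using alg_vnat_hom(1)[OF p, of k] s by (simp add: hom_def)
  fix b c U h t y
  assume h: "h \<in> hom V U (vHom T b c)" and t: "t \<in> hom V U W'"
    and y: "y \<in> hom V U (apow b n)"
  have st: "s \<cdot> t \<in> hom V U W" and "(p k \<cdot> s) \<cdot> t = p k \<cdot> (s \<cdot> t)" for k
    using s t alg_vnat_hom(1)[OF p, of k] by (simp_all add: hom_def)
  with alg_vnat_natural[OF p h st y]
  show "top_val b c m (fHom (alg m) b c \<cdot> h)
        (aval b n m ((p b \<cdot> s) \<cdot> t) y) =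
      aval c n m ((p c \<cdot> s) \<cdot> t)
        (top_val b c n (fHom (alg n) b c \<cdot> h) y)"
    by simp
qed

lemma alg_vnat_vcomp:
  assumes p: "alg_vnat n m W p"
    and q: "alg_vnat m l W q"
  shows "alg_vnat n l W
    (\<lambda>k. vcomp V (self V) (apow k n) (apow k m) (apow k l) (q k) (p k))"
    (is "is_vnat _ _ _ _ _ _ ?r")
  unfolding alg_vnat_iff
proof (intro conjI allI impI)
  show "W \<in> Ob V" by (rule alg_vnat_hom(2)[OF p])
  show "?r k \<in> hom V W (Exp V (apow k n) (apow k l))" for k
    using alg_vnat_hom(1)[OF p, of k] alg_vnat_hom(1)[OF q, of k] by (simp add: hom_def)
  fix b c U h t y
  assume h: "h \<in> hom V U (vHom T b c)" and t: "t \<in> hom V U W"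
    and y: "y \<in> hom V U (apow b n)"
  have r: "aval k n l (?r k \<cdot> t) z =
      aval k m l (q k \<cdot> t)
        (aval k n m (p k \<cdot> t) z)"
    if "z \<in> hom V U (apow k n)" for k z
    using alg_vnat_hom(1)[OF p, of k] alg_vnat_hom(1)[OF q, of k] t that by (simp add: hom_def)
  have py: "aval b n m (p b \<cdot> t) y \<in> hom V U (apow b m)"
    using alg_vnat_hom(1)[OF p, of b] t y by (simp add: hom_def)
  have hy: "top_val b c n (fHom (alg n) b c \<cdot> h) y
      \<in> hom V U (apow c n)"
    using h y by (simp add: hom_def)
  show "top_val b c l (fHom (alg l) b c \<cdot> h)
        (aval b n l (?r b \<cdot> t) y) =
      aval c n l (?r c \<cdot> t)
        (top_val b c n (fHom (alg n) b c \<cdot> h) y)"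
    by (simp only: r[OF y] r[OF hy] alg_vnat_natural[OF q h t py] alg_vnat_natural[OF p h t y])
qed

lemma alg_vnat_name:
  assumes g: "\<And>k. g k \<in> hom V (apow k n) (apow k m)"
    and nat: "\<And>b c U h y. h \<in> hom V U (vHom T b c) \<Longrightarrow> y \<in> hom V U (apow b n) \<Longrightarrow>
      top_val b c m (fHom (alg m) b c \<cdot> h) (g b \<cdot> y) =
      g c \<cdot> top_val b c n (fHom (alg n) b c \<cdot> h) y"
  shows "alg_vnat n m (One V)
    (\<lambda>k. name V (apow k n) (apow k m) (g k))"
  unfolding alg_vnat_iff
proof (intro conjI allI impI)
  have [simp]: "g k \<in> Arr V" "Dom V (g k) = apow k n" "Cod V (g k) = apow k m" for k
    using g by (auto simp: hom_def)
  show "One V \<in> Ob V" by simp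
  show "name V (apow k n) (apow k m) (g k) \<in>
    hom V (One V) (Exp V (apow k n) (apow k m))" for k
    by (simp add: hom_def)
  fix b c U h t y
  assume h: "h \<in> hom V U (vHom T b c)" and t: "t \<in> hom V U (One V)"
    and y: "y \<in> hom V U (apow b n)"
  have hy: "top_val b c n (fHom (alg n) b c \<cdot> h) y
      \<in> hom V U (apow c n)"
    using h y by (simp add: hom_def)
  have nm: "aval k n m
      (name V (apow k n) (apow k m) (g k) \<cdot> t) z = g k \<cdot> z"
    if "z \<in> hom V U (apow k n)" for k z
    using t that by (simp add: hom_def)
  show "top_val b c m (fHom (alg m) b c \<cdot> h)
      (aval b n m
        (name V (apow b n) (apow b m) (g b) \<cdot> t) y) =
      aval c n m
        (name V (apow c n) (apow c m) (g c) \<cdot> t)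
        (top_val b c n (fHom (alg n) b c \<cdot> h) y)"
    by (simp only: nm[OF y] nm[OF hy] nat[OF h y])
qed

end

section \<open>Commutants\<close>

text \<open>
  The arrows into \<open>[X\<^sup>n, X\<^sup>m]\<close> that commute with all operations form a subobject \<open>\<beta> n m\<close>. Then the
  ends in the definition of the commutant exist, and the commutant consists of these subobjects.
\<close>

locale commutant_representation = subtheory V X T \<alpha>
  for V :: "('o, 'a) ccc" (structure) and X T \<alpha> +
  fixes \<beta> :: "nat \<Rightarrow> nat \<Rightarrow> 'a"
  assumes rep_mono: "is_mono V (\<beta> n m)"
    and rep_Cod: "Cod V (\<beta> n m) = Exp V (Pow V X n) (Pow V X m)"
    and rep_iff: "f \<in> hom V W (Exp V (Pow V X n) (Pow V X m)) \<Longrightarrow>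
      factors_through V f (\<beta> n m) \<longleftrightarrow> commutes n m f"
begin

text \<open>
  The extension of \<open>\<beta> n m\<close> is the universal natural transformation: any other one is the extension
  of its component at \<open>1\<close>, which commutes with all operations and so factors through \<open>\<beta> n m\<close>.
\<close>

lemma nat_object:
  "is_nat_object V T (self V) (alg n) (alg m) (Dom V (\<beta> n m)) (extension n m (\<beta> n m))"
proof -
  have b: "\<beta> n m \<in> hom V (Dom V (\<beta> n m)) (Exp V (Pow V X n) (Pow V X m))"
    using rep_mono rep_Cod by (simp add: hom_def is_mono_def)
  then have "factors_through V (\<beta> n m) (\<beta> n m)"
    unfolding factors_through_def by (intro bexI[of _ "Ide V (Dom V (\<beta> n m))"]) (auto simp: hom_def)
  then have nat: "alg_vnat n m (Dom V (\<beta> n m)) (extension n m (\<beta> n m))"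
    by (intro extension_vnat[OF b]) (simp add: rep_iff[OF b])
  have "\<exists>!h. h \<in> hom V W (Dom V (\<beta> n m)) \<and> (\<forall>k. extension n m (\<beta> n m) k \<cdot> h = q k)"
    if q: "alg_vnat n m W q" for W q
  proof (rule ex_ex1I)
    have q1: "q 1 \<in> hom V W (Exp V (Pow V X n) (Pow V X m))" by (rule alg_vnat_hom(3)[OF q])
    have "factors_through V (q 1) (\<beta> n m)"
      unfolding rep_iff[OF q1] by (rule alg_vnat_commutes[OF q])
    then obtain h where h: "h \<in> hom V W (Dom V (\<beta> n m))" "\<beta> n m \<cdot> h = q 1"
      using q1 by (auto simp: factors_through_def hom_Dom)
    have "extension n m (\<beta> n m) k \<cdot> h = q k" for k
      by (rule alg_vnat_eqI[OF alg_vnat_comp[OF nat h(1)] q]) (simp only: extension_1[OF b] h(2))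
    with h show "\<exists>h. h \<in> hom V W (Dom V (\<beta> n m)) \<and> (\<forall>k. extension n m (\<beta> n m) k \<cdot> h = q k)" by blast
  next
    fix g h
    assume g: "g \<in> hom V W (Dom V (\<beta> n m)) \<and> (\<forall>k. extension n m (\<beta> n m) k \<cdot> g = q k)"
      and h: "h \<in> hom V W (Dom V (\<beta> n m)) \<and> (\<forall>k. extension n m (\<beta> n m) k \<cdot> h = q k)"
    then have "\<beta> n m \<cdot> g = \<beta> n m \<cdot> h" using extension_1[OF b] by metis
    with g h show "g = h" using mono_cancel[OF rep_mono[of n m], of g h] by (simp add: hom_def)
  qed
  with nat show ?thesis by (simp add: is_nat_object_def objects)
qed

abbreviation comp_alg :: "nat \<Rightarrow> nat \<Rightarrow> nat \<Rightarrow> 'a" where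
  "comp_alg n m \<equiv> alg_component V T (alg n) (alg m)"

abbreviation hom_alg :: "nat \<Rightarrow> nat \<Rightarrow> 'o" where
  "hom_alg n m \<equiv> alg_hom V T (alg n) (alg m)"

text \<open>
  The end that was chosen need not be \<open>\<beta> n m\<close>, but it has the same universal property.
\<close>

lemma alg_end_nat_object:
  "is_nat_object V T (self V) (alg n) (alg m) (hom_alg n m) (comp_alg n m)"
proof -
  have "case alg_end V T (alg n) (alg m) of (E, p) \<Rightarrow> is_nat_object V T (self V) (alg n) (alg m) E p"
    unfolding alg_end_def by (rule someI[of _ "(Dom V (\<beta> n m), extension n m (\<beta> n m))"])
      (simp add: nat_object)
  then show ?thesis by (simp add: alg_hom_def alg_component_def split: prod.splits)
qed

lemma comp_vnat: "alg_vnat n m (hom_alg n m) (comp_alg n m)"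
  and comp_universal: "alg_vnat n m W q \<Longrightarrow>
    \<exists>!h. h \<in> hom V W (hom_alg n m) \<and> (\<forall>k. comp_alg n m k \<cdot> h = q k)"
  using alg_end_nat_object[of n m] by (auto simp: is_nat_object_def objects)

lemma alg_hom_elem:
  assumes "alg_vnat n m W q"
  shows "alg_hom_elem V T (alg n) (alg m) W q \<in> hom V W (hom_alg n m)"
    and "comp_alg n m k \<cdot> alg_hom_elem V T (alg n) (alg m) W q = q k"
  using theI'[OF comp_universal[OF assms]] by (simp_all add: alg_hom_elem_def)

abbreviation incl :: "nat \<Rightarrow> nat \<Rightarrow> 'a" where
  "incl n m \<equiv> comp_alg n m 1"

lemma incl_alg_hom: "incl n m \<in> hom V (hom_alg n m) (Exp V (Pow V X n) (Pow V X m))"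
  by (rule alg_vnat_hom(3)[OF comp_vnat])

lemma incl_alg_mono: "is_mono V (incl n m)"
  unfolding is_mono_def
proof (intro conjI allI ballI impI)
  show "incl n m \<in> Arr V" using incl_alg_hom by (rule hom_Arr)
  fix W f g
  assume "f \<in> hom V W (Dom V (incl n m))" "g \<in> hom V W (Dom V (incl n m))"
  then have f: "f \<in> hom V W (hom_alg n m)" and g: "g \<in> hom V W (hom_alg n m)"
    using incl_alg_hom[of n m] by (simp_all add: hom_def)
  assume eq: "incl n m \<cdot> f = incl n m \<cdot> g"
  have "comp_alg n m k \<cdot> f = comp_alg n m k \<cdot> g" for k
    by (rule alg_vnat_eqI[OF alg_vnat_comp[OF comp_vnat f] alg_vnat_comp[OF comp_vnat g] eq])
  with comp_universal[OF alg_vnat_comp[OF comp_vnat g]] f g show "f = g" by blast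
qed

text \<open>
  By its universal property, the chosen end represents the natural transformations, and these
  correspond to the arrows that commute with all operations.
\<close>

lemma factors_incl_iff:
  assumes f: "f \<in> hom V W (Exp V (Pow V X n) (Pow V X m))"
  shows "factors_through V f (incl n m) \<longleftrightarrow> commutes n m f"
proof
  assume "factors_through V f (incl n m)"
  then obtain h where h: "h \<in> hom V W (hom_alg n m)" "incl n m \<cdot> h = f"
    using f incl_alg_hom[of n m] by (auto simp: factors_through_def hom_Dom)
  from alg_vnat_commutes[OF alg_vnat_comp[OF comp_vnat h(1)]] show "commutes n m f"
    by (simp only: h(2))
next
  assume c: "commutes n m f"
  note e = alg_hom_elem[OF extension_vnat[OF f c]]
  have "incl n m \<cdot> alg_hom_elem V T (alg n) (alg m) W (extension n m f) = f"
    by (simp only: e(2) extension_1[OF f])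
  with e(1) f incl_alg_hom[of n m] show "factors_through V f (incl n m)"
    by (auto simp: factors_through_def hom_Dom)
qed

lemma commutant_eq:
  "commutant V X (T, \<alpha>) =
     (\<lparr>vOb = UNIV, vHom = hom_alg,
       vComp = (\<lambda>n m l. alg_hom_elem V T (alg n) (alg l) (Prd V (hom_alg m l) (hom_alg n m))
          (\<lambda>k. vcomp V (self V) (apow k n) (apow k m) (apow k l)
             (comp_alg m l k \<cdot> Fst V (hom_alg m l) (hom_alg n m))
             (comp_alg n m k \<cdot> Snd V (hom_alg m l) (hom_alg n m)))),
       vId = (\<lambda>n. alg_hom_elem V T (alg n) (alg n) (One V)
          (\<lambda>k. name V (apow k n) (apow k n) (Ide V (apow k n)))),
       tProj = (\<lambda>n i. alg_hom_elem V T (alg n) (alg 1) (One V)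
          (\<lambda>k. name V (apow k n) (Pow V X k) (Proj V (Pow V X k) n i)))\<rparr>,
      incl)"
proof -
  have [simp]: "fOb (over_algebra V X \<alpha>) k = Pow V X k" for k by (simp add: over_algebra_def)
  show ?thesis
    by (simp add: commutant_def alg_cat_def Let_def alg_proj_def[abs_def])
qed

text \<open>
  All structure of the commutant is given by components, and the components at \<open>1\<close> of composites,
  identities and projections are those of the full theory. Closure holds by \<open>commutes_rows\<close>.
\<close>

lemma commutant_subtheory:
  "subtheory V X (fst (commutant V X (T, \<alpha>))) (snd (commutant V X (T, \<alpha>)))"
proof -
  let ?H = hom_alg
  have I [simp]: "incl n m \<in> Arr V" "Dom V (incl n m) = ?H n m"
    "Cod V (incl n m) = Exp V (Pow V X n) (Pow V X m)" for n m
    using incl_alg_hom by (auto simp: hom_def)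
  have H [simp]: "?H n m \<in> Ob V" for n m using Dom_Ob'[of "incl n m"] by simp
  let ?K = "\<lambda>n m l. alg_hom_elem V T (alg n) (alg l) (Prd V (?H m l) (?H n m))
          (\<lambda>k. vcomp V (self V) (apow k n) (apow k m) (apow k l)
             (comp_alg m l k \<cdot> Fst V (?H m l) (?H n m)) (comp_alg n m k \<cdot> Snd V (?H m l) (?H n m)))"
  have comp: "?K n m l \<in> hom V (Prd V (?H m l) (?H n m)) (?H n l)"
    "incl n l \<cdot> ?K n m l = vcomp V (self V) (Pow V X n) (Pow V X m) (Pow V X l)
             (incl m l \<cdot> Fst V (?H m l) (?H n m)) (incl n m \<cdot> Snd V (?H m l) (?H n m))" for n m l
  proof -
    have F: "Fst V (?H m l) (?H n m) \<in> hom V (Prd V (?H m l) (?H n m)) (?H m l)"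
      and S: "Snd V (?H m l) (?H n m) \<in> hom V (Prd V (?H m l) (?H n m)) (?H n m)"
      by (simp_all add: hom_def)
    note v = alg_vnat_vcomp[OF alg_vnat_comp[OF comp_vnat S] alg_vnat_comp[OF comp_vnat F]]
    show "?K n m l \<in> hom V (Prd V (?H m l) (?H n m)) (?H n l)"
      by (rule alg_hom_elem(1)[OF v])
    show "incl n l \<cdot> ?K n m l = vcomp V (self V) (Pow V X n) (Pow V X m) (Pow V X l)
             (incl m l \<cdot> Fst V (?H m l) (?H n m)) (incl n m \<cdot> Snd V (?H m l) (?H n m))"
      by (simp only: alg_hom_elem(2)[OF v] Pow_1 X_Ob)
  qed
  have id: "alg_vnat n n (One V)
    (\<lambda>k. name V (apow k n) (apow k n) (Ide V (apow k n)))" for n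
    by (rule alg_vnat_name) (simp_all add: hom_def)
  have proj: "alg_vnat n 1 (One V)
    (\<lambda>k. name V (apow k n) (apow k 1) (Proj V (Pow V X k) n i))"
    if i: "i < n" for n i
  proof (rule alg_vnat_name)
    fix b c U h y
    assume h: "h \<in> hom V U (vHom T b c)" and y: "y \<in> hom V U (apow b n)"
    have yi: "Proj V (Pow V X b) n i \<cdot> y \<in> hom V U (apow b 1)"
      using y i by (simp add: hom_def)
    have "top_val b c 1 (fHom (alg 1) b c \<cdot> h)
        (Proj V (Pow V X b) n i \<cdot> y) = val b c (\<alpha> b c \<cdot> h) (Proj V (Pow V X b) n i \<cdot> y)"
      using Proj_app_alg[OF zero_less_one h yi] yi h by (simp add: hom_def)
    then show "top_val b c 1 (fHom (alg 1) b c \<cdot> h)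
          (Proj V (Pow V X b) n i \<cdot> y) =
        Proj V (Pow V X c) n i \<cdot> top_val b c n (fHom (alg n) b c \<cdot> h) y"
      by (simp only: Proj_app_alg[OF i h y])
  qed (use i in \<open>simp add: hom_def\<close>)
  have "subtheory V X \<lparr>vOb = UNIV, vHom = ?H, vComp = ?K,
       vId = (\<lambda>n. alg_hom_elem V T (alg n) (alg n) (One V)
          (\<lambda>k. name V (apow k n) (apow k n) (Ide V (apow k n)))),
       tProj = (\<lambda>n i. alg_hom_elem V T (alg n) (alg 1) (One V)
          (\<lambda>k. name V (apow k n) (Pow V X k) (Proj V (Pow V X k) n i)))\<rparr> incl"
    (is "subtheory V X ?U incl")
  proof unfold_locales
    fix f g n m l W
    assume f: "f \<in> hom V W (vHom ?U n m)" and g: "g \<in> hom V W (vHom ?U m l)"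
    have K: "?K n m l \<in> Arr V" "Dom V (?K n m l) = Prd V (?H m l) (?H n m)"
      "Cod V (?K n m l) = ?H n l" using comp(1)[where n = n and m = m and l = l] by (simp_all add: hom_def)
    have fg: "pair V g f \<in> hom V W (Prd V (?H m l) (?H n m))"
      "Fst V (?H m l) (?H n m) \<cdot> pair V g f = g" "Snd V (?H m l) (?H n m) \<cdot> pair V g f = f"
      using f g by (simp_all add: hom_def)
    have "incl n l \<cdot> ?K n m l \<cdot> pair V g f = (incl n l \<cdot> ?K n m l) \<cdot> pair V g f"
      using K fg(1) by (simp add: hom_def)
    also have "\<dots> = vcomp V (self V) (Pow V X n) (Pow V X m) (Pow V X l) (incl m l \<cdot> g) (incl n m \<cdot> f)"
      unfolding comp(2) using fg by (simp add: hom_def)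
    finally show "incl n l \<cdot> vcomp V ?U n m l g f =
        vcomp V (self V) (Pow V X n) (Pow V X m) (Pow V X l) (incl m l \<cdot> g) (incl n m \<cdot> f)"
      by (simp add: vcomp_def)
  next
    fix f n m W
    assume f: "f \<in> hom V W (Exp V (Pow V X n) (Pow V X m))"
      and rows: "\<And>j. j < m \<Longrightarrow> factors_through V (row X n m j f) (incl n 1)"
    have "commutes n 1 (row X n m j f)" if "j < m" for j
      using rows[OF that] factors_incl_iff[of "row X n m j f" W n 1] row_hom[OF X_Ob f that] by simp
    then show "factors_through V f (incl n m)"
      unfolding factors_incl_iff[OF f] by (rule commutes_rows[OF f])
  next
    fix n i :: nat assume i: "i < n"
    show "tProj ?U n i \<in> hom V (One V) (vHom ?U n 1)"
      using alg_hom_elem(1)[OF proj[OF i]] by simp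
    show "incl n 1 \<cdot> tProj ?U n i = name V (Pow V X n) X (Proj V X n i)"
      using alg_hom_elem(2)[OF proj[OF i], of 1] by simp
  next
    fix n
    show "vId ?U n \<in> hom V (One V) (vHom ?U n n)"
      using alg_hom_elem(1)[OF id[of n]] by simp
    show "incl n n \<cdot> vId ?U n = name V (Pow V X n) (Pow V X n) (Ide V (Pow V X n))"
      using alg_hom_elem(2)[OF id[of n], of 1] by simp
  qed (use incl_alg_mono incl_alg_hom comp(1) in simp_all)
  then show ?thesis by (simp only: commutant_eq fst_conv snd_conv)
qed

lemma isomorphic_commutant:
  assumes U: "subtheory V X U \<beta>"
  shows "isomorphic_over V X (U, \<beta>) (commutant V X (T, \<alpha>))"
proof -
  interpret U: subtheory V X U \<beta> by (rule U)
  have "snd (commutant V X (T, \<alpha>)) = incl" by (simp only: commutant_eq snd_conv)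
  moreover have "factors_through V (\<beta> n m) (incl n m)" "factors_through V (incl n m) (\<beta> n m)" for n m
  proof -
    have "factors_through V f f" if "f \<in> Arr V" for f
      unfolding factors_through_def using that by (intro bexI[of _ "Ide V (Dom V f)"]) (auto simp: hom_def)
    then have "factors_through V (\<beta> n m) (\<beta> n m)" "factors_through V (incl n m) (incl n m)"
      using U.incl_hom incl_alg_hom by (blast intro: hom_Arr)+
    then show "factors_through V (\<beta> n m) (incl n m)" "factors_through V (incl n m) (\<beta> n m)"
      using factors_incl_iff[OF U.incl_hom[of n m]] rep_iff[OF U.incl_hom[of n m]]
        factors_incl_iff[OF incl_alg_hom[of n m]] rep_iff[OF incl_alg_hom[of n m]] by simp_all
  qed
  ultimately have "isomorphic_over V X (U, \<beta>)
      (fst (commutant V X (T, \<alpha>)), snd (commutant V X (T, \<alpha>)))"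
    by (intro isomorphic_overI[OF U commutant_subtheory]) simp_all
  then show ?thesis by simp
qed

end

section \<open>Generalized elements of a rig\<close>

lemma radd_upto_cong:
  "(\<And>i. i < n \<Longrightarrow> f i = g i) \<Longrightarrow> radd_upto V R W n f = radd_upto V R W n g"
  by (induction n) auto

context rig_in
begin

lemma Car_in_Ob [simp]: "Car R \<in> Ob V"
  by (rule Car_Ob)

lemma rig_arrows [simp]:
  "Add R \<in> Arr V" "Dom V (Add R) = Prd V (Car R) (Car R)" "Cod V (Add R) = Car R"
  "Mul R \<in> Arr V" "Dom V (Mul R) = Prd V (Car R) (Car R)" "Cod V (Mul R) = Car R"
  "Zero R \<in> Arr V" "Dom V (Zero R) = One V" "Cod V (Zero R) = Car R"
  "Unit R \<in> Arr V" "Dom V (Unit R) = One V" "Cod V (Unit R) = Car R"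
  using Add_hom Mul_hom Zero_hom Unit_hom by (auto simp: hom_def)

abbreviation el :: "'o \<Rightarrow> 'a set" where
  "el W \<equiv> hom V W (Car R)"

abbreviation tup :: "'o \<Rightarrow> nat \<Rightarrow> (nat \<Rightarrow> 'a) \<Rightarrow> 'a" where
  "tup W \<equiv> tuple V W (Car R)"

abbreviation rplus :: "'a \<Rightarrow> 'a \<Rightarrow> 'a" (infixl "\<oplus>" 65) where
  "a \<oplus> b \<equiv> radd V R a b"

abbreviation rtimes :: "'a \<Rightarrow> 'a \<Rightarrow> 'a" (infixl "\<odot>" 70) where
  "a \<odot> b \<equiv> rmul V R a b"

abbreviation rsum :: "'o \<Rightarrow> nat \<Rightarrow> (nat \<Rightarrow> 'a) \<Rightarrow> 'a" where
  "rsum \<equiv> radd_upto V R"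

lemma radd_hom: "a \<in> el W \<Longrightarrow> b \<in> el W \<Longrightarrow> (a \<oplus> b) \<in> el W"
  and rmul_hom: "a \<in> el W \<Longrightarrow> b \<in> el W \<Longrightarrow> (a \<odot> b) \<in> el W"
  and rzero_hom: "W \<in> Ob V \<Longrightarrow> rzero V R W \<in> el W"
  and rone_hom: "W \<in> Ob V \<Longrightarrow> rone V R W \<in> el W"
  by (auto simp: radd_def rmul_def rzero_def rone_def hom_def)

lemma radd_comp:
    "a \<in> el W \<Longrightarrow> b \<in> el W \<Longrightarrow> t \<in> hom V U W \<Longrightarrow>
      (a \<oplus> b) \<cdot> t = (a \<cdot> t) \<oplus> (b \<cdot> t)"
  and rmul_comp:
    "a \<in> el W \<Longrightarrow> b \<in> el W \<Longrightarrow> t \<in> hom V U W \<Longrightarrow>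
      (a \<odot> b) \<cdot> t = (a \<cdot> t) \<odot> (b \<cdot> t)"
  and rzero_comp: "t \<in> hom V U W \<Longrightarrow> rzero V R W \<cdot> t = rzero V R U"
  and rone_comp: "t \<in> hom V U W \<Longrightarrow> rone V R W \<cdot> t = rone V R U"
  by (auto simp: radd_def rmul_def rzero_def rone_def hom_def)

lemma radd_upto_hom:
  "W \<in> Ob V \<Longrightarrow> (\<And>i. i < n \<Longrightarrow> f i \<in> el W) \<Longrightarrow>
    rsum W n f \<in> el W"
  by (induction n) (simp_all add: radd_hom rzero_hom)

lemma radd_upto_comp:
  assumes "t \<in> hom V U W" "\<And>i. i < n \<Longrightarrow> f i \<in> el W"
  shows "rsum W n f \<cdot> t = rsum U n (\<lambda>i. f i \<cdot> t)"
proof -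
  have W: "W \<in> Ob V" using assms(1) by (auto simp: hom_def)
  from assms(2) show ?thesis
  proof (induction n)
    case 0
    show ?case using rzero_comp[OF assms(1)] by simp
  next
    case (Suc n)
    have "rsum W n f \<in> el W" using W Suc.prems by (intro radd_upto_hom) simp_all
    from radd_comp[OF this Suc.prems assms(1)] show ?case using Suc by simp
  qed
qed

end

locale rig_stage = rig_in V R
  for V :: "('o, 'a) ccc" (structure) and R :: "('o, 'a) rig" +
  fixes W :: 'o
  assumes W_Ob: "W \<in> Ob V"
begin

abbreviation zero_W :: 'a ("\<zero>") where
  "\<zero> \<equiv> rzero V R W"

abbreviation one_W :: 'a ("\<one>") where
  "\<one> \<equiv> rone V R W"

abbreviation sum_W :: "nat \<Rightarrow> (nat \<Rightarrow> 'a) \<Rightarrow> 'a" where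
  "sum_W n f \<equiv> rsum W n f"

lemma closed [simp]:
  "a \<in> el W \<Longrightarrow> b \<in> el W \<Longrightarrow> a \<oplus> b \<in> el W" "a \<in> el W \<Longrightarrow> b \<in> el W \<Longrightarrow> a \<odot> b \<in> el W"
  "\<zero> \<in> el W" "\<one> \<in> el W"
  by (simp_all add: radd_hom rmul_hom rzero_hom rone_hom W_Ob)

lemma sum_closed [simp]: "\<forall>i<n. f i \<in> el W \<Longrightarrow> sum_W n f \<in> el W"
  by (simp add: radd_upto_hom W_Ob)

lemma assoc: "a \<in> el W \<Longrightarrow> b \<in> el W \<Longrightarrow> c \<in> el W \<Longrightarrow> a \<oplus> b \<oplus> c = a \<oplus> (b \<oplus> c)"
  and commute: "a \<in> el W \<Longrightarrow> b \<in> el W \<Longrightarrow> a \<oplus> b = b \<oplus> a"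
  by (rule add_assoc add_commute; assumption)+

lemma left_commute: "a \<in> el W \<Longrightarrow> b \<in> el W \<Longrightarrow> c \<in> el W \<Longrightarrow> a \<oplus> (b \<oplus> c) = b \<oplus> (a \<oplus> c)"
  by (metis add_assoc add_commute)

lemmas ac = assoc commute left_commute

lemma units [simp]: "a \<in> el W \<Longrightarrow> a \<oplus> \<zero> = a" "a \<in> el W \<Longrightarrow> \<zero> \<oplus> a = a"
  "a \<in> el W \<Longrightarrow> a \<odot> \<one> = a" "a \<in> el W \<Longrightarrow> \<one> \<odot> a = a"
  "a \<in> el W \<Longrightarrow> a \<odot> \<zero> = \<zero>" "a \<in> el W \<Longrightarrow> \<zero> \<odot> a = \<zero>"
  using add_zero add_commute[of \<zero> W a] mul_one one_mul mul_zero zero_mul by simp_all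

lemma distribs:
  "a \<in> el W \<Longrightarrow> b \<in> el W \<Longrightarrow> c \<in> el W \<Longrightarrow> a \<odot> (b \<oplus> c) = a \<odot> b \<oplus> a \<odot> c"
  "a \<in> el W \<Longrightarrow> b \<in> el W \<Longrightarrow> c \<in> el W \<Longrightarrow> (a \<oplus> b) \<odot> c = a \<odot> c \<oplus> b \<odot> c"
  "a \<in> el W \<Longrightarrow> b \<in> el W \<Longrightarrow> c \<in> el W \<Longrightarrow> (a \<odot> b) \<odot> c = a \<odot> (b \<odot> c)"
  using mul_add add_mul mul_assoc by blast+

lemma sum_zero [simp]: "sum_W n (\<lambda>i. \<zero>) = \<zero>"
  by (induction n) simp_all

lemma sum_add: "\<forall>i<n. f i \<in> el W \<Longrightarrow> \<forall>i<n. g i \<in> el W \<Longrightarrow>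
    sum_W n (\<lambda>i. f i \<oplus> g i) = sum_W n f \<oplus> sum_W n g"
  by (induction n) (simp_all add: ac)

lemma mul_sum: "a \<in> el W \<Longrightarrow> \<forall>i<n. f i \<in> el W \<Longrightarrow> a \<odot> sum_W n f = sum_W n (\<lambda>i. a \<odot> f i)"
  by (induction n) (simp_all add: distribs)

lemma sum_mul: "a \<in> el W \<Longrightarrow> \<forall>i<n. f i \<in> el W \<Longrightarrow> sum_W n f \<odot> a = sum_W n (\<lambda>i. f i \<odot> a)"
  by (induction n) (simp_all add: distribs)

lemma sum_swap: "\<forall>i<n. \<forall>j<m. f i j \<in> el W \<Longrightarrow>
    sum_W n (\<lambda>i. sum_W m (\<lambda>j. f i j)) = sum_W m (\<lambda>j. sum_W n (\<lambda>i. f i j))"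
  by (induction n) (simp_all add: sum_add)

lemma sum_single:
  assumes "j < n" "f j \<in> el W" "\<And>i. i < n \<Longrightarrow> i \<noteq> j \<Longrightarrow> f i = \<zero>"
  shows "sum_W n f = f j"
  using assms
proof (induction n)
  case (Suc n)
  show ?case
  proof (cases "j = n")
    case True
    have "sum_W n f = sum_W n (\<lambda>i. \<zero>)"
      using Suc.prems True by (intro radd_upto_cong) simp
    then show ?thesis using True Suc.prems by simp
  next
    case False
    then have "sum_W n f = f j" "f n = \<zero>" using Suc by simp_all
    then show ?thesis using Suc.prems by simp
  qed
qed simp

text \<open>
  Associativity of the product of the row \<open>b\<close>, the matrix \<open>a\<close> and the column \<open>x\<close>.
\<close>

lemma sum_mul_assoc:
  assumes "\<forall>j<m. b j \<in> el W" "\<forall>j<m. \<forall>i<n. a j i \<in> el W" "\<forall>i<n. x i \<in> el W"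
  shows "sum_W n (\<lambda>i. sum_W m (\<lambda>j. b j \<odot> a j i) \<odot> x i) = sum_W m (\<lambda>j. b j \<odot> sum_W n (\<lambda>i. a j i \<odot> x i))"
proof -
  have "sum_W n (\<lambda>i. sum_W m (\<lambda>j. b j \<odot> a j i) \<odot> x i) = sum_W n (\<lambda>i. sum_W m (\<lambda>j. b j \<odot> (a j i \<odot> x i)))"
    using assms by (intro radd_upto_cong) (simp add: sum_mul distribs cong: radd_upto_cong)
  also have "\<dots> = sum_W m (\<lambda>j. sum_W n (\<lambda>i. b j \<odot> (a j i \<odot> x i)))"
    using assms by (intro sum_swap) simp
  also have "\<dots> = sum_W m (\<lambda>j. b j \<odot> sum_W n (\<lambda>i. a j i \<odot> x i))"
    using assms by (intro radd_upto_cong) (simp add: mul_sum)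
  finally show ?thesis .
qed

text \<open>
  The computation that makes affine combinations commute with the operations of pointed right
  modules. The coefficients \<open>h\<close> stand on the left and \<open>u\<close> on the right, so only associativity of the
  product is involved; \<open>u0\<close> is reproduced because the \<open>h i\<close> sum to \<open>1\<close>.
\<close>

lemma affine_pointed_interchange:
  assumes h: "\<forall>i<b. h i \<in> el W" "sum_W b h = \<one>" and u0: "u0 \<in> el W" and u: "\<forall>a<n. u a \<in> el W"
    and x: "\<forall>i<b. \<forall>a<n. x i a \<in> el W"
  shows "sum_W b (\<lambda>i. h i \<odot> (u0 \<oplus> sum_W n (\<lambda>a. x i a \<odot> u a))) =
    u0 \<oplus> sum_W n (\<lambda>a. sum_W b (\<lambda>i. h i \<odot> x i a) \<odot> u a)"
proof -
  have "sum_W b (\<lambda>i. h i \<odot> (u0 \<oplus> sum_W n (\<lambda>a. x i a \<odot> u a))) =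
      sum_W b (\<lambda>i. h i \<odot> u0 \<oplus> h i \<odot> sum_W n (\<lambda>a. x i a \<odot> u a))"
    using assms by (intro radd_upto_cong) (simp add: distribs)
  also have "\<dots> = sum_W b (\<lambda>i. h i \<odot> u0) \<oplus> sum_W b (\<lambda>i. h i \<odot> sum_W n (\<lambda>a. x i a \<odot> u a))"
    using assms by (intro sum_add) simp_all
  also have "sum_W b (\<lambda>i. h i \<odot> u0) = u0"
    using sum_mul[OF u0 h(1)] h(2) u0 by simp
  also have "sum_W b (\<lambda>i. h i \<odot> sum_W n (\<lambda>a. x i a \<odot> u a)) = sum_W n (\<lambda>a. sum_W b (\<lambda>i. h i \<odot> x i a) \<odot> u a)"
    using assms by (intro sum_mul_assoc[symmetric]) simp_all
  finally show ?thesis .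
qed

end

locale ring_stage = rig_stage V R W + ring_in V R
  for V :: "('o, 'a) ccc" (structure) and R :: "('o, 'a) rig" and W
begin

lemma subtraction: assumes "a \<in> el W" "b \<in> el W" shows "\<exists>d\<in>el W. d \<oplus> b = a"
proof -
  obtain neg where neg: "neg \<in> hom V (Car R) (Car R)"
    "\<And>a. a \<in> el W \<Longrightarrow> a \<oplus> (neg \<cdot> a) = \<zero>" using neg by blast
  have nb: "neg \<cdot> b \<in> el W" using neg(1) assms by (simp add: hom_def)
  have "(a \<oplus> (neg \<cdot> b)) \<oplus> b = a \<oplus> (b \<oplus> (neg \<cdot> b))" using assms nb by (simp add: ac)
  then have "(a \<oplus> (neg \<cdot> b)) \<oplus> b = a" using assms neg(2)[of b] by simp
  then show ?thesis using nb assms by (intro bexI[of _ "a \<oplus> (neg \<cdot> b)"]) simp_all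
qed

lemma left_cancel:
  assumes "a \<in> el W" "b \<in> el W" "c \<in> el W" "a \<oplus> b = a \<oplus> c" shows "b = c"
proof -
  obtain d where d: "d \<in> el W" "d \<oplus> a = \<zero>" using subtraction[of \<zero> a] assms by auto
  have "(d \<oplus> a) \<oplus> b = (d \<oplus> a) \<oplus> c"
    by (simp only: assoc[OF d(1) assms(1,2)] assoc[OF d(1) assms(1,3)] assms(4))
  then show ?thesis using assms(2,3) d(2) by simp
qed

end

section \<open>Matrices\<close>

context rig_in
begin

abbreviation vec :: "nat \<Rightarrow> 'o" where
  "vec n \<equiv> Pow V (Car R) n"

abbreviation mat :: "nat \<Rightarrow> nat \<Rightarrow> 'o" where
  "mat n m \<equiv> mat_obj V R n m"

abbreviation mval :: "nat \<Rightarrow> nat \<Rightarrow> 'a \<Rightarrow> 'a \<Rightarrow> 'a" where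
  "mval n m \<equiv> app V (vec n) (vec m)"

abbreviation pr :: "nat \<Rightarrow> nat \<Rightarrow> 'a" where
  "pr \<equiv> Proj V (Car R)"

abbreviation ent :: "nat \<Rightarrow> nat \<Rightarrow> 'a \<Rightarrow> nat \<Rightarrow> nat \<Rightarrow> 'a" where
  "ent \<equiv> entry V R"

abbreviation mat_act :: "nat \<Rightarrow> nat \<Rightarrow> 'a" where
  "mat_act \<equiv> Mat_act V R"

abbreviation star_act :: "nat \<Rightarrow> nat \<Rightarrow> 'a" where
  "star_act \<equiv> Mat_op_star_act V R"

abbreviation aff_act :: "nat \<Rightarrow> nat \<Rightarrow> 'a" where
  "aff_act \<equiv> Mat_aff_act V R"

lemma rig_stageI: "W \<in> Ob V \<Longrightarrow> rig_stage V R W"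
  by unfold_locales

lemma mat_Ob [simp]: "mat n m \<in> Ob V"
  by (simp add: mat_obj_def)

lemma entry_hom: "u \<in> hom V W (mat n m) \<Longrightarrow> j < m \<Longrightarrow> i < n \<Longrightarrow> ent n m u j i \<in> el W"
  and entry_comp: "u \<in> hom V W (mat n m) \<Longrightarrow> j < m \<Longrightarrow> i < n \<Longrightarrow> t \<in> hom V U W \<Longrightarrow>
    ent n m u j i \<cdot> t = ent n m (u \<cdot> t) j i"
  by (auto simp: entry_def mat_obj_def hom_def)

lemma mat_of_hom: "W \<in> Ob V \<Longrightarrow> (\<And>j i. j < m \<Longrightarrow> i < n \<Longrightarrow> a j i \<in> el W) \<Longrightarrow>
    mat_of V R W n m a \<in> hom V W (mat n m)"
  and entry_mat_of: "W \<in> Ob V \<Longrightarrow> (\<And>j i. j < m \<Longrightarrow> i < n \<Longrightarrow> a j i \<in> el W) \<Longrightarrow>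
    j < m \<Longrightarrow> i < n \<Longrightarrow> ent n m (mat_of V R W n m a) j i = a j i"
  by (auto simp: entry_def mat_obj_def mat_of_def hom_def)

lemma mat_eqI:
  assumes "u \<in> hom V W (mat n m)" "v \<in> hom V W (mat n m)"
    and "\<And>j i. j < m \<Longrightarrow> i < n \<Longrightarrow> ent n m u j i = ent n m v j i"
  shows "u = v"
proof (rule Pow_eqI[OF assms(1,2)[unfolded mat_obj_def]])
  fix j assume j: "j < m"
  have "Proj V (vec n) m j \<cdot> w \<in> hom V W (vec n)" if "w \<in> hom V W (mat n m)" for w
    using that j by (simp add: mat_obj_def hom_def)
  with assms j show "Proj V (vec n) m j \<cdot> u = Proj V (vec n) m j \<cdot> v"
    by (intro Pow_eqI[of "Proj V (vec n) m j \<cdot> u" W "Car R" n "Proj V (vec n) m j \<cdot> v"])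
      (simp_all add: entry_def)
qed simp

lemma Proj_hom: "x \<in> hom V W (vec n) \<Longrightarrow> i < n \<Longrightarrow> pr n i \<cdot> x \<in> el W"
  by (simp add: hom_def)

text \<open>
  The defining formulas of the two actions, as formulas for values at generalized elements.
\<close>

lemma Mat_act_hom: "mat_act n m \<in> hom V (mat n m) (Exp V (vec n) (vec m))"
  and Mat_act_value: "\<lbrakk>u \<in> hom V W (mat n m); x \<in> hom V W (vec n); j < m\<rbrakk> \<Longrightarrow>
    pr m j \<cdot> mval n m (mat_act n m \<cdot> u) x =
    rsum W n (\<lambda>i. ent n m u j i \<odot> (pr n i \<cdot> x))"
proof -
  let ?W = "Prd V (mat n m) (vec n)"
  let ?a = "ent n m (Fst V (mat n m) (vec n))"
  let ?x = "\<lambda>i. pr n i \<cdot> Snd V (mat n m) (vec n)"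
  let ?b = "\<lambda>j. rsum ?W n (\<lambda>i. ?a j i \<odot> ?x i)"
  have F: "Fst V (mat n m) (vec n) \<in> hom V ?W (mat n m)" and S: "Snd V (mat n m) (vec n) \<in> hom V ?W (vec n)"
    by (simp_all add: hom_def)
  have act: "mat_act n m = transpose V (mat n m) (vec n) (vec m) (tuple V ?W (Car R) m ?b)"
    by (simp add: Mat_act_def Let_def)
  have term_hom: "?a j i \<odot> ?x i \<in> el ?W" if "j < m" "i < n" for j i
    using entry_hom[OF F] Proj_hom[OF S] that by (intro rmul_hom) simp_all
  then have b: "?b j \<in> el ?W" if "j < m" for j
    using that by (intro radd_upto_hom) simp_all
  show "mat_act n m \<in> hom V (mat n m) (Exp V (vec n) (vec m))"
    unfolding act using b by (intro transpose_tuple_hom) simp_all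
  assume u: "u \<in> hom V W (mat n m)" and x: "x \<in> hom V W (vec n)" and j: "j < m"
  have p: "pair V u x \<in> hom V W ?W" and Fp: "Fst V (mat n m) (vec n) \<cdot> pair V u x = u"
    and Sp: "Snd V (mat n m) (vec n) \<cdot> pair V u x = x"
    using u x by (simp_all add: hom_def)
  have "pr m j \<cdot> mval n m (mat_act n m \<cdot> u) x = ?b j \<cdot> pair V u x"
    unfolding act using b u x j by (intro Proj_app_transpose_tuple[where U = W]) simp_all
  also have "\<dots> = rsum W n (\<lambda>i. (?a j i \<odot> ?x i) \<cdot> pair V u x)"
    using term_hom j by (intro radd_upto_comp[OF p]) simp
  also have "\<dots> = rsum W n (\<lambda>i. ent n m u j i \<odot> (pr n i \<cdot> x))"
  proof (rule radd_upto_cong)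
    fix i assume i: "i < n"
    have "?a j i \<cdot> pair V u x = ent n m u j i"
      using entry_comp[OF F j i p] by (simp only: Fp)
    moreover have "?x i \<cdot> pair V u x = pr n i \<cdot> x"
    proof -
      have "?x i \<cdot> pair V u x = pr n i \<cdot> Snd V (mat n m) (vec n) \<cdot> pair V u x"
        using p S i by (simp add: hom_def del: Snd_pair)
      then show ?thesis by (simp only: Sp)
    qed
    ultimately show "(?a j i \<odot> ?x i) \<cdot> pair V u x =
        ent n m u j i \<odot> (pr n i \<cdot> x)"
      using rmul_comp[OF entry_hom[OF F j i] Proj_hom[OF S i] p] by simp
  qed
  finally show "pr m j \<cdot> mval n m (mat_act n m \<cdot> u) x =
    rsum W n (\<lambda>i. ent n m u j i \<odot> (pr n i \<cdot> x))" .
qed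

lemma star_act_hom:
    "star_act n m \<in> hom V (mat (Suc n) m) (Exp V (vec n) (vec m))"
  and star_act_value: "\<lbrakk>u \<in> hom V W (mat (Suc n) m); x \<in> hom V W (vec n); j < m\<rbrakk> \<Longrightarrow>
    pr m j \<cdot> mval n m (star_act n m \<cdot> u) x =
    ent (Suc n) m u j 0 \<oplus> rsum W n (\<lambda>i. (pr n i \<cdot> x) \<odot> ent (Suc n) m u j (Suc i))"
proof -
  let ?A = "mat (Suc n) m"
  let ?W = "Prd V ?A (vec n)"
  let ?u = "ent (Suc n) m (Fst V ?A (vec n))"
  let ?x = "\<lambda>i. pr n i \<cdot> Snd V ?A (vec n)"
  let ?s = "\<lambda>j. rsum ?W n (\<lambda>i. ?x i \<odot> ?u j (Suc i))"
  let ?b = "\<lambda>j. ?u j 0 \<oplus> ?s j"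
  have F: "Fst V ?A (vec n) \<in> hom V ?W ?A" and S: "Snd V ?A (vec n) \<in> hom V ?W (vec n)"
    by (simp_all add: hom_def)
  have act: "star_act n m = transpose V ?A (vec n) (vec m) (tuple V ?W (Car R) m ?b)"
    by (simp add: Mat_op_star_act_def Let_def)
  have term_hom: "?x i \<odot> ?u j (Suc i) \<in> el ?W" if "j < m" "i < n" for j i
    using entry_hom[OF F] Proj_hom[OF S] that by (intro rmul_hom) simp_all
  then have s: "?s j \<in> el ?W" if "j < m" for j
    using that by (intro radd_upto_hom) simp_all
  have u0: "?u j 0 \<in> el ?W" if "j < m" for j
    using entry_hom[OF F that, of 0] by simp
  have b: "?b j \<in> el ?W" if "j < m" for j
    using s[OF that] u0[OF that] by (rule radd_hom[rotated])
  show "star_act n m \<in> hom V ?A (Exp V (vec n) (vec m))"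
    unfolding act using b by (intro transpose_tuple_hom) simp_all
  assume u: "u \<in> hom V W ?A" and x: "x \<in> hom V W (vec n)" and j: "j < m"
  have p: "pair V u x \<in> hom V W ?W" and Fp: "Fst V ?A (vec n) \<cdot> pair V u x = u"
    and Sp: "Snd V ?A (vec n) \<cdot> pair V u x = x"
    using u x by (simp_all add: hom_def)
  have up: "?u j i \<cdot> pair V u x = ent (Suc n) m u j i" if "i < Suc n" for i
    using entry_comp[OF F j that p] by (simp only: Fp)
  have "pr m j \<cdot> mval n m (star_act n m \<cdot> u) x = ?b j \<cdot> pair V u x"
    unfolding act using b u x j by (intro Proj_app_transpose_tuple[where U = W]) simp_all
  also have "\<dots> = ent (Suc n) m u j 0 \<oplus> (?s j \<cdot> pair V u x)"
    using radd_comp[OF u0[OF j] s[OF j] p] up[of 0] by simp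
  also have "?s j \<cdot> pair V u x = rsum W n (\<lambda>i. (?x i \<odot> ?u j (Suc i)) \<cdot> pair V u x)"
    using term_hom j by (intro radd_upto_comp[OF p]) simp
  also have "\<dots> = rsum W n
      (\<lambda>i. (pr n i \<cdot> x) \<odot> ent (Suc n) m u j (Suc i))"
  proof (rule radd_upto_cong)
    fix i assume i: "i < n"
    then have Si: "Suc i < Suc n" by simp
    have "?x i \<cdot> pair V u x = pr n i \<cdot> x"
    proof -
      have "?x i \<cdot> pair V u x = pr n i \<cdot> Snd V ?A (vec n) \<cdot> pair V u x"
        using p S i by (simp add: hom_def del: Snd_pair)
      then show ?thesis by (simp only: Sp)
    qed
    then show "(?x i \<odot> ?u j (Suc i)) \<cdot> pair V u x =
        (pr n i \<cdot> x) \<odot> ent (Suc n) m u j (Suc i)"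
      using rmul_comp[OF Proj_hom[OF S i] entry_hom[OF F j Si] p] up[OF Si] by simp
  qed
  finally show "pr m j \<cdot> mval n m (star_act n m \<cdot> u) x =
    ent (Suc n) m u j 0 \<oplus> rsum W n (\<lambda>i. (pr n i \<cdot> x) \<odot> ent (Suc n) m u j (Suc i))" .
qed

text \<open>
  Likewise, composition in the two theories is given by the defining formulas for the entries.
\<close>

lemma Mat_comp_hom: "vComp (Mat V R) n m l \<in> hom V (Prd V (mat m l) (mat n m)) (mat n l)"
  and Mat_vcomp_hom: "\<lbrakk>a \<in> hom V W (mat n m); b \<in> hom V W (mat m l)\<rbrakk> \<Longrightarrow>
    vcomp V (Mat V R) n m l b a \<in> hom V W (mat n l)"
  and Mat_vcomp_entry: "\<lbrakk>a \<in> hom V W (mat n m); b \<in> hom V W (mat m l); k < l; i < n\<rbrakk> \<Longrightarrow>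
    ent n l (vcomp V (Mat V R) n m l b a) k i =
    rsum W m (\<lambda>j. ent m l b k j \<odot> ent n m a j i)"
proof -
  let ?B = "mat m l" and ?A = "mat n m"
  let ?W = "Prd V ?B ?A"
  let ?b = "ent m l (Fst V ?B ?A)" and ?a = "ent n m (Snd V ?B ?A)"
  let ?c = "\<lambda>k i. rsum ?W m (\<lambda>j. ?b k j \<odot> ?a j i)"
  have F: "Fst V ?B ?A \<in> hom V ?W ?B" and S: "Snd V ?B ?A \<in> hom V ?W ?A"
    by (simp_all add: hom_def)
  have eq: "vComp (Mat V R) n m l = mat_of V R ?W n l ?c" by (simp add: Mat_def Let_def)
  have term_hom: "?b k j \<odot> ?a j i \<in> el ?W" if "k < l" "j < m" "i < n" for k j i
    using entry_hom[OF F] entry_hom[OF S] that by (intro rmul_hom) simp_all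
  then have c: "?c k i \<in> el ?W" if "k < l" "i < n" for k i
    using that by (intro radd_upto_hom) simp_all
  show comp: "vComp (Mat V R) n m l \<in> hom V ?W (mat n l)"
    unfolding eq using c by (intro mat_of_hom) simp_all
  assume a: "a \<in> hom V W ?A" and b: "b \<in> hom V W ?B"
  have p: "pair V b a \<in> hom V W ?W" and Fp: "Fst V ?B ?A \<cdot> pair V b a = b"
    and Sp: "Snd V ?B ?A \<cdot> pair V b a = a"
    using a b by (simp_all add: hom_def)
  show "vcomp V (Mat V R) n m l b a \<in> hom V W (mat n l)"
    using comp p by (simp add: vcomp_def hom_def)
  assume k: "k < l" and i: "i < n"
  have "ent n l (vcomp V (Mat V R) n m l b a) k i = ent n l (mat_of V R ?W n l ?c) k i \<cdot> pair V b a"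
    unfolding vcomp_def using entry_comp[OF comp k i p] by (simp only: eq)
  also have "ent n l (mat_of V R ?W n l ?c) k i = ?c k i"
    using c k i by (intro entry_mat_of) simp_all
  also have "?c k i \<cdot> pair V b a = rsum W m (\<lambda>j. (?b k j \<odot> ?a j i) \<cdot> pair V b a)"
    using term_hom k i by (intro radd_upto_comp[OF p]) simp
  also have "\<dots> = rsum W m (\<lambda>j. ent m l b k j \<odot> ent n m a j i)"
    using rmul_comp[OF entry_hom[OF F k] entry_hom[OF S _ i] p] entry_comp[OF F k _ p]
      entry_comp[OF S _ i p] by (intro radd_upto_cong) (simp only: Fp Sp)
  finally show "ent n l (vcomp V (Mat V R) n m l b a) k i =
    rsum W m (\<lambda>j. ent m l b k j \<odot> ent n m a j i)" .
qed

lemma star_comp_hom: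
    "vComp (Mat_op_star V R) n m l \<in> hom V (Prd V (mat (Suc m) l) (mat (Suc n) m)) (mat (Suc n) l)"
  and star_vcomp_hom: "\<lbrakk>u \<in> hom V W (mat (Suc n) m); v \<in> hom V W (mat (Suc m) l)\<rbrakk> \<Longrightarrow>
    vcomp V (Mat_op_star V R) n m l v u \<in> hom V W (mat (Suc n) l)"
  and star_vcomp_entry:
    "\<lbrakk>u \<in> hom V W (mat (Suc n) m); v \<in> hom V W (mat (Suc m) l); k < l; i < Suc n\<rbrakk> \<Longrightarrow>
    ent (Suc n) l (vcomp V (Mat_op_star V R) n m l v u) k i =
    (let s = rsum W m (\<lambda>j. ent (Suc n) m u j i \<odot> ent (Suc m) l v k (Suc j))
     in if i = 0 then (ent (Suc m) l v k 0 \<oplus> s) else s)"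
proof -
  let ?B = "mat (Suc m) l" and ?A = "mat (Suc n) m"
  let ?W = "Prd V ?B ?A"
  let ?v = "ent (Suc m) l (Fst V ?B ?A)" and ?u = "ent (Suc n) m (Snd V ?B ?A)"
  let ?s = "\<lambda>k i. rsum ?W m (\<lambda>j. ?u j i \<odot> ?v k (Suc j))"
  let ?c = "\<lambda>k i. if i = 0 then (?v k 0 \<oplus> ?s k 0) else ?s k i"
  have F: "Fst V ?B ?A \<in> hom V ?W ?B" and S: "Snd V ?B ?A \<in> hom V ?W ?A"
    by (simp_all add: hom_def)
  have eq: "vComp (Mat_op_star V R) n m l = mat_of V R ?W (Suc n) l ?c"
    by (simp add: Mat_op_star_def Let_def)
  have term_hom: "?u j i \<odot> ?v k (Suc j) \<in> el ?W"
    if "k < l" "j < m" "i < Suc n" for k j i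
    using entry_hom[OF F] entry_hom[OF S] that by (intro rmul_hom) simp_all
  then have s: "?s k i \<in> el ?W" if "k < l" "i < Suc n" for k i
    using that by (intro radd_upto_hom) simp_all
  have v0: "?v k 0 \<in> el ?W" if "k < l" for k
    using entry_hom[OF F that, of 0] by simp
  have c: "?c k i \<in> el ?W" if "k < l" "i < Suc n" for k i
    using radd_hom[OF v0 s] s that by simp
  show comp: "vComp (Mat_op_star V R) n m l \<in> hom V ?W (mat (Suc n) l)"
    unfolding eq using c by (intro mat_of_hom) simp_all
  assume u: "u \<in> hom V W ?A" and v: "v \<in> hom V W ?B"
  have p: "pair V v u \<in> hom V W ?W" and Fp: "Fst V ?B ?A \<cdot> pair V v u = v"
    and Sp: "Snd V ?B ?A \<cdot> pair V v u = u"
    using u v by (simp_all add: hom_def)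
  show "vcomp V (Mat_op_star V R) n m l v u \<in> hom V W (mat (Suc n) l)"
    using comp p by (simp add: vcomp_def hom_def)
  assume k: "k < l" and i: "i < Suc n"
  let ?t = "rsum W m (\<lambda>j. ent (Suc n) m u j i \<odot> ent (Suc m) l v k (Suc j))"
  have sp: "?s k i \<cdot> pair V v u = ?t"
  proof -
    have "?s k i \<cdot> pair V v u = rsum W m (\<lambda>j. (?u j i \<odot> ?v k (Suc j)) \<cdot> pair V v u)"
      using term_hom k i by (intro radd_upto_comp[OF p]) simp
    also have "\<dots> = ?t"
    proof (rule radd_upto_cong)
      fix j assume j: "j < m"
      then have Sj: "Suc j < Suc m" by simp
      show "(?u j i \<odot> ?v k (Suc j)) \<cdot> pair V v u =
          ent (Suc n) m u j i \<odot> ent (Suc m) l v k (Suc j)"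
        by (simp only: rmul_comp[OF entry_hom[OF S j i] entry_hom[OF F k Sj] p]
            entry_comp[OF F k Sj p] entry_comp[OF S j i p] Fp Sp)
    qed
    finally show ?thesis .
  qed
  have "ent (Suc n) l (vcomp V (Mat_op_star V R) n m l v u) k i =
      ent (Suc n) l (mat_of V R ?W (Suc n) l ?c) k i \<cdot> pair V v u"
    unfolding vcomp_def using entry_comp[OF comp k i p] by (simp only: eq)
  also have "ent (Suc n) l (mat_of V R ?W (Suc n) l ?c) k i = ?c k i"
    using c k i by (intro entry_mat_of) simp_all
  also have "?c k i \<cdot> pair V v u =
      (if i = 0 then (ent (Suc m) l v k 0 \<oplus> ?t) else ?t)"
  proof (cases "i = 0")
    case True
    have "?v k 0 \<cdot> pair V v u = ent (Suc m) l v k 0"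
      using entry_comp[OF F k zero_less_Suc p] by (simp only: Fp)
    then show ?thesis
      using True radd_comp[OF v0[OF k] s[OF k i] p] sp by simp
  next
    case False
    then show ?thesis using sp by simp
  qed
  finally show "ent (Suc n) l (vcomp V (Mat_op_star V R) n m l v u) k i =
    (let s = rsum W m (\<lambda>j. ent (Suc n) m u j i \<odot> ent (Suc m) l v k (Suc j))
     in if i = 0 then (ent (Suc m) l v k 0 \<oplus> s) else s)"
    by (simp add: Let_def)
qed

end

section \<open>Basis vectors and functoriality of the actions\<close>

context cartesian_closed
begin

lemma vcomp_precomp:
  assumes "vComp C n m l \<in> hom V (Prd V G F) H" "g \<in> hom V W G" "f \<in> hom V W F" "t \<in> hom V U W"
  shows "vcomp V C n m l g f \<cdot> t = vcomp V C n m l (g \<cdot> t) (f \<cdot> t)"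
  using assms by (simp add: vcomp_def hom_def)

end

context rig_in
begin

lemma act_simps [simp]:
  "mat_act n m \<in> Arr V" "Dom V (mat_act n m) = mat n m"
  "Cod V (mat_act n m) = Exp V (vec n) (vec m)"
  "star_act n m \<in> Arr V" "Dom V (star_act n m) = mat (Suc n) m"
  "Cod V (star_act n m) = Exp V (vec n) (vec m)"
  using Mat_act_hom[of n m] star_act_hom[of n m] by (auto simp: hom_def)

lemma vec_Exp_eqI:
  assumes f: "f \<in> hom V W (Exp V (vec n) (vec m))" and g: "g \<in> hom V W (Exp V (vec n) (vec m))"
    and eq: "\<And>U t x j. t \<in> hom V U W \<Longrightarrow> x \<in> hom V U (vec n) \<Longrightarrow> j < m \<Longrightarrow>
      pr m j \<cdot> mval n m (f \<cdot> t) x = pr m j \<cdot> mval n m (g \<cdot> t) x"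
  shows "f = g"
proof (rule Exp_eqI[OF f g])
  fix U t x assume tx: "t \<in> hom V U W" "x \<in> hom V U (vec n)"
  show "mval n m (f \<cdot> t) x = mval n m (g \<cdot> t) x"
  proof (rule Pow_eqI)
    show "mval n m (f \<cdot> t) x \<in> hom V U (vec m)" "mval n m (g \<cdot> t) x \<in> hom V U (vec m)"
      using f g tx by (simp_all add: hom_def)
  qed (use eq[OF tx] in simp_all)
qed simp_all

text \<open>
  For \<open>a \<ge> n\<close> this is the zero vector; \<open>basis W n n\<close> serves as the origin.
\<close>

definition basis :: "'o \<Rightarrow> nat \<Rightarrow> nat \<Rightarrow> 'a" where
  "basis W n a = tup W n (\<lambda>i. if i = a then rone V R W else rzero V R W)"

lemma basis_hom: "W \<in> Ob V \<Longrightarrow> basis W n a \<in> hom V W (vec n)"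
  and Proj_basis: "W \<in> Ob V \<Longrightarrow> i < n \<Longrightarrow>
    pr n i \<cdot> basis W n a = (if i = a then rone V R W else rzero V R W)"
proof -
  assume W: "W \<in> Ob V"
  have "(if i = a then rone V R W else rzero V R W) \<in> el W" for i
    using rone_hom[OF W] rzero_hom[OF W] by simp
  then show "basis W n a \<in> hom V W (vec n)"
    and "i < n \<Longrightarrow> pr n i \<cdot> basis W n a = (if i = a then rone V R W else rzero V R W)"
    using W by (simp_all add: basis_def hom_def)
qed

lemma basis_comp: "t \<in> hom V U W \<Longrightarrow> basis W n a \<cdot> t = basis U n a"
proof -
  assume t: "t \<in> hom V U W"
  then have W: "W \<in> Ob V" and U: "U \<in> Ob V" by (auto simp: hom_def)
  have d: "(if i = a then rone V R W else rzero V R W) \<in> el W" for i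
    using rone_hom[OF W] rzero_hom[OF W] by simp
  have "basis W n a \<cdot> t = tup (Dom V t) n
      (\<lambda>i. (if i = a then rone V R W else rzero V R W) \<cdot> t)"
    unfolding basis_def using d t by (intro tuple_comp) (simp_all add: hom_def)
  also have "\<dots> = basis U n a"
    unfolding basis_def hom_Dom[OF t]
    using rone_comp[OF t] rzero_comp[OF t] by (intro tuple_cong) simp
  finally show ?thesis .
qed

lemma Mat_act_basis:
  assumes u: "u \<in> hom V W (mat n m)" and j: "j < m" and a: "a < n"
  shows "pr m j \<cdot> mval n m (mat_act n m \<cdot> u) (basis W n a) = ent n m u j a"
proof -
  have W: "W \<in> Ob V" using u by (auto simp: hom_def)
  interpret S: rig_stage V R W by (rule rig_stageI[OF W])
  have "pr m j \<cdot> mval n m (mat_act n m \<cdot> u) (basis W n a) =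
      rsum W n (\<lambda>i. ent n m u j i \<odot> (pr n i \<cdot> basis W n a))"
    by (rule Mat_act_value[OF u basis_hom[OF W] j])
  also have "\<dots> = ent n m u j a \<odot> (pr n a \<cdot> basis W n a)"
    using entry_hom[OF u j] Proj_basis[OF W, of _ n a] a by (intro S.sum_single) simp_all
  finally show ?thesis
    using entry_hom[OF u j a] Proj_basis[OF W a, of a] by simp
qed

lemma star_act_basis:
  assumes u: "u \<in> hom V W (mat (Suc n) m)" and j: "j < m" and a: "a < n"
  shows "pr m j \<cdot> mval n m (star_act n m \<cdot> u) (basis W n a) =
    ent (Suc n) m u j 0 \<oplus> ent (Suc n) m u j (Suc a)"
proof -
  have W: "W \<in> Ob V" using u by (auto simp: hom_def)
  interpret S: rig_stage V R W by (rule rig_stageI[OF W])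
  have "rsum W n (\<lambda>i. (pr n i \<cdot> basis W n a) \<odot> ent (Suc n) m u j (Suc i)) =
      (pr n a \<cdot> basis W n a) \<odot> ent (Suc n) m u j (Suc a)"
    using entry_hom[OF u j] Proj_basis[OF W, of _ n a] a by (intro S.sum_single) simp_all
  then show ?thesis
    using star_act_value[OF u basis_hom[OF W] j] entry_hom[OF u j, of "Suc a"]
      Proj_basis[OF W a, of a] a by simp
qed

lemma star_act_zero:
  assumes u: "u \<in> hom V W (mat (Suc n) m)" and j: "j < m"
  shows "pr m j \<cdot> mval n m (star_act n m \<cdot> u) (basis W n n) =
    ent (Suc n) m u j 0"
proof -
  have W: "W \<in> Ob V" using u by (auto simp: hom_def)
  interpret S: rig_stage V R W by (rule rig_stageI[OF W])
  have "rsum W n (\<lambda>i. (pr n i \<cdot> basis W n n) \<odot> ent (Suc n) m u j (Suc i)) =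
      rsum W n (\<lambda>i. rzero V R W)"
    using entry_hom[OF u j] Proj_basis[OF W, of _ n n] by (intro radd_upto_cong) simp
  then show ?thesis
    using star_act_value[OF u basis_hom[OF W] j] entry_hom[OF u j, of 0] by simp
qed

text \<open>
  Multiplication of matrices is composition of their actions, by \<open>sum_mul_assoc\<close>.
\<close>

lemma Mat_act_comp:
  assumes a: "a \<in> hom V W (mat n m)" and b: "b \<in> hom V W (mat m l)"
  shows "mat_act n l \<cdot> vcomp V (Mat V R) n m l b a =
    vcomp V (self V) (vec n) (vec m) (vec l) (mat_act m l \<cdot> b) (mat_act n m \<cdot> a)"
proof (rule vec_Exp_eqI)
  note c = Mat_vcomp_hom[OF a b]
  have A: "mat_act n m \<cdot> a \<in> hom V W (Exp V (vec n) (vec m))"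
    and B: "mat_act m l \<cdot> b \<in> hom V W (Exp V (vec m) (vec l))"
    by (rule Comp_hom[OF a Mat_act_hom], rule Comp_hom[OF b Mat_act_hom])
  show "mat_act n l \<cdot> vcomp V (Mat V R) n m l b a \<in> hom V W (Exp V (vec n) (vec l))"
    by (rule Comp_hom[OF c Mat_act_hom])
  show "vcomp V (self V) (vec n) (vec m) (vec l) (mat_act m l \<cdot> b) (mat_act n m \<cdot> a)
      \<in> hom V W (Exp V (vec n) (vec l))"
    using A B by (simp add: hom_def)
  fix U t x k assume t: "t \<in> hom V U W" and x: "x \<in> hom V U (vec n)" and k: "k < l"
  then have U: "U \<in> Ob V" by (auto simp: hom_def)
  interpret S: rig_stage V R U by (rule rig_stageI[OF U])
  note at = Comp_hom[OF t a] and bt = Comp_hom[OF t b]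
  have ct: "vcomp V (Mat V R) n m l b a \<cdot> t = vcomp V (Mat V R) n m l (b \<cdot> t) (a \<cdot> t)"
    by (rule vcomp_precomp[OF Mat_comp_hom b a t])
  have ax: "mval n m (mat_act n m \<cdot> (a \<cdot> t)) x \<in> hom V U (vec m)"
    using Comp_hom[OF at Mat_act_hom] x by (simp add: hom_def)
  let ?y = "\<lambda>j. rsum U n (\<lambda>i. ent n m (a \<cdot> t) j i \<odot> (pr n i \<cdot> x))"
  have "pr l k \<cdot> mval n l ((mat_act n l \<cdot> vcomp V (Mat V R) n m l b a) \<cdot> t) x =
      rsum U n (\<lambda>i. ent n l (vcomp V (Mat V R) n m l (b \<cdot> t) (a \<cdot> t)) k i \<odot> (pr n i \<cdot> x))"
    unfolding Comp_assoc[OF t c Mat_act_hom] ct by (rule Mat_act_value[OF Mat_vcomp_hom[OF at bt] x k])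
  also have "\<dots> = rsum U n (\<lambda>i. rsum U m
        (\<lambda>j. ent m l (b \<cdot> t) k j \<odot> ent n m (a \<cdot> t) j i) \<odot> (pr n i \<cdot> x))"
    using Mat_vcomp_entry[OF at bt k] by (intro radd_upto_cong) simp
  also have "\<dots> = rsum U m (\<lambda>j. ent m l (b \<cdot> t) k j \<odot> ?y j)"
    using entry_hom[OF at] entry_hom[OF bt k] Proj_hom[OF x] by (intro S.sum_mul_assoc) simp_all
  also have "\<dots> = rsum U m (\<lambda>j. ent m l (b \<cdot> t) k j \<odot> (pr m j \<cdot> mval n m (mat_act n m \<cdot> (a \<cdot> t)) x))"
    using Mat_act_value[OF at x] by (intro radd_upto_cong) simp
  also have "\<dots> = pr l k \<cdot> mval m l (mat_act m l \<cdot> (b \<cdot> t)) (mval n m (mat_act n m \<cdot> (a \<cdot> t)) x)"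
    by (rule Mat_act_value[OF bt ax k, symmetric])
  also have "mval m l (mat_act m l \<cdot> (b \<cdot> t)) (mval n m (mat_act n m \<cdot> (a \<cdot> t)) x) =
      mval n l (vcomp V (self V) (vec n) (vec m) (vec l) (mat_act m l \<cdot> b) (mat_act n m \<cdot> a) \<cdot> t) x"
    using a b t x by (simp add: hom_def)
  finally show "pr l k \<cdot> mval n l ((mat_act n l \<cdot> vcomp V (Mat V R) n m l b a) \<cdot> t) x =
      pr l k \<cdot> mval n l (vcomp V (self V) (vec n) (vec m) (vec l)
        (mat_act m l \<cdot> b) (mat_act n m \<cdot> a) \<cdot> t) x" .
qed

text \<open>
  Substitution of \<open>u\<^sub>j\<^sub>0 + \<Sum>\<^sub>i x\<^sub>i u\<^sub>j\<^sub>i\<close> for the variables of \<open>v\<^sub>k\<close>: the constant terms collect in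
  column \<open>0\<close>, and the rest is \<open>sum_mul_assoc\<close>.
\<close>

lemma star_act_comp:
  assumes u: "u \<in> hom V W (mat (Suc n) m)" and v: "v \<in> hom V W (mat (Suc m) l)"
  shows "star_act n l \<cdot> vcomp V (Mat_op_star V R) n m l v u =
    vcomp V (self V) (vec n) (vec m) (vec l) (star_act m l \<cdot> v) (star_act n m \<cdot> u)"
proof (rule vec_Exp_eqI)
  note c = star_vcomp_hom[OF u v]
  have A: "star_act n m \<cdot> u \<in> hom V W (Exp V (vec n) (vec m))"
    and B: "star_act m l \<cdot> v \<in> hom V W (Exp V (vec m) (vec l))"
    by (rule Comp_hom[OF u star_act_hom], rule Comp_hom[OF v star_act_hom])
  show "star_act n l \<cdot> vcomp V (Mat_op_star V R) n m l v u \<in> hom V W (Exp V (vec n) (vec l))"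
    by (rule Comp_hom[OF c star_act_hom])
  show "vcomp V (self V) (vec n) (vec m) (vec l) (star_act m l \<cdot> v) (star_act n m \<cdot> u)
      \<in> hom V W (Exp V (vec n) (vec l))"
    using A B by (simp add: hom_def)
  fix U t x k assume t: "t \<in> hom V U W" and x: "x \<in> hom V U (vec n)" and k: "k < l"
  then have U: "U \<in> Ob V" by (auto simp: hom_def)
  interpret S: rig_stage V R U by (rule rig_stageI[OF U])
  note ut = Comp_hom[OF t u] and vt = Comp_hom[OF t v]
  have ct: "vcomp V (Mat_op_star V R) n m l v u \<cdot> t = vcomp V (Mat_op_star V R) n m l (v \<cdot> t) (u \<cdot> t)"
    by (rule vcomp_precomp[OF star_comp_hom v u t])
  have ux: "mval n m (star_act n m \<cdot> (u \<cdot> t)) x \<in> hom V U (vec m)"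
    using Comp_hom[OF ut star_act_hom] x by (simp add: hom_def)
  let ?x = "\<lambda>i. pr n i \<cdot> x"
  let ?u = "ent (Suc n) m (u \<cdot> t)" and ?v = "ent (Suc m) l (v \<cdot> t) k"
  let ?w = "ent (Suc n) l (vcomp V (Mat_op_star V R) n m l (v \<cdot> t) (u \<cdot> t)) k"
  let ?xu = "\<lambda>j. rsum U n (\<lambda>i. ?x i \<odot> ?u j (Suc i))"
  have uh: "?u j i \<in> el U" if "j < m" "i < Suc n" for j i
    by (rule entry_hom[OF ut that])
  have vh: "?v i \<in> el U" if "i < Suc m" for i
    by (rule entry_hom[OF vt k that])
  have xh: "?x i \<in> el U" if "i < n" for i
    by (rule Proj_hom[OF x that])
  have "pr l k \<cdot> mval n l ((star_act n l \<cdot> vcomp V (Mat_op_star V R) n m l v u) \<cdot> t) x =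
      ?w 0 \<oplus> rsum U n (\<lambda>i. ?x i \<odot> ?w (Suc i))"
    unfolding Comp_assoc[OF t c star_act_hom] ct by (rule star_act_value[OF star_vcomp_hom[OF ut vt] x k])
  also have "?w 0 = ?v 0 \<oplus> rsum U m (\<lambda>j. ?u j 0 \<odot> ?v (Suc j))"
    using star_vcomp_entry[OF ut vt k, of 0] by (simp add: Let_def)
  also have "rsum U n (\<lambda>i. ?x i \<odot> ?w (Suc i)) =
      rsum U n (\<lambda>i. ?x i \<odot> rsum U m (\<lambda>j. ?u j (Suc i) \<odot> ?v (Suc j)))"
    using star_vcomp_entry[OF ut vt k] by (intro radd_upto_cong) (simp add: Let_def)
  also have "\<dots> = rsum U m (\<lambda>j. ?xu j \<odot> ?v (Suc j))"
    using uh vh xh by (intro S.sum_mul_assoc[symmetric]) simp_all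
  also have "(?v 0 \<oplus> rsum U m (\<lambda>j. ?u j 0 \<odot> ?v (Suc j))) \<oplus> \<dots> =
      ?v 0 \<oplus> (rsum U m (\<lambda>j. ?u j 0 \<odot> ?v (Suc j)) \<oplus> rsum U m (\<lambda>j. ?xu j \<odot> ?v (Suc j)))"
    using uh vh xh by (intro S.assoc) simp_all
  also have "rsum U m (\<lambda>j. ?u j 0 \<odot> ?v (Suc j)) \<oplus> rsum U m (\<lambda>j. ?xu j \<odot> ?v (Suc j)) =
      rsum U m (\<lambda>j. ?u j 0 \<odot> ?v (Suc j) \<oplus> ?xu j \<odot> ?v (Suc j))"
    using uh vh xh by (intro S.sum_add[symmetric]) simp_all
  also have "\<dots> = rsum U m (\<lambda>j. (pr m j \<cdot> mval n m (star_act n m \<cdot> (u \<cdot> t)) x) \<odot> ?v (Suc j))"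
    using star_act_value[OF ut x] uh vh xh by (intro radd_upto_cong) (simp add: S.distribs)
  also have "?v 0 \<oplus> \<dots> =
      pr l k \<cdot> mval m l (star_act m l \<cdot> (v \<cdot> t)) (mval n m (star_act n m \<cdot> (u \<cdot> t)) x)"
    by (rule star_act_value[OF vt ux k, symmetric])
  also have "mval m l (star_act m l \<cdot> (v \<cdot> t)) (mval n m (star_act n m \<cdot> (u \<cdot> t)) x) =
      mval n l (vcomp V (self V) (vec n) (vec m) (vec l) (star_act m l \<cdot> v) (star_act n m \<cdot> u) \<cdot> t) x"
    using u v t x by (simp add: hom_def)
  finally show "pr l k \<cdot> mval n l ((star_act n l \<cdot> vcomp V (Mat_op_star V R) n m l v u) \<cdot> t) x =
      pr l k \<cdot> mval n l (vcomp V (self V) (vec n) (vec m) (vec l)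
        (star_act m l \<cdot> v) (star_act n m \<cdot> u) \<cdot> t) x" .
qed

text \<open>
  Identities and projections of both theories are matrices with entries \<open>0\<close> and \<open>1\<close>; these are stable under reindexing.
\<close>

lemma one_entry:
  assumes "u = mat_of V R (One V) n m (\<lambda>j i. if P j i then rone V R (One V) else rzero V R (One V))"
  shows "u \<in> hom V (One V) (mat n m)"
    and "\<lbrakk>t \<in> hom V U (One V); j < m; i < n\<rbrakk> \<Longrightarrow>
      ent n m (u \<cdot> t) j i = (if P j i then rone V R U else rzero V R U)"
proof -
  have d: "(if P j i then rone V R (One V) else rzero V R (One V)) \<in> hom V (One V) (Car R)" for j i
    using rone_hom[of "One V"] rzero_hom[of "One V"] by simp
  show u: "u \<in> hom V (One V) (mat n m)"
    unfolding assms using d by (intro mat_of_hom) simp_all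
  assume t: "t \<in> hom V U (One V)" and j: "j < m" and i: "i < n"
  have "ent n m (u \<cdot> t) j i = ent n m u j i \<cdot> t"
    by (rule entry_comp[OF u j i t, symmetric])
  also have "ent n m u j i = (if P j i then rone V R (One V) else rzero V R (One V))"
    unfolding assms using d j i by (intro entry_mat_of) simp_all
  finally show "ent n m (u \<cdot> t) j i = (if P j i then rone V R U else rzero V R U)"
    using rone_comp[OF t] rzero_comp[OF t] by simp
qed

lemma Mat_act_Id: "vId (Mat V R) n \<in> hom V (One V) (mat n n)"
    "mat_act n n \<cdot> vId (Mat V R) n = name V (vec n) (vec n) (Ide V (vec n))"
proof -
  have "vId (Mat V R) n = mat_of V R (One V) n n
      (\<lambda>j i. if j = i then rone V R (One V) else rzero V R (One V))" by (simp add: Mat_def)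
  note i = one_entry[OF this]
  show hom: "vId (Mat V R) n \<in> hom V (One V) (mat n n)" by (rule i(1))
  show "mat_act n n \<cdot> vId (Mat V R) n = name V (vec n) (vec n) (Ide V (vec n))"
  proof (rule vec_Exp_eqI)
    show "mat_act n n \<cdot> vId (Mat V R) n \<in> hom V (One V) (Exp V (vec n) (vec n))"
      by (rule Comp_hom[OF hom Mat_act_hom])
    show "name V (vec n) (vec n) (Ide V (vec n)) \<in> hom V (One V) (Exp V (vec n) (vec n))"
      by (simp add: hom_def)
    fix U t x j assume t: "t \<in> hom V U (One V)" and x: "x \<in> hom V U (vec n)" and j: "j < n"
    then have U: "U \<in> Ob V" by (auto simp: hom_def)
    interpret S: rig_stage V R U by (rule rig_stageI[OF U])
    have "pr n j \<cdot> mval n n ((mat_act n n \<cdot> vId (Mat V R) n) \<cdot> t) x =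
        rsum U n (\<lambda>i. ent n n (vId (Mat V R) n \<cdot> t) j i \<odot> (pr n i \<cdot> x))"
      unfolding Comp_assoc[OF t hom Mat_act_hom] by (rule Mat_act_value[OF Comp_hom[OF t hom] x j])
    also have "\<dots> = ent n n (vId (Mat V R) n \<cdot> t) j j \<odot> (pr n j \<cdot> x)"
      using i(2)[OF t j] Proj_hom[OF x] j by (intro S.sum_single) simp_all
    also have "\<dots> = pr n j \<cdot> x" using i(2)[OF t j j] Proj_hom[OF x j] by simp
    finally show "pr n j \<cdot> mval n n ((mat_act n n \<cdot> vId (Mat V R) n) \<cdot> t) x =
        pr n j \<cdot> mval n n (name V (vec n) (vec n) (Ide V (vec n)) \<cdot> t) x"
      using t x by (simp add: hom_def)
  qed
qed

lemma Mat_act_tProj: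
  assumes k: "k < n"
  shows "tProj (Mat V R) n k \<in> hom V (One V) (mat n 1)"
    "mat_act n 1 \<cdot> tProj (Mat V R) n k = name V (vec n) (Car R) (pr n k)"
proof -
  have "tProj (Mat V R) n k = mat_of V R (One V) n 1
      (\<lambda>_ i. if i = k then rone V R (One V) else rzero V R (One V))" by (simp add: Mat_def)
  note i = one_entry[OF this]
  show hom: "tProj (Mat V R) n k \<in> hom V (One V) (mat n 1)" by (rule i(1))
  show "mat_act n 1 \<cdot> tProj (Mat V R) n k = name V (vec n) (Car R) (pr n k)"
  proof (rule vec_Exp_eqI)
    show "mat_act n 1 \<cdot> tProj (Mat V R) n k \<in> hom V (One V) (Exp V (vec n) (vec 1))"
      by (rule Comp_hom[OF hom Mat_act_hom])
    show "name V (vec n) (Car R) (pr n k) \<in> hom V (One V) (Exp V (vec n) (vec 1))"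
      using k by (simp add: hom_def)
    fix U t x and j :: nat assume t: "t \<in> hom V U (One V)" and x: "x \<in> hom V U (vec n)" and j: "j < 1"
    then have U: "U \<in> Ob V" by (auto simp: hom_def)
    interpret S: rig_stage V R U by (rule rig_stageI[OF U])
    have "pr 1 j \<cdot> mval n 1 ((mat_act n 1 \<cdot> tProj (Mat V R) n k) \<cdot> t) x =
        rsum U n (\<lambda>i. ent n 1 (tProj (Mat V R) n k \<cdot> t) j i \<odot> (pr n i \<cdot> x))"
      unfolding Comp_assoc[OF t hom Mat_act_hom] by (rule Mat_act_value[OF Comp_hom[OF t hom] x j])
    also have "\<dots> = ent n 1 (tProj (Mat V R) n k \<cdot> t) j k \<odot> (pr n k \<cdot> x)"
      using i(2)[OF t j] Proj_hom[OF x] k by (intro S.sum_single) simp_all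
    also have "\<dots> = pr n k \<cdot> x" using i(2)[OF t j k] Proj_hom[OF x k] by simp
    finally show "pr 1 j \<cdot> mval n 1 ((mat_act n 1 \<cdot> tProj (Mat V R) n k) \<cdot> t) x =
        pr 1 j \<cdot> mval n 1 (name V (vec n) (Car R) (pr n k) \<cdot> t) x"
      using t x k j by (simp add: hom_def)
  qed
qed

lemma star_act_Id: "vId (Mat_op_star V R) n \<in> hom V (One V) (mat (Suc n) n)"
    "star_act n n \<cdot> vId (Mat_op_star V R) n = name V (vec n) (vec n) (Ide V (vec n))"
proof -
  let ?I = "vId (Mat_op_star V R) n"
  have "?I = mat_of V R (One V) (Suc n) n
      (\<lambda>j i. if i = Suc j then rone V R (One V) else rzero V R (One V))" by (simp add: Mat_op_star_def)
  note i = one_entry[OF this]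
  show hom: "?I \<in> hom V (One V) (mat (Suc n) n)" by (rule i(1))
  show "star_act n n \<cdot> ?I = name V (vec n) (vec n) (Ide V (vec n))"
  proof (rule vec_Exp_eqI)
    show "star_act n n \<cdot> ?I \<in> hom V (One V) (Exp V (vec n) (vec n))"
      by (rule Comp_hom[OF hom star_act_hom])
    show "name V (vec n) (vec n) (Ide V (vec n)) \<in> hom V (One V) (Exp V (vec n) (vec n))"
      by (simp add: hom_def)
    fix U t x j assume t: "t \<in> hom V U (One V)" and x: "x \<in> hom V U (vec n)" and j: "j < n"
    then have U: "U \<in> Ob V" by (auto simp: hom_def)
    interpret S: rig_stage V R U by (rule rig_stageI[OF U])
    let ?e = "ent (Suc n) n (?I \<cdot> t) j"
    have "pr n j \<cdot> mval n n ((star_act n n \<cdot> ?I) \<cdot> t) x =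
        ?e 0 \<oplus> rsum U n (\<lambda>i. (pr n i \<cdot> x) \<odot> ?e (Suc i))"
      unfolding Comp_assoc[OF t hom star_act_hom] by (rule star_act_value[OF Comp_hom[OF t hom] x j])
    also have "rsum U n (\<lambda>i. (pr n i \<cdot> x) \<odot> ?e (Suc i)) =
        (pr n j \<cdot> x) \<odot> ?e (Suc j)"
      using i(2)[OF t j] Proj_hom[OF x] j by (intro S.sum_single) simp_all
    also have "?e 0 \<oplus> \<dots> = pr n j \<cdot> x"
      using i(2)[OF t j, of 0] i(2)[OF t j, of "Suc j"] Proj_hom[OF x j] j by simp
    finally show "pr n j \<cdot> mval n n ((star_act n n \<cdot> ?I) \<cdot> t) x =
        pr n j \<cdot> mval n n (name V (vec n) (vec n) (Ide V (vec n)) \<cdot> t) x"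
      using t x by (simp add: hom_def)
  qed
qed

lemma star_act_tProj:
  assumes k: "k < n"
  shows "tProj (Mat_op_star V R) n k \<in> hom V (One V) (mat (Suc n) 1)"
    "star_act n 1 \<cdot> tProj (Mat_op_star V R) n k = name V (vec n) (Car R) (pr n k)"
proof -
  let ?p = "tProj (Mat_op_star V R) n k"
  have "?p = mat_of V R (One V) (Suc n) 1
      (\<lambda>_ i. if i = Suc k then rone V R (One V) else rzero V R (One V))" by (simp add: Mat_op_star_def)
  note i = one_entry[OF this]
  show hom: "?p \<in> hom V (One V) (mat (Suc n) 1)" by (rule i(1))
  show "star_act n 1 \<cdot> ?p = name V (vec n) (Car R) (pr n k)"
  proof (rule vec_Exp_eqI)
    show "star_act n 1 \<cdot> ?p \<in> hom V (One V) (Exp V (vec n) (vec 1))"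
      by (rule Comp_hom[OF hom star_act_hom])
    show "name V (vec n) (Car R) (pr n k) \<in> hom V (One V) (Exp V (vec n) (vec 1))"
      using k by (simp add: hom_def)
    fix U t x and j :: nat assume t: "t \<in> hom V U (One V)" and x: "x \<in> hom V U (vec n)" and j: "j < 1"
    then have U: "U \<in> Ob V" by (auto simp: hom_def)
    interpret S: rig_stage V R U by (rule rig_stageI[OF U])
    let ?e = "ent (Suc n) 1 (?p \<cdot> t) j"
    have "pr 1 j \<cdot> mval n 1 ((star_act n 1 \<cdot> ?p) \<cdot> t) x =
        ?e 0 \<oplus> rsum U n (\<lambda>i. (pr n i \<cdot> x) \<odot> ?e (Suc i))"
      unfolding Comp_assoc[OF t hom star_act_hom] by (rule star_act_value[OF Comp_hom[OF t hom] x j])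
    also have "rsum U n (\<lambda>i. (pr n i \<cdot> x) \<odot> ?e (Suc i)) =
        (pr n k \<cdot> x) \<odot> ?e (Suc k)"
      using i(2)[OF t j] Proj_hom[OF x] k by (intro S.sum_single) simp_all
    also have "?e 0 \<oplus> \<dots> = pr n k \<cdot> x"
      using i(2)[OF t j, of 0] i(2)[OF t j, of "Suc k"] Proj_hom[OF x k] k by simp
    finally show "pr 1 j \<cdot> mval n 1 ((star_act n 1 \<cdot> ?p) \<cdot> t) x =
        pr 1 j \<cdot> mval n 1 (name V (vec n) (Car R) (pr n k) \<cdot> t) x"
      using t x k j by (simp add: hom_def)
  qed
qed

lemma Mat_act_mono: "is_mono V (mat_act n m)"
  unfolding is_mono_def
proof (intro conjI allI ballI impI)
  show "mat_act n m \<in> Arr V" by simp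
  fix W f g assume "f \<in> hom V W (Dom V (mat_act n m))" "g \<in> hom V W (Dom V (mat_act n m))"
  then have f: "f \<in> hom V W (mat n m)" and g: "g \<in> hom V W (mat n m)" by simp_all
  assume eq: "mat_act n m \<cdot> f = mat_act n m \<cdot> g"
  show "f = g"
    using Mat_act_basis[OF f] Mat_act_basis[OF g] by (intro mat_eqI[OF f g]) (simp add: eq)
qed

end

section \<open>Affine matrices\<close>

locale ring_with_equalizers = ring_in V R
  for V :: "('o, 'a) ccc" (structure) and R :: "('o, 'a) rig" +
  assumes equalizers: "has_equalizers V"
begin

lemma ring_stageI: "W \<in> Ob V \<Longrightarrow> ring_stage V R W"
  by unfold_locales

lemma row_sums_hom: "row_sums V R n m \<in> hom V (mat n m) (vec m)"
  and all_ones_hom: "all_ones V R n m \<in> hom V (mat n m) (vec m)"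
  and equalized_iff: "u \<in> hom V W (mat n m) \<Longrightarrow>
    row_sums V R n m \<cdot> u = all_ones V R n m \<cdot> u \<longleftrightarrow>
    (\<forall>j<m. rsum W n (ent n m u j) = rone V R W)"
proof -
  let ?A = "mat n m"
  let ?e = "ent n m (Ide V ?A)"
  have I: "Ide V ?A \<in> hom V ?A ?A" by (simp add: hom_def)
  have s: "rsum ?A n (?e j) \<in> el ?A" if "j < m" for j
    using entry_hom[OF I that] by (intro radd_upto_hom) simp_all
  have o: "rone V R ?A \<in> el ?A" by (simp add: rone_hom)
  have rs: "row_sums V R n m = tuple V ?A (Car R) m (\<lambda>j. rsum ?A n (?e j))"
    and ao: "all_ones V R n m = tuple V ?A (Car R) m (\<lambda>j. rone V R ?A)"
    by (simp_all add: row_sums_def all_ones_def Let_def)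
  show RS: "row_sums V R n m \<in> hom V ?A (vec m)" and AO: "all_ones V R n m \<in> hom V ?A (vec m)"
    unfolding rs ao using s o by (simp_all add: hom_def)
  assume u: "u \<in> hom V W ?A"
  have W: "W \<in> Ob V" using u by (auto simp: hom_def)
  have "pr m j \<cdot> (row_sums V R n m \<cdot> u) = rsum W n (ent n m u j)"
    if j: "j < m" for j
  proof -
    have "pr m j \<cdot> (row_sums V R n m \<cdot> u) = (pr m j \<cdot> row_sums V R n m) \<cdot> u"
      using RS u j by (simp add: hom_def)
    also have "pr m j \<cdot> row_sums V R n m = rsum ?A n (?e j)"
      unfolding rs using s j by simp
    also have "\<dots> \<cdot> u = rsum W n (\<lambda>i. ?e j i \<cdot> u)"
      using entry_hom[OF I j] by (intro radd_upto_comp[OF u]) simp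
    also have "\<dots> = rsum W n (ent n m u j)"
      using entry_comp[OF I j _ u] u by (intro radd_upto_cong) (simp add: hom_def)
    finally show ?thesis .
  qed
  moreover have "pr m j \<cdot> (all_ones V R n m \<cdot> u) = rone V R W" if j: "j < m" for j
  proof -
    have "pr m j \<cdot> (all_ones V R n m \<cdot> u) = (pr m j \<cdot> all_ones V R n m) \<cdot> u"
      using AO u j by (simp add: hom_def)
    also have "pr m j \<cdot> all_ones V R n m = rone V R ?A"
      unfolding ao using o j by simp
    finally show ?thesis using rone_comp[OF u] by simp
  qed
  ultimately show "row_sums V R n m \<cdot> u = all_ones V R n m \<cdot> u \<longleftrightarrow>
      (\<forall>j<m. rsum W n (ent n m u j) = rone V R W)"
    using Pow_eqI[OF Comp_hom[OF u RS] Comp_hom[OF u AO]] by fastforce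
qed

abbreviation aff :: "nat \<Rightarrow> nat \<Rightarrow> 'a" where
  "aff n m \<equiv> aff_incl V R n m"

abbreviation affmat :: "nat \<Rightarrow> nat \<Rightarrow> 'o" where
  "affmat n m \<equiv> Dom V (aff n m)"

lemma aff_equalizer: "is_equalizer V (row_sums V R n m) (all_ones V R n m) (aff n m)"
proof -
  have "\<exists>e. is_equalizer V (row_sums V R n m) (all_ones V R n m) e"
    using equalizers row_sums_hom all_ones_hom unfolding has_equalizers_def by blast
  then show ?thesis unfolding aff_incl_def by (rule someI_ex)
qed

lemma aff_hom: "aff n m \<in> hom V (affmat n m) (mat n m)"
  using aff_equalizer row_sums_hom by (auto simp: is_equalizer_def hom_def)

lemma aff_simps [simp]: "aff n m \<in> Arr V" "Cod V (aff n m) = mat n m"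
  using aff_hom[of n m] by (simp_all add: hom_def)

lemma aff_mono: "is_mono V (aff n m)"
  by (rule equalizer_mono[OF row_sums_hom all_ones_hom aff_equalizer])

lemma aff_row_sum:
  assumes k: "k \<in> hom V W (affmat n m)" and j: "j < m"
  shows "rsum W n (ent n m (aff n m \<cdot> k) j) = rone V R W"
proof -
  have eq: "row_sums V R n m \<cdot> aff n m = all_ones V R n m \<cdot> aff n m"
    using aff_equalizer by (simp add: is_equalizer_def)
  have "row_sums V R n m \<cdot> (aff n m \<cdot> k) = all_ones V R n m \<cdot> (aff n m \<cdot> k)"
    by (simp only: Comp_assoc[OF k aff_hom row_sums_hom, symmetric]
        Comp_assoc[OF k aff_hom all_ones_hom, symmetric] eq)
  then show ?thesis using equalized_iff[OF Comp_hom[OF k aff_hom]] j by simp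
qed

lemma aff_factor:
  assumes u: "u \<in> hom V W (mat n m)"
    and sums: "\<And>j. j < m \<Longrightarrow> rsum W n (ent n m u j) = rone V R W"
  shows "factor V (aff n m) u \<in> hom V W (affmat n m)" "aff n m \<cdot> factor V (aff n m) u = u"
proof -
  have "row_sums V R n m \<cdot> u = all_ones V R n m \<cdot> u"
    using equalized_iff[OF u] sums by simp
  moreover have "Cod V u = Dom V (row_sums V R n m)"
    by (simp only: hom_Cod[OF u] hom_Dom[OF row_sums_hom])
  moreover have "\<forall>h\<in>Arr V. Cod V h = Dom V (row_sums V R n m) \<and>
      row_sums V R n m \<cdot> h = all_ones V R n m \<cdot> h \<longrightarrow>
      (\<exists>!k. k \<in> hom V (Dom V h) (affmat n m) \<and> aff n m \<cdot> k = h)"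
    using aff_equalizer unfolding is_equalizer_def by blast
  ultimately have "\<exists>!k. k \<in> hom V (Dom V u) (affmat n m) \<and> aff n m \<cdot> k = u"
    using hom_Arr[OF u] by blast
  then have "factor V (aff n m) u \<in> hom V (Dom V u) (affmat n m) \<and> aff n m \<cdot> factor V (aff n m) u = u"
    unfolding factor_def by (rule theI')
  then show "factor V (aff n m) u \<in> hom V W (affmat n m)" "aff n m \<cdot> factor V (aff n m) u = u"
    using u by (simp_all add: hom_def)
qed

lemma Mat_aff_simps [simp]:
  "vOb (Mat_aff V R) = UNIV" "vHom (Mat_aff V R) n m = affmat n m"
  "vComp (Mat_aff V R) n m l = factor V (aff n l) (vcomp V (Mat V R) n m l
     (aff m l \<cdot> Fst V (affmat m l) (affmat n m)) (aff n m \<cdot> Snd V (affmat m l) (affmat n m)))"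
  "vId (Mat_aff V R) n = factor V (aff n n) (vId (Mat V R) n)"
  "tProj (Mat_aff V R) n i = factor V (aff n 1) (tProj (Mat V R) n i)"
  by (simp_all add: Mat_aff_def Let_def)

lemma Mat_op_star_simps [simp]:
  "vOb (Mat_op_star V R) = UNIV" "vHom (Mat_op_star V R) n m = mat (Suc n) m"
  by (simp_all add: Mat_op_star_def)

lemma aff_act_hom: "aff_act n m \<in> hom V (affmat n m) (Exp V (vec n) (vec m))"
  unfolding Mat_aff_act_def by (rule Comp_hom[OF aff_hom Mat_act_hom])

lemma aff_act_assoc: "k \<in> hom V W (affmat n m) \<Longrightarrow>
    aff_act n m \<cdot> k = mat_act n m \<cdot> (aff n m \<cdot> k)"
  unfolding Mat_aff_act_def by (rule Comp_assoc[OF _ aff_hom Mat_act_hom])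

interpretation aff: operations_on V "Car R" "Mat_aff V R" "aff_act"
  by unfold_locales (simp_all add: aff_act_hom)

interpretation star: operations_on V "Car R" "Mat_op_star V R" "star_act"
  by unfold_locales (simp_all add: star_act_hom)

section \<open>Affine and pointed-module operations commute\<close>

text \<open>
  Commutation is a symmetric relation, so this one equation, with the matrix \<open>x\<close> or its transpose,
  shows that each theory lies in the commutant of the other.
\<close>

lemma affine_pointed_commute:
  assumes k: "k \<in> hom V U (affmat n m)" and u: "u \<in> hom V U (mat (Suc b) l)"
    and x: "\<forall>a<n. \<forall>i<b. x a i \<in> el U" and j: "j < m" and q: "q < l"
  shows "pr l q \<cdot> mval b l (star_act b l \<cdot> u) (tup U b
      (\<lambda>i. pr m j \<cdot> mval n m (aff_act n m \<cdot> k) (tup U n (\<lambda>a. x a i)))) =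
    pr m j \<cdot> mval n m (aff_act n m \<cdot> k) (tup U n
      (\<lambda>a. pr l q \<cdot> mval b l (star_act b l \<cdot> u) (tup U b (x a))))"
proof -
  have U: "U \<in> Ob V" using k by (auto simp: hom_def)
  interpret S: rig_stage V R U by (rule rig_stageI[OF U])
  let ?c = "ent n m (aff n m \<cdot> k) j" and ?u = "ent (Suc b) l u q"
  let ?F = "\<lambda>y. pr m j \<cdot> mval n m (aff_act n m \<cdot> k) y"
  let ?G = "\<lambda>y. pr l q \<cdot> mval b l (star_act b l \<cdot> u) y"
  have c: "?c a \<in> el U" if "a < n" for a
    by (rule entry_hom[OF Comp_hom[OF k aff_hom] j that])
  have uu: "?u i \<in> el U" if "i < Suc b" for i
    by (rule entry_hom[OF u q that])
  have F: "?F (tup U n z) = rsum U n (\<lambda>a. ?c a \<odot> z a)"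
    if z: "\<forall>a<n. z a \<in> el U" for z
  proof -
    have "tup U n z \<in> hom V U (vec n)" using z U by (simp add: homI)
    then have "?F (tup U n z) =
        rsum U n (\<lambda>a. ?c a \<odot> (pr n a \<cdot> tup U n z))"
      using Mat_act_value[OF Comp_hom[OF k aff_hom] _ j] by (simp only: aff_act_assoc[OF k])
    also have "\<dots> = rsum U n (\<lambda>a. ?c a \<odot> z a)"
      using z U by (intro radd_upto_cong) simp
    finally show ?thesis .
  qed
  have G: "?G (tup U b z) =
      ?u 0 \<oplus> rsum U b (\<lambda>i. z i \<odot> ?u (Suc i))"
    if z: "\<forall>i<b. z i \<in> el U" for z
  proof -
    have "tup U b z \<in> hom V U (vec b)" using z U by (simp add: homI)
    then have "?G (tup U b z) = ?u 0 \<oplus> rsum U b (\<lambda>i. (pr b i \<cdot> tup U b z) \<odot> ?u (Suc i))"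
      by (rule star_act_value[OF u _ q])
    also have "rsum U b (\<lambda>i. (pr b i \<cdot> tup U b z) \<odot> ?u (Suc i)) =
        rsum U b (\<lambda>i. z i \<odot> ?u (Suc i))"
      using z U by (intro radd_upto_cong) simp
    finally show ?thesis .
  qed
  have Fcol: "?F (tup U n (\<lambda>a. x a i)) = rsum U n (\<lambda>a. ?c a \<odot> x a i)"
    if "i < b" for i using x that by (intro F) simp
  have Grow: "?G (tup U b (x a)) =
      ?u 0 \<oplus> rsum U b (\<lambda>i. x a i \<odot> ?u (Suc i))"
    if "a < n" for a using x that by (intro G) simp
  have "?G (tup U b (\<lambda>i. ?F (tup U n (\<lambda>a. x a i)))) =
      ?G (tup U b (\<lambda>i. rsum U n (\<lambda>a. ?c a \<odot> x a i)))"
    using Fcol by (simp only: cong: tuple_cong)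
  also have "\<dots> = ?u 0 \<oplus> rsum U b (\<lambda>i. rsum U n (\<lambda>a. ?c a \<odot> x a i) \<odot> ?u (Suc i))"
    using c x by (intro G) simp
  also have "\<dots> = rsum U n (\<lambda>a. ?c a \<odot> (?u 0 \<oplus> rsum U b (\<lambda>i. x a i \<odot> ?u (Suc i))))"
    using c uu x aff_row_sum[OF k j] by (intro S.affine_pointed_interchange[symmetric]) simp_all
  also have "\<dots> = ?F (tup U n
      (\<lambda>a. ?u 0 \<oplus> rsum U b (\<lambda>i. x a i \<odot> ?u (Suc i))))"
    using uu x by (intro F[symmetric]) simp
  also have "\<dots> = ?F (tup U n (\<lambda>a. ?G (tup U b (x a))))"
    using Grow by (simp only: cong: tuple_cong)
  finally show ?thesis .
qed

lemma affine_commutes: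
  assumes k: "k \<in> hom V W (affmat n m)"
  shows "star.commutes n m (aff_act n m \<cdot> k)"
  unfolding star.commutes_def
proof (intro allI impI)
  fix U t b l h x j q
  assume "t \<in> hom V U (Dom V (aff_act n m \<cdot> k))"
    and "h \<in> hom V U (vHom (Mat_op_star V R) b l)"
    and x: "\<forall>a<n. \<forall>i<b. x a i \<in> el U" and jq: "j < m" "q < l"
  then have t: "t \<in> hom V U W" and h: "h \<in> hom V U (mat (Suc b) l)"
    using hom_Dom[OF Comp_hom[OF k aff_act_hom]] by simp_all
  show "pr l q \<cdot> mval b l (star_act b l \<cdot> h) (tup U b (\<lambda>i.
        pr m j \<cdot> mval n m ((aff_act n m \<cdot> k) \<cdot> t) (tup U n (\<lambda>a. x a i)))) =
      pr m j \<cdot> mval n m ((aff_act n m \<cdot> k) \<cdot> t) (tup U n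
        (\<lambda>a. pr l q \<cdot> mval b l (star_act b l \<cdot> h) (tup U b (x a))))"
    unfolding Comp_assoc[OF t k aff_act_hom]
    by (rule affine_pointed_commute[OF Comp_hom[OF t k] h x jq])
qed

lemma pointed_commutes:
  assumes u: "u \<in> hom V W (mat (Suc n) m)"
  shows "aff.commutes n m (star_act n m \<cdot> u)"
  unfolding aff.commutes_def
proof (intro allI impI)
  fix U t b l h x j q
  assume "t \<in> hom V U (Dom V (star_act n m \<cdot> u))"
    and "h \<in> hom V U (vHom (Mat_aff V R) b l)"
    and x: "\<forall>a<n. \<forall>i<b. x a i \<in> el U" and j: "j < m" and q: "q < l"
  then have t: "t \<in> hom V U W" and h: "h \<in> hom V U (affmat b l)"
    using hom_Dom[OF Comp_hom[OF u star_act_hom]] by simp_all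
  have x': "\<forall>i<b. \<forall>a<n. x a i \<in> el U" using x by blast
  show "pr l q \<cdot> mval b l (aff_act b l \<cdot> h) (tup U b (\<lambda>i.
        pr m j \<cdot> mval n m ((star_act n m \<cdot> u) \<cdot> t) (tup U n (\<lambda>a. x a i)))) =
      pr m j \<cdot> mval n m ((star_act n m \<cdot> u) \<cdot> t) (tup U n
        (\<lambda>a. pr l q \<cdot> mval b l (aff_act b l \<cdot> h) (tup U b (x a))))"
    unfolding Comp_assoc[OF t u star_act_hom]
    by (rule affine_pointed_commute[OF h Comp_hom[OF t u] x' q j, symmetric])
qed

lemma aff_act_mono: "is_mono V (aff_act n m)"
  unfolding Mat_aff_act_def by (rule mono_comp[OF Mat_act_mono aff_mono]) simp

text \<open>
  The value at the origin is the constant term. The value at the \<open>a\<close>-th basis vector is its sum with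
  the \<open>a\<close>-th coefficient, from which the coefficient is recovered by subtraction.
\<close>

lemma star_act_mono: "is_mono V (star_act n m)"
  unfolding is_mono_def
proof (intro conjI allI ballI impI)
  show "star_act n m \<in> Arr V" by simp
  fix W f g
  assume "f \<in> hom V W (Dom V (star_act n m))" "g \<in> hom V W (Dom V (star_act n m))"
  then have f: "f \<in> hom V W (mat (Suc n) m)" and g: "g \<in> hom V W (mat (Suc n) m)" by simp_all
  assume eq: "star_act n m \<cdot> f = star_act n m \<cdot> g"
  have W: "W \<in> Ob V" using f by (auto simp: hom_def)
  interpret S: ring_stage V R W by (rule ring_stageI[OF W])
  show "f = g"
  proof (rule mat_eqI[OF f g])
    fix j i assume j: "j < m" and i: "i < Suc n"
    have zero: "ent (Suc n) m f j 0 = ent (Suc n) m g j 0"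
      using star_act_zero[OF f j] star_act_zero[OF g j] by (simp add: eq)
    show "ent (Suc n) m f j i = ent (Suc n) m g j i"
    proof (cases i)
      case 0
      then show ?thesis using zero by simp
    next
      case (Suc a)
      then have a: "a < n" using i by simp
      have "ent (Suc n) m f j 0 \<oplus> ent (Suc n) m f j (Suc a) =
          ent (Suc n) m f j 0 \<oplus> ent (Suc n) m g j (Suc a)"
        using star_act_basis[OF f j a] star_act_basis[OF g j a] by (simp add: eq zero)
      then show ?thesis
        unfolding Suc using a
        by (intro S.left_cancel[OF entry_hom[OF f j] entry_hom[OF f j] entry_hom[OF g j]]) simp_all
    qed
  qed
qed

section \<open>Arrows that commute with all operations\<close>

text \<open>
  Commutation with the single operation that has coefficients \<open>u0\<close> and \<open>u\<close>.
\<close>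

lemma star_commutes_apply:
  assumes f: "f \<in> hom V W (Exp V (vec n) (vec m))" and comm: "star.commutes n m f"
    and t: "t \<in> hom V U W" and u0: "u0 \<in> el U" and u: "\<forall>i<b. u i \<in> el U"
    and x: "\<forall>a<n. \<forall>i<b. x a i \<in> el U" and j: "j < m"
  shows "u0 \<oplus> rsum U b (\<lambda>i. (pr m j \<cdot> mval n m (f \<cdot> t) (tup U n (\<lambda>a. x a i))) \<odot> u i) =
    pr m j \<cdot> mval n m (f \<cdot> t)
      (tup U n (\<lambda>a. u0 \<oplus> rsum U b (\<lambda>i. x a i \<odot> u i)))"
proof -
  have U: "U \<in> Ob V" using t by (auto simp: hom_def)
  let ?F = "\<lambda>y. pr m j \<cdot> mval n m (f \<cdot> t) y"
  define h where "h = mat_of V R U (Suc b) 1 (\<lambda>_ i. if i = 0 then u0 else u (i - 1))"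
  have c: "(if i = 0 then u0 else u (i - 1)) \<in> el U" if "i < Suc b" for i
    using u0 u that by (cases i) simp_all
  have h: "h \<in> hom V U (mat (Suc b) 1)"
    unfolding h_def using U c by (intro mat_of_hom) simp_all
  have e: "ent (Suc b) 1 h 0 i = (if i = 0 then u0 else u (i - 1))" if "i < Suc b" for i
    unfolding h_def using U c that by (intro entry_mat_of) simp_all
  have h_val: "pr 1 0 \<cdot> mval b 1 (star_act b 1 \<cdot> h) (tup U b z) =
      u0 \<oplus> rsum U b (\<lambda>i. z i \<odot> u i)"
    if "\<forall>i<b. z i \<in> el U" for z
  proof -
    have z: "tup U b z \<in> hom V U (vec b)" using U that by (simp add: homI)
    have "rsum U b (\<lambda>i. (pr b i \<cdot> tup U b z) \<odot> ent (Suc b) 1 h 0 (Suc i)) = rsum U b (\<lambda>i. z i \<odot> u i)"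
      using U that e by (intro radd_upto_cong) simp
    then show ?thesis using star_act_value[OF h z zero_less_one] e[of 0] by simp
  qed
  have F: "?F y \<in> el U" if "y \<in> hom V U (vec n)" for y
    using f t that j by (simp add: hom_def)
  have col: "tup U n (\<lambda>a. x a i) \<in> hom V U (vec n)" if "i < b" for i
    using x U that by (simp add: homI)
  have t': "t \<in> hom V U (Dom V f)" using t f by (simp add: hom_def)
  have h': "h \<in> hom V U (vHom (Mat_op_star V R) b 1)" using h by simp
  have "pr 1 0 \<cdot> mval b 1 (star_act b 1 \<cdot> h)
        (tup U b (\<lambda>i. ?F (tup U n (\<lambda>a. x a i)))) =
      ?F (tup U n (\<lambda>a. pr 1 0 \<cdot> mval b 1 (star_act b 1 \<cdot> h) (tup U b (x a))))"
    using comm t' h' x j zero_less_one unfolding star.commutes_def by blast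
  moreover have "tup U n (\<lambda>a. pr 1 0 \<cdot> mval b 1 (star_act b 1 \<cdot> h) (tup U b (x a))) =
      tup U n (\<lambda>a. u0 \<oplus> rsum U b (\<lambda>i. x a i \<odot> u i))"
    using h_val x by (intro tuple_cong) simp
  moreover have "pr 1 0 \<cdot> mval b 1 (star_act b 1 \<cdot> h)
        (tup U b (\<lambda>i. ?F (tup U n (\<lambda>a. x a i)))) =
      u0 \<oplus> rsum U b (\<lambda>i. ?F (tup U n (\<lambda>a. x a i)) \<odot> u i)"
    using F[OF col] by (intro h_val) simp
  ultimately show ?thesis by simp
qed

text \<open>
  Commutation with the single affine combination that has coefficients \<open>h\<close>.
\<close>

lemma aff_commutes_apply:
  assumes f: "f \<in> hom V W (Exp V (vec n) (vec m))" and comm: "aff.commutes n m f"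
    and t: "t \<in> hom V U W" and h: "\<forall>i<b. h i \<in> el U" "rsum U b h = rone V R U"
    and x: "\<forall>a<n. \<forall>i<b. x a i \<in> el U" and j: "j < m"
  shows "rsum U b (\<lambda>i. h i \<odot> (pr m j \<cdot> mval n m (f \<cdot> t) (tup U n (\<lambda>a. x a i)))) =
    pr m j \<cdot> mval n m (f \<cdot> t)
      (tup U n (\<lambda>a. rsum U b (\<lambda>i. h i \<odot> x a i)))"
proof -
  have U: "U \<in> Ob V" using t by (auto simp: hom_def)
  let ?F = "\<lambda>y. pr m j \<cdot> mval n m (f \<cdot> t) y"
  define M where "M = mat_of V R U b 1 (\<lambda>_ i. h i)"
  have M: "M \<in> hom V U (mat b 1)"
    unfolding M_def using U h by (intro mat_of_hom) simp_all
  have e: "ent b 1 M r i = h i" if "r < 1" "i < b" for r i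
    unfolding M_def using U h that by (intro entry_mat_of) simp_all
  have "rsum U b (ent b 1 M r) = rone V R U" if "r < 1" for r
    using e[OF that] h(2) radd_upto_cong[of b "ent b 1 M r" h V R U] by simp
  note k = aff_factor[OF M this]
  let ?k = "factor V (aff b 1) M"
  have k_val: "pr 1 0 \<cdot> mval b 1 (aff_act b 1 \<cdot> ?k) (tup U b z) =
      rsum U b (\<lambda>i. h i \<odot> z i)" if "\<forall>i<b. z i \<in> el U" for z
  proof -
    have z: "tup U b z \<in> hom V U (vec b)" using U that by (simp add: homI)
    have "rsum U b (\<lambda>i. ent b 1 M 0 i \<odot> (pr b i \<cdot> tup U b z)) =
        rsum U b (\<lambda>i. h i \<odot> z i)"
      using U that e by (intro radd_upto_cong) simp
    then show ?thesis
      using Mat_act_value[OF M z zero_less_one] by (simp only: aff_act_assoc[OF k(1)] k(2))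
  qed
  have F: "?F y \<in> el U" if "y \<in> hom V U (vec n)" for y
    using f t that j by (simp add: hom_def)
  have col: "tup U n (\<lambda>a. x a i) \<in> hom V U (vec n)" if "i < b" for i
    using x U that by (simp add: homI)
  have t': "t \<in> hom V U (Dom V f)" using t f by (simp add: hom_def)
  have k': "?k \<in> hom V U (vHom (Mat_aff V R) b 1)" using k(1) by simp
  have "pr 1 0 \<cdot> mval b 1 (aff_act b 1 \<cdot> ?k)
        (tup U b (\<lambda>i. ?F (tup U n (\<lambda>a. x a i)))) =
      ?F (tup U n (\<lambda>a. pr 1 0 \<cdot> mval b 1 (aff_act b 1 \<cdot> ?k) (tup U b (x a))))"
    using comm t' k' x j zero_less_one unfolding aff.commutes_def by blast
  moreover have "tup U n (\<lambda>a. pr 1 0 \<cdot> mval b 1 (aff_act b 1 \<cdot> ?k) (tup U b (x a))) =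
      tup U n (\<lambda>a. rsum U b (\<lambda>i. h i \<odot> x a i))"
    using k_val x by (intro tuple_cong) simp
  moreover have "pr 1 0 \<cdot> mval b 1 (aff_act b 1 \<cdot> ?k)
        (tup U b (\<lambda>i. ?F (tup U n (\<lambda>a. x a i)))) =
      rsum U b (\<lambda>i. h i \<odot> ?F (tup U n (\<lambda>a. x a i)))"
    using F[OF col] by (intro k_val) simp
  ultimately show ?thesis by simp
qed

lemma val_comp:
  assumes "f \<in> hom V W (Exp V (vec n) (vec m))" "t \<in> hom V U W" "x \<in> hom V W (vec n)" "j < m"
  shows "(pr m j \<cdot> mval n m f x) \<cdot> t = pr m j \<cdot> mval n m (f \<cdot> t) (x \<cdot> t)"
  using assms by (simp add: hom_def)

text \<open>
  Applied to the \<open>a\<close>-th row of the identity matrix, the operation with \<open>u0 = 0\<close> and coefficients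
  \<open>y i\<close> returns \<open>y a\<close>. Commutation therefore expresses \<open>f\<close> through its values at the basis vectors, which are the
  columns of a matrix; its rows sum to \<open>1\<close> because \<open>f\<close> fixes the constant \<open>1\<close>.
\<close>

lemma star_commutes_factors:
  assumes f: "f \<in> hom V W (Exp V (vec n) (vec m))" and comm: "star.commutes n m f"
  shows "factors_through V f (aff_act n m)"
proof -
  have W: "W \<in> Ob V" using f by (auto simp: hom_def)
  have linear: "pr m j \<cdot> mval n m (f \<cdot> t) y =
      rsum U n (\<lambda>i. (pr m j \<cdot> mval n m (f \<cdot> t) (basis U n i)) \<odot> (pr n i \<cdot> y))"
    if t: "t \<in> hom V U W" and y: "y \<in> hom V U (vec n)" and j: "j < m" for U t y j
  proof -
    have U: "U \<in> Ob V" using t by (auto simp: hom_def)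
    interpret S: rig_stage V R U by (rule rig_stageI[OF U])
    let ?x = "\<lambda>a i. if a = i then rone V R U else rzero V R U"
    let ?F = "\<lambda>y. pr m j \<cdot> mval n m (f \<cdot> t) y"
    have F: "?F z \<in> el U" if "z \<in> hom V U (vec n)" for z
      using f t that j by (simp add: hom_def)
    have "rzero V R U \<oplus> rsum U n (\<lambda>i. ?F (tup U n (\<lambda>a. ?x a i)) \<odot> (pr n i \<cdot> y)) =
      ?F (tup U n (\<lambda>a. rzero V R U \<oplus> rsum U n (\<lambda>i. ?x a i \<odot> (pr n i \<cdot> y))))"
      using Proj_hom[OF y] by (intro star_commutes_apply[OF f comm t _ _ _ j]) simp_all
    moreover have "tup U n (\<lambda>a. rzero V R U \<oplus> rsum U n (\<lambda>i. ?x a i \<odot> (pr n i \<cdot> y))) =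
      tup U n (\<lambda>a. pr n a \<cdot> y)"
    proof (rule tuple_cong)
      fix a assume a: "a < n"
      have "rsum U n (\<lambda>i. ?x a i \<odot> (pr n i \<cdot> y)) =
          ?x a a \<odot> (pr n a \<cdot> y)"
        using a Proj_hom[OF y] by (intro S.sum_single) simp_all
      then show "rzero V R U \<oplus> rsum U n (\<lambda>i. ?x a i \<odot> (pr n i \<cdot> y)) =
          pr n a \<cdot> y"
        using Proj_hom[OF y a] by simp
    qed
    moreover have "rsum U n (\<lambda>i. ?F (basis U n i) \<odot> (pr n i \<cdot> y)) \<in> el U"
      using F[OF basis_hom[OF U]] Proj_hom[OF y] by simp
    ultimately show ?thesis using y by (simp add: basis_def)
  qed
  let ?a = "\<lambda>j i. pr m j \<cdot> mval n m f (basis W n i)"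
  define A where "A = mat_of V R W n m ?a"
  have a: "?a j i \<in> el W" if "j < m" for j i
    using f basis_hom[OF W, of n i] that by (simp add: hom_def)
  have A: "A \<in> hom V W (mat n m)" unfolding A_def using W a by (intro mat_of_hom) simp_all
  have A_entry: "ent n m A j i = ?a j i" if "j < m" "i < n" for j i
    unfolding A_def using W a that by (intro entry_mat_of) simp_all
  have sums: "rsum W n (ent n m A j) = rone V R W" if j: "j < m" for j
  proof -
    interpret S: rig_stage V R W by (rule rig_stageI[OF W])
    let ?ones = "tup W n (\<lambda>a. rone V R W)"
    have 1: "Ide V W \<in> hom V W W" using W by (simp add: hom_def)
    have ones: "?ones \<in> hom V W (vec n)" using W S.closed(4) by (simp add: homI)
    have f1: "f \<cdot> Ide V W = f" using f by (simp add: hom_def)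
    have "rsum W n (ent n m A j) =
        rsum W n (\<lambda>i. ?a j i \<odot> (pr n i \<cdot> ?ones))"
      using A_entry[OF j] a[OF j] W S.closed(4) by (intro radd_upto_cong) simp
    also have "\<dots> = pr m j \<cdot> mval n m f ?ones"
      using linear[OF 1 ones j] by (simp only: f1)
    \<comment> \<open>Invariance of the constant 1, which is a pointed-module operation of arity 0.\<close>
    also have "\<dots> = rone V R W"
      using star_commutes_apply[OF f comm 1, of "rone V R W" 0 "\<lambda>_. rone V R W" "\<lambda>_ _. rone V R W" j] j
      by (simp add: f1)
    finally show ?thesis .
  qed
  note k = aff_factor[OF A sums]
  let ?k = "factor V (aff n m) A"
  have "aff_act n m \<cdot> ?k = f"
  proof (rule vec_Exp_eqI[OF Comp_hom[OF k(1) aff_act_hom] f])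
    fix U t y j assume t: "t \<in> hom V U W" and y: "y \<in> hom V U (vec n)" and j: "j < m"
    have "(aff_act n m \<cdot> ?k) \<cdot> t = mat_act n m \<cdot> (A \<cdot> t)"
      by (simp only: aff_act_assoc[OF k(1)] k(2) Comp_assoc[OF t A Mat_act_hom])
    then have "pr m j \<cdot> mval n m ((aff_act n m \<cdot> ?k) \<cdot> t) y =
        rsum U n (\<lambda>i. ent n m (A \<cdot> t) j i \<odot> (pr n i \<cdot> y))"
      using Mat_act_value[OF Comp_hom[OF t A] y j] by simp
    also have "\<dots> = rsum U n (\<lambda>i. (pr m j \<cdot> mval n m (f \<cdot> t) (basis U n i)) \<odot> (pr n i \<cdot> y))"
    proof (rule radd_upto_cong)
      fix i assume i: "i < n"
      have "ent n m (A \<cdot> t) j i = ?a j i \<cdot> t"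
        by (simp only: entry_comp[OF A j i t, symmetric] A_entry[OF j i])
      also have "\<dots> = pr m j \<cdot> mval n m (f \<cdot> t) (basis U n i)"
        by (simp only: val_comp[OF f t basis_hom[OF W] j] basis_comp[OF t])
      finally show "ent n m (A \<cdot> t) j i \<odot> (pr n i \<cdot> y) =
          (pr m j \<cdot> mval n m (f \<cdot> t) (basis U n i)) \<odot> (pr n i \<cdot> y)"
        by simp
    qed
    also have "\<dots> = pr m j \<cdot> mval n m (f \<cdot> t) y"
      by (rule linear[OF t y j, symmetric])
    finally show "pr m j \<cdot> mval n m ((aff_act n m \<cdot> ?k) \<cdot> t) y =
        pr m j \<cdot> mval n m (f \<cdot> t) y" .
  qed
  then show ?thesis
    using k(1) hom_Dom[OF f] hom_Dom[OF aff_act_hom] by (auto simp: factors_through_def)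
qed

text \<open>
  The vector \<open>y\<close> is the affine combination of the basis vectors and the origin with weights \<open>y i\<close> and
  \<open>s = 1 - \<Sum>\<^sub>i y i\<close>. Commutation with this combination of \<open>n + 1\<close> points determines \<open>f\<close> by its values
  there; the coefficients \<open>d j i\<close> are the differences \<open>f(e\<^sub>i) - f(0)\<close>.
\<close>

lemma aff_commutes_factors:
  assumes f: "f \<in> hom V W (Exp V (vec n) (vec m))" and comm: "aff.commutes n m f"
  shows "factors_through V f (star_act n m)"
proof -
  have W: "W \<in> Ob V" using f by (auto simp: hom_def)
  interpret SW: ring_stage V R W by (rule ring_stageI[OF W])
  let ?a = "\<lambda>j i. pr m j \<cdot> mval n m f (basis W n i)"
  have a: "?a j i \<in> el W" if "j < m" for j i
    using f basis_hom[OF W, of n i] that by (simp add: hom_def)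
  have "\<forall>j i. \<exists>d. j < m \<longrightarrow> d \<in> el W \<and> (d \<oplus> ?a j n) = ?a j i"
    using SW.subtraction a by blast
  then obtain d where d: "\<And>j i. j < m \<Longrightarrow> d j i \<in> el W"
      "\<And>j i. j < m \<Longrightarrow> (d j i \<oplus> ?a j n) = ?a j i" by metis
  let ?c = "\<lambda>j i. if i = 0 then ?a j n else d j (i - 1)"
  define B where "B = mat_of V R W (Suc n) m ?c"
  have c: "?c j i \<in> el W" if "j < m" for j i
    using a d(1) that by simp
  have B: "B \<in> hom V W (mat (Suc n) m)" unfolding B_def using W c by (intro mat_of_hom) simp_all
  have B_entry: "ent (Suc n) m B j i = ?c j i" if "j < m" "i < Suc n" for j i
    unfolding B_def using W c that by (intro entry_mat_of) simp_all
  have "star_act n m \<cdot> B = f"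
  proof (rule vec_Exp_eqI[OF Comp_hom[OF B star_act_hom] f])
    fix U t y j assume t: "t \<in> hom V U W" and y: "y \<in> hom V U (vec n)" and j: "j < m"
    have U: "U \<in> Ob V" using t by (auto simp: hom_def)
    interpret S: ring_stage V R U by (rule ring_stageI[OF U])
    let ?F = "\<lambda>y. pr m j \<cdot> mval n m (f \<cdot> t) y"
    let ?y = "\<lambda>i. pr n i \<cdot> y"
    have F: "?F z \<in> el U" if "z \<in> hom V U (vec n)" for z
      using f t that j by (simp add: hom_def)
    note Fb = F[OF basis_hom[OF U]]
    have yh: "?y i \<in> el U" if "i < n" for i by (rule Proj_hom[OF y that])
    then have ysum: "rsum U n ?y \<in> el U" by simp
    obtain s where s: "s \<in> el U" "s \<oplus> rsum U n ?y = rone V R U"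
      using S.subtraction[OF S.closed(4) ysum] by blast
    have at: "?a j i \<cdot> t = ?F (basis U n i)" for i
      by (simp only: val_comp[OF f t basis_hom[OF W] j] basis_comp[OF t])
    have dt: "d j i \<cdot> t \<in> el U" for i by (rule Comp_hom[OF t d(1)[OF j]])
    have dF: "(d j i \<cdot> t) \<oplus> ?F (basis U n n) = ?F (basis U n i)" for i
    proof -
      have "(d j i \<cdot> t) \<oplus> (?a j n \<cdot> t) = ?a j i \<cdot> t"
        by (simp only: radd_comp[OF d(1)[OF j] a[OF j] t, symmetric] d(2)[OF j])
      then show ?thesis by (simp only: at)
    qed
    \<comment> \<open>Column \<open>n\<close> of the \<open>n \<times> (n + 1)\<close> matrix \<open>?x\<close> is zero: the last point is the origin, with weight \<open>s\<close>.\<close>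
    let ?h = "\<lambda>i. if i < n then ?y i else s"
    let ?x = "\<lambda>a i. if a = i then rone V R U else rzero V R U"
    have h_lt: "rsum U n (\<lambda>i. G (?h i) i) = rsum U n (\<lambda>i. G (?y i) i)" for G
      by (rule radd_upto_cong) simp
    have h_sum: "rsum U (Suc n) ?h = rone V R U"
      using h_lt[of "\<lambda>z i. z"] s ysum S.commute[OF s(1) ysum] by simp
    have aff_eq: "rsum U (Suc n) (\<lambda>i. ?h i \<odot> ?F (tup U n (\<lambda>a. ?x a i))) =
        ?F (tup U n (\<lambda>a. rsum U (Suc n) (\<lambda>i. ?h i \<odot> ?x a i)))"
      using yh s(1) h_sum by (intro aff_commutes_apply[OF f comm t _ _ _ j]) simp_all
    have "tup U n (\<lambda>a. rsum U (Suc n) (\<lambda>i. ?h i \<odot> ?x a i)) =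
        tup U n ?y"
    proof (rule tuple_cong)
      fix a assume a: "a < n"
      have "rsum U (Suc n) (\<lambda>i. ?h i \<odot> ?x a i) = ?h a \<odot> ?x a a"
        using a yh s(1) by (intro S.sum_single) (simp_all add: less_Suc_eq)
      then show "rsum U (Suc n) (\<lambda>i. ?h i \<odot> ?x a i) = ?y a"
        using a yh by simp
    qed
    then have "?F y = rsum U (Suc n) (\<lambda>i. ?h i \<odot> ?F (basis U n i))"
      using aff_eq y by (simp add: basis_def)
    also have "\<dots> = rsum U n (\<lambda>i. ?y i \<odot> ?F (basis U n i)) \<oplus> s \<odot> ?F (basis U n n)"
      using h_lt[of "\<lambda>z i. z \<odot> ?F (basis U n i)"] by simp
    also have "rsum U n (\<lambda>i. ?y i \<odot> ?F (basis U n i)) =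
        rsum U n (\<lambda>i. ?y i \<odot> (d j i \<cdot> t) \<oplus> ?y i \<odot> ?F (basis U n n))"
    proof (rule radd_upto_cong)
      fix i assume i: "i < n"
      show "?y i \<odot> ?F (basis U n i) =
          ?y i \<odot> (d j i \<cdot> t) \<oplus> ?y i \<odot> ?F (basis U n n)"
        unfolding dF[of i, symmetric] by (rule S.distribs(1)[OF yh[OF i] dt Fb])
    qed
    also have "\<dots> = rsum U n (\<lambda>i. ?y i \<odot> (d j i \<cdot> t)) \<oplus> rsum U n (\<lambda>i. ?y i \<odot> ?F (basis U n n))"
      using yh dt Fb[of n] by (intro S.sum_add) simp_all
    also have "rsum U n (\<lambda>i. ?y i \<odot> ?F (basis U n n)) =
        rsum U n ?y \<odot> ?F (basis U n n)"
      using yh Fb[of n] by (intro S.sum_mul[symmetric]) simp_all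
    also have "(rsum U n (\<lambda>i. ?y i \<odot> (d j i \<cdot> t)) \<oplus> rsum U n ?y \<odot> ?F (basis U n n)) \<oplus> s \<odot> ?F (basis U n n) =
        (s \<oplus> rsum U n ?y) \<odot> ?F (basis U n n) \<oplus> rsum U n (\<lambda>i. ?y i \<odot> (d j i \<cdot> t))"
    proof -
      have "rsum U n (\<lambda>i. ?y i \<odot> (d j i \<cdot> t)) \<in> el U"
        using yh dt by simp
      then show ?thesis
        using s(1) ysum Fb[of n] by (simp only: S.distribs S.closed S.ac)
    qed
    also have "\<dots> = ?F (basis U n n) \<oplus> rsum U n (\<lambda>i. ?y i \<odot> (d j i \<cdot> t))"
      unfolding s(2) using Fb[of n] by simp
    also have "\<dots> = ent (Suc n) m (B \<cdot> t) j 0 \<oplus> rsum U n (\<lambda>i. ?y i \<odot> ent (Suc n) m (B \<cdot> t) j (Suc i))"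
    proof -
      have e: "ent (Suc n) m (B \<cdot> t) j i = ?c j i \<cdot> t" if "i < Suc n" for i
        by (simp only: entry_comp[OF B j that t, symmetric] B_entry[OF j that])
      have e0: "ent (Suc n) m (B \<cdot> t) j 0 = ?F (basis U n n)"
        using e[of 0] at[of n] by simp
      have "rsum U n (\<lambda>i. ?y i \<odot> ent (Suc n) m (B \<cdot> t) j (Suc i)) =
          rsum U n (\<lambda>i. ?y i \<odot> (d j i \<cdot> t))"
        using e by (intro radd_upto_cong) simp
      then show ?thesis by (simp only: e0)
    qed
    also have "\<dots> = pr m j \<cdot> mval n m ((star_act n m \<cdot> B) \<cdot> t) y"
      using star_act_value[OF Comp_hom[OF t B] y j] by (simp only: Comp_assoc[OF t B star_act_hom])
    finally show "pr m j \<cdot> mval n m ((star_act n m \<cdot> B) \<cdot> t) y =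
        pr m j \<cdot> mval n m (f \<cdot> t) y" ..
  qed
  then show ?thesis
    using B hom_Dom[OF f] by (auto simp: factors_through_def)
qed

lemma factors_aff_iff:
  assumes f: "f \<in> hom V W (Exp V (vec n) (vec m))"
  shows "factors_through V f (aff_act n m) \<longleftrightarrow> star.commutes n m f"
  using star_commutes_factors[OF f] affine_commutes hom_Dom[OF aff_act_hom[of n m]]
  by (auto simp: factors_through_def)

lemma factors_star_iff:
  assumes f: "f \<in> hom V W (Exp V (vec n) (vec m))"
  shows "factors_through V f (star_act n m) \<longleftrightarrow> aff.commutes n m f"
  using aff_commutes_factors[OF f] pointed_commutes by (auto simp: factors_through_def)

section \<open>Affine spaces and pointed modules as mutual commutants\<close>

text \<open>
  Closure under powers holds for arrows that commute with all affine combinations, and by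
  \<open>factors_star_iff\<close> these are the arrows that belong to the theory.
\<close>

lemma star_subtheory: "subtheory V (Car R) (Mat_op_star V R) (star_act)"
proof unfold_locales
  show "vOb (Mat_op_star V R) = UNIV" by simp
  show "is_mono V (star_act n m)" for n m by (rule star_act_mono)
  show "vComp (Mat_op_star V R) n m l \<in> hom V
      (Prd V (vHom (Mat_op_star V R) m l) (vHom (Mat_op_star V R) n m)) (vHom (Mat_op_star V R) n l)" for n m l
    using star_comp_hom by simp
  show "star_act n l \<cdot> vcomp V (Mat_op_star V R) n m l g f =
      vcomp V (self V) (vec n) (vec m) (vec l) (star_act m l \<cdot> g) (star_act n m \<cdot> f)"
    if "f \<in> hom V W (vHom (Mat_op_star V R) n m)" "g \<in> hom V W (vHom (Mat_op_star V R) m l)" for f g n m l W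
    using that by (intro star_act_comp) simp_all
  show "vId (Mat_op_star V R) n \<in> hom V (One V) (vHom (Mat_op_star V R) n n)" for n
    using star_act_Id(1) by simp
  show "star_act n n \<cdot> vId (Mat_op_star V R) n = name V (vec n) (vec n) (Ide V (vec n))" for n
    by (rule star_act_Id(2))
  show "tProj (Mat_op_star V R) n i \<in> hom V (One V) (vHom (Mat_op_star V R) n 1)" if "i < n" for n i
    using star_act_tProj(1)[OF that] by simp
  show "star_act n 1 \<cdot> tProj (Mat_op_star V R) n i = name V (vec n) (Car R) (pr n i)"
    if "i < n" for n i by (rule star_act_tProj(2)[OF that])
  fix f W n m
  assume f: "f \<in> hom V W (Exp V (vec n) (vec m))"
    and rows: "\<And>j. j < m \<Longrightarrow> factors_through V (row (Car R) n m j f) (star_act n 1)"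
  have "aff.commutes n 1 (row (Car R) n m j f)" if "j < m" for j
    using rows[OF that] factors_star_iff[of "row (Car R) n m j f" W n 1] row_hom[OF Car_in_Ob f that] by simp
  then show "factors_through V f (star_act n m)"
    unfolding factors_star_iff[OF f] by (rule aff.commutes_rows[OF f])
qed

text \<open>
  The structure is that of all matrices, restricted to matrices whose rows sum to \<open>1\<close>; products
  preserve this condition. Closure under powers holds as before, with the two theories exchanged.
\<close>

lemma aff_subtheory: "subtheory V (Car R) (Mat_aff V R) (aff_act)"
proof unfold_locales
  show "vOb (Mat_aff V R) = UNIV" by simp
  show "is_mono V (aff_act n m)" for n m by (rule aff_act_mono)
  have comp_sums: "rsum W n (ent n l (vcomp V (Mat V R) n m l (aff m l \<cdot> g) (aff n m \<cdot> f)) k) = rone V R W"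
    if f: "f \<in> hom V W (affmat n m)" and g: "g \<in> hom V W (affmat m l)" and k: "k < l" for f g n m l W k
  proof -
    have W: "W \<in> Ob V" using f by (auto simp: hom_def)
    interpret S: rig_stage V R W by (rule rig_stageI[OF W])
    let ?a = "ent n m (aff n m \<cdot> f)" and ?b = "ent m l (aff m l \<cdot> g) k"
    note F = Comp_hom[OF f aff_hom] and G = Comp_hom[OF g aff_hom]
    have a: "?a j i \<in> el W" if "j < m" "i < n" for j i by (rule entry_hom[OF F that])
    have b: "?b j \<in> el W" if "j < m" for j by (rule entry_hom[OF G k that])
    have "rsum W n (ent n l (vcomp V (Mat V R) n m l (aff m l \<cdot> g) (aff n m \<cdot> f)) k) =
        rsum W n (\<lambda>i. rsum W m (\<lambda>j. ?b j \<odot> ?a j i))"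
      using Mat_vcomp_entry[OF F G k] by (intro radd_upto_cong) simp
    also have "\<dots> = rsum W m (\<lambda>j. rsum W n (\<lambda>i. ?b j \<odot> ?a j i))"
      using a b by (intro S.sum_swap) simp
    also have "\<dots> = rsum W m ?b"
    proof (rule radd_upto_cong)
      fix j assume j: "j < m"
      have "rsum W n (\<lambda>i. ?b j \<odot> ?a j i) = ?b j \<odot> rsum W n (?a j)"
        using a b j by (intro S.mul_sum[symmetric]) simp_all
      then show "rsum W n (\<lambda>i. ?b j \<odot> ?a j i) = ?b j"
        using aff_row_sum[OF f j] b[OF j] by simp
    qed
    also have "\<dots> = rone V R W" by (rule aff_row_sum[OF g k])
    finally show ?thesis .
  qed
  have comp: "vComp (Mat_aff V R) n m l \<in> hom V (Prd V (affmat m l) (affmat n m)) (affmat n l)"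
    "aff n l \<cdot> vComp (Mat_aff V R) n m l = vcomp V (Mat V R) n m l
      (aff m l \<cdot> Fst V (affmat m l) (affmat n m)) (aff n m \<cdot> Snd V (affmat m l) (affmat n m))" for n m l
  proof -
    have F: "Fst V (affmat m l) (affmat n m) \<in> hom V (Prd V (affmat m l) (affmat n m)) (affmat m l)"
      and S: "Snd V (affmat m l) (affmat n m) \<in> hom V (Prd V (affmat m l) (affmat n m)) (affmat n m)"
      by (simp_all add: hom_def)
    note k = aff_factor[OF Mat_vcomp_hom[OF Comp_hom[OF S aff_hom] Comp_hom[OF F aff_hom]] comp_sums[OF S F]]
    show "vComp (Mat_aff V R) n m l \<in> hom V (Prd V (affmat m l) (affmat n m)) (affmat n l)"
      unfolding Mat_aff_simps by (rule k(1))
    show "aff n l \<cdot> vComp (Mat_aff V R) n m l = vcomp V (Mat V R) n m l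
      (aff m l \<cdot> Fst V (affmat m l) (affmat n m)) (aff n m \<cdot> Snd V (affmat m l) (affmat n m))"
      unfolding Mat_aff_simps by (rule k(2))
  qed
  show "vComp (Mat_aff V R) n m l \<in> hom V
      (Prd V (vHom (Mat_aff V R) m l) (vHom (Mat_aff V R) n m)) (vHom (Mat_aff V R) n l)" for n m l
    using comp(1) by (simp only: Mat_aff_simps(2))
  show "aff_act n l \<cdot> vcomp V (Mat_aff V R) n m l g f =
      vcomp V (self V) (vec n) (vec m) (vec l) (aff_act m l \<cdot> g) (aff_act n m \<cdot> f)"
    if "f \<in> hom V W (vHom (Mat_aff V R) n m)" "g \<in> hom V W (vHom (Mat_aff V R) m l)" for f g n m l W
  proof -
    have f: "f \<in> hom V W (affmat n m)" and g: "g \<in> hom V W (affmat m l)"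
      using that by (simp_all only: Mat_aff_simps(2))
    let ?P = "Prd V (affmat m l) (affmat n m)"
    have p: "pair V g f \<in> hom V W ?P" and Fp: "Fst V (affmat m l) (affmat n m) \<cdot> pair V g f = g"
      and Sp: "Snd V (affmat m l) (affmat n m) \<cdot> pair V g f = f"
      using f g by (simp_all add: hom_def)
    have F: "Fst V (affmat m l) (affmat n m) \<in> hom V ?P (affmat m l)"
      and S: "Snd V (affmat m l) (affmat n m) \<in> hom V ?P (affmat n m)"
      by (simp_all add: hom_def)
    have c: "vcomp V (Mat_aff V R) n m l g f \<in> hom V W (affmat n l)"
      unfolding vcomp_def by (rule Comp_hom[OF p comp(1)])
    have "aff n l \<cdot> vcomp V (Mat_aff V R) n m l g f =
        vcomp V (Mat V R) n m l (aff m l \<cdot> Fst V (affmat m l) (affmat n m))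
          (aff n m \<cdot> Snd V (affmat m l) (affmat n m)) \<cdot> pair V g f"
      unfolding vcomp_def[of V "Mat_aff V R"]
      by (simp only: Comp_assoc[OF p comp(1) aff_hom, symmetric] comp(2))
    also have "\<dots> = vcomp V (Mat V R) n m l (aff m l \<cdot> g) (aff n m \<cdot> f)"
      by (simp only: vcomp_precomp[OF Mat_comp_hom Comp_hom[OF F aff_hom] Comp_hom[OF S aff_hom] p]
          Comp_assoc[OF p F aff_hom] Comp_assoc[OF p S aff_hom] Fp Sp)
    finally show ?thesis
      using Mat_act_comp[OF Comp_hom[OF f aff_hom] Comp_hom[OF g aff_hom]]
      by (simp only: aff_act_assoc[OF c] aff_act_assoc[OF f] aff_act_assoc[OF g])
  qed
  have one_sum: "rsum (One V) n (ent n m u j) = rone V R (One V)"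
    if u: "u = mat_of V R (One V) n m (\<lambda>j i. if P j i then rone V R (One V) else rzero V R (One V))"
      and j: "j < m" and i: "p < n" "\<And>i. P j i \<longleftrightarrow> i = p" for n m u P p j
  proof -
    interpret S: rig_stage V R "One V" by (rule rig_stageI) simp
    have I: "Ide V (One V) \<in> hom V (One V) (One V)" by (simp add: hom_def)
    have "u \<cdot> Ide V (One V) = u" using one_entry(1)[OF u] by (simp add: hom_def)
    then have e: "ent n m u j i = (if P j i then rone V R (One V) else rzero V R (One V))" if "i < n" for i
      using one_entry(2)[OF u I j that] by simp
    have "rsum (One V) n (ent n m u j) = ent n m u j p"
      using e i by (intro S.sum_single) simp_all
    then show ?thesis using e i by simp
  qed
  have id: "vId (Mat_aff V R) n \<in> hom V (One V) (affmat n n)"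
      "aff n n \<cdot> vId (Mat_aff V R) n = vId (Mat V R) n" for n
  proof -
    have "vId (Mat V R) n = mat_of V R (One V) n n
        (\<lambda>j i. if j = i then rone V R (One V) else rzero V R (One V))" by (simp add: Mat_def)
    then have "rsum (One V) n (ent n n (vId (Mat V R) n) j) = rone V R (One V)" if "j < n" for j
      using that by (rule one_sum[where p = j]) (use that in auto)
    note k = aff_factor[OF Mat_act_Id(1) this]
    show "vId (Mat_aff V R) n \<in> hom V (One V) (affmat n n)" "aff n n \<cdot> vId (Mat_aff V R) n = vId (Mat V R) n"
      using k by simp_all
  qed
  show "vId (Mat_aff V R) n \<in> hom V (One V) (vHom (Mat_aff V R) n n)" for n
    using id(1) by (simp only: Mat_aff_simps(2))
  show "aff_act n n \<cdot> vId (Mat_aff V R) n = name V (vec n) (vec n) (Ide V (vec n))" for n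
    by (simp only: aff_act_assoc[OF id(1)] id(2) Mat_act_Id(2))
  have pr: "tProj (Mat_aff V R) n i \<in> hom V (One V) (affmat n 1)"
    "aff n 1 \<cdot> tProj (Mat_aff V R) n i = tProj (Mat V R) n i" if i: "i < n" for n i
  proof -
    have "tProj (Mat V R) n i = mat_of V R (One V) n 1
        (\<lambda>_ i'. if i' = i then rone V R (One V) else rzero V R (One V))" by (simp add: Mat_def)
    then have "rsum (One V) n (ent n 1 (tProj (Mat V R) n i) j) = rone V R (One V)" if "j < 1" for j
      using that by (rule one_sum[where p = i]) (use i in auto)
    note k = aff_factor[OF Mat_act_tProj(1)[OF i] this]
    show "tProj (Mat_aff V R) n i \<in> hom V (One V) (affmat n 1)"
      "aff n 1 \<cdot> tProj (Mat_aff V R) n i = tProj (Mat V R) n i"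
      using k by simp_all
  qed
  show "tProj (Mat_aff V R) n i \<in> hom V (One V) (vHom (Mat_aff V R) n 1)" if "i < n" for n i
    using pr(1)[OF that] by (simp only: Mat_aff_simps(2))
  show "aff_act n 1 \<cdot> tProj (Mat_aff V R) n i = name V (vec n) (Car R) (pr n i)"
    if "i < n" for n i
    by (simp only: aff_act_assoc[OF pr(1)[OF that]] pr(2)[OF that] Mat_act_tProj(2)[OF that])
  fix f W n m
  assume f: "f \<in> hom V W (Exp V (vec n) (vec m))"
    and rows: "\<And>j. j < m \<Longrightarrow> factors_through V (row (Car R) n m j f) (aff_act n 1)"
  have "star.commutes n 1 (row (Car R) n m j f)" if "j < m" for j
    using rows[OF that] factors_aff_iff[of "row (Car R) n m j f" W n 1] row_hom[OF Car_in_Ob f that] by simp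
  then show "factors_through V f (aff_act n m)"
    unfolding factors_aff_iff[OF f] by (rule star.commutes_rows[OF f])
qed

lemma mutual_commutants_aff_star:
  "mutual_commutants V (Car R) (Mat_aff V R, aff_act) (Mat_op_star V R, star_act)"
proof -
  interpret aff_rep: commutant_representation V "Car R" "Mat_op_star V R" "star_act" "aff_act"
    using aff_act_mono hom_Cod[OF aff_act_hom] factors_aff_iff
    by (intro commutant_representation.intro star_subtheory commutant_representation_axioms.intro) simp_all
  interpret star_rep: commutant_representation V "Car R" "Mat_aff V R" "aff_act" "star_act"
    using star_act_mono factors_star_iff
    by (intro commutant_representation.intro aff_subtheory commutant_representation_axioms.intro) simp_all
  show ?thesis
    unfolding mutual_commutants_def
    using aff_rep.isomorphic_commutant[OF aff_subtheory] star_rep.isomorphic_commutant[OF star_subtheory]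
    by simp
qed

end

theorem theorem10p5:
  fixes V :: "('o, 'a) ccc" and R :: "('o, 'a) rig"
  assumes "cartesian_closed V"
    and "has_equalizers V"
    and "has_countable_colimits V"
    and "has_countable_strong_intersections V"
    and "ring_in V R"
  shows "mutual_commutants V (Car R) (Mat_aff V R, Mat_aff_act V R)
           (Mat_op_star V R, Mat_op_star_act V R)"
proof -
  interpret ring_with_equalizers V R
    using assms(2,5) by (simp add: ring_with_equalizers_def ring_with_equalizers_axioms_def)
  show ?thesis by (rule mutual_commutants_aff_star)
qed

end
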